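(* Let $S\in\mathbb{R}^{d\times d}$ be symmetric positive definite, $b\in\mathbb{R}^d$, $A$ a real matrix with $d$ rows, and let $(x_n)$ be the LPSA iterates described in the context for the problem of minimizing $\frac12x^\top Sx-b^\top x$ subject to $A^\top x=0$, whose minimizer is $x^\star$. Assume that $\|\Sigma(x)-\Sigma(y)\|\le L\|x-y\|$ for all $x,y$ and some $L$, that $\sup_n\mathbb{E}\|\xi_n\|^q<\infty$ for some $q>2$, and that $(A,S,b)$ has degenerate order $k$ with $1\le k<\infty$, i.e. $P_{A^\perp}S^i(Sx^\star-b)=0$ for $i=0,\dots,k-1$ and $P_{A^\perp}S^k(Sx^\star-b)\ne0$. Let $\eta_n=\eta_0n^{-\alpha}$, $p_n=\min\{\gamma\eta_n^\beta,1\}$ with $\gamma>0$, $0<\alpha\le1$, $0\le\beta<1$ and $\eta_0>2k\,\mathbb{1}_{\{\alpha=1\}}/\lambda_{\min}(S)$ (and $\eta_0>0$). Put $u_n=P_{A^\perp}x_n$. Let $\tilde\Sigma$ satisfy the Lyapunov equation $$P_{A^\perp}\Big(S-\tfrac1{2\eta_0}\mathbb{1}_{\{\alpha=1\}}I_d\Big)P_{A^\perp}\tilde\Sigma+\tilde\Sigma P_{A^\perp}\Big(S-\tfrac1{2\eta_0}\mathbb{1}_{\{\alpha=1\}}I_d\Big)P_{A^\perp}=P_{A^\perp}\Sigma(x^\star)P_{A^\perp}$$ and let $$m_k=\frac{(-1)^{k+1}}{\gamma^k}\Big[P_{A^\perp}\Big(S-\tfrac{k(1-\beta)}{\eta_0}\mathbb{1}_{\{\alpha=1\}}I_d\Big)P_{A^\perp}\Big]^\dagger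 P_{A^\perp}S^k(Sx^\star-b),$$ with $\dagger$ the pseudoinverse. Then, as $n\to\infty$: (i) if $0<\beta<1-\frac1{2k}$, then $\frac{u_n-x^\star}{\sqrt{\eta_{n-1}}}$ converges weakly to $\mathcal N(0,\tilde\Sigma)$; (ii) if $1-\frac1{2k}<\beta<1$, then $\frac{u_n-x^\star}{\eta_{n-1}^{k(1-\beta)}}$ converges in $L_2$ to the vector $m_k$, which is non-zero; (iii) if $\beta=1-\frac1{2k}$, then $\frac{u_n-x^\star}{\sqrt{\eta_{n-1}}}$ converges weakly to $\mathcal N(m_k,\tilde\Sigma)$.
   Context: $P_A$ is the orthogonal projection of $\mathbb{R}^d$ onto the column space of $A$, and $P_{A^\perp}=I_d-P_A$ the orthogonal projection onto the null space of $A^\top$; $\lambda_{\min}(S)$ is the smallest eigenvalue of $S$. LPSA for this problem: starting from a deterministic point $x_1$, for $n\ge1$, $$x_{n+1/2}=x_n-\eta_n(Sx_n-b)+\eta_n\xi_n,$$ and, given an independent coin $\omega_n\sim\mathrm{Bernoulli}(p_n)$, $x_{n+1}=P_{A^\perp}x_{n+1/2}$ if $\omega_n=1$ and $x_{n+1}=x_{n+1/2}$ if $\omega_n=0$. Here $\xi_n$ is stochastic gradient noise: there is an i.i.d. sequence $\zeta_n\sim\mathcal D$ (independent of the coins) and unbiased stochastic gradients $\nabla f(x,\zeta)$ of $f(x)=\frac12x^\top Sx-b^\top x$ with $\xi_n=\nabla f(x_n)-\nabla f(x_n,\zeta_n)$; so with $\mathcal F_n=\sigma(\zeta_k,\omega_k:k<n)$,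 $\mathbb{E}[\xi_n\mid\mathcal F_n]=0$ and $\mathbb{E}[\xi_n\xi_n^\top\mid\mathcal F_n]=\Sigma(x_n)$, where $\Sigma(x)$ is the covariance matrix of $\nabla f(x,\zeta)$. $\|\cdot\|$ is the Euclidean norm for vectors and the spectral norm for matrices. Since $u_n-x^\star$ lies in the null space of $A^\top$, $\tilde\Sigma$ is the positive semidefinite solution with $P_{A^\perp}\tilde\Sigma=\tilde\Sigma$. *)

theory Defs
  imports "HOL-Probability.Probability"
begin

section \<open>Linear algebra\<close>

definition spd :: "real^'d^'d \<Rightarrow> bool" where
  "spd S \<longleftrightarrow> transpose S = S \<and> (\<forall>x. x \<noteq> 0 \<longrightarrow> x \<bullet> (S *v x) > 0)"

definition psd :: "real^'d^'d \<Rightarrow> bool" where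
  "psd S \<longleftrightarrow> transpose S = S \<and> (\<forall>x. x \<bullet> (S *v x) \<ge> 0)"

definition lambda_min :: "real^'d^'d \<Rightarrow> real" where
  "lambda_min S = Min {l. \<exists>v. v \<noteq> 0 \<and> S *v v = l *\<^sub>R v}"

text \<open>The norm of the type \<open>real^'d^'d\<close> is the Frobenius norm, hence a separate notion.\<close>

definition spectral_norm :: "real^'d^'d \<Rightarrow> real" where
  "spectral_norm M = onorm (\<lambda>x. M *v x)"

text \<open>The operations \<open>(*)\<close> and \<open>(^)\<close> on the type \<open>real^'d^'d\<close> act componentwise, so powers
  with respect to the matrix product need their own definition.\<close>

primrec matpow :: "real^'d^'d \<Rightarrow> nat \<Rightarrow> real^'d^'d" where
  "matpow M 0 = mat 1"
| "matpow M (Suc n) = M ** matpow M n"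

definition orth_proj :: "(real^'d) set \<Rightarrow> real^'d^'d" where
  "orth_proj V = matrix (\<lambda>x. THE y. y \<in> V \<and> (\<forall>v\<in>V. orthogonal (x - y) v))"

text \<open>\<open>P\<^sub>A\<close> and \<open>P\<close> for the orthogonal complement \<open>A\<^sup>\<bottom>\<close>.\<close>

definition proj_col :: "real^'m^'d \<Rightarrow> real^'d^'d" where
  "proj_col A = orth_proj (span (columns A))"

definition proj_perp :: "real^'m^'d \<Rightarrow> real^'d^'d" where
  "proj_perp A = mat 1 - proj_col A"

text \<open>Moore--Penrose pseudoinverse, through the four Penrose equations.\<close>

definition pinv :: "real^'n^'m \<Rightarrow> real^'m^'n" where
  "pinv M = (THE X. M ** X ** M = M \<and> X ** M ** X = X \<and>
     transpose (M ** X) = M ** X \<and> transpose (X ** M) = X ** M)"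

section \<open>The optimization problem\<close>

definition quad_obj :: "real^'d^'d \<Rightarrow> real^'d \<Rightarrow> real^'d \<Rightarrow> real" where
  "quad_obj S b x = (x \<bullet> (S *v x)) / 2 - b \<bullet> x"

definition constrained_minimizer :: "real^'m^'d \<Rightarrow> real^'d^'d \<Rightarrow> real^'d \<Rightarrow> real^'d \<Rightarrow> bool" where
  "constrained_minimizer A S b x \<longleftrightarrow> is_arg_min (quad_obj S b) (\<lambda>y. transpose A *v y = 0) x"

definition degenerate_order ::
    "real^'m^'d \<Rightarrow> real^'d^'d \<Rightarrow> real^'d \<Rightarrow> real^'d \<Rightarrow> nat \<Rightarrow> bool" where
  "degenerate_order A S b xstar k \<longleftrightarrow>
     (\<forall>i<k. proj_perp A *v (matpow S i *v (S *v xstar - b)) = 0) \<and>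
     proj_perp A *v (matpow S k *v (S *v xstar - b)) \<noteq> 0"

section \<open>Probability\<close>

definition cov_matrix :: "'z measure \<Rightarrow> ('z \<Rightarrow> real^'d) \<Rightarrow> real^'d^'d" where
  "cov_matrix D X = (\<chi> i j. \<integral>z. (X z $ i - (\<integral>y. X y $ i \<partial>D)) * (X z $ j - (\<integral>y. X y $ j \<partial>D)) \<partial>D)"

definition std_normal_vec :: "(real^'d) measure" where
  "std_normal_vec = density lborel (\<lambda>z. ennreal (\<Prod>i\<in>UNIV. std_normal_density (z $ i)))"

text \<open>The law of \<open>m + B Z\<close>, where \<open>Z\<close> is standard normal and \<open>B B\<^sup>T = C\<close>; it does not depend on
  the choice of \<open>B\<close>, which exists for every positive semidefinite \<open>C\<close>. Singular \<open>C\<close> is allowed.\<close>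

definition multi_normal :: "real^'d \<Rightarrow> real^'d^'d \<Rightarrow> (real^'d) measure" where
  "multi_normal m C =
     distr std_normal_vec borel (\<lambda>z. m + (SOME B :: real^'d^'d. B ** transpose B = C) *v z)"

text \<open>\<open>indep_vars\<close> would require all variables to have the same range type. The joint independence of
  the samples \<open>\<zeta> n\<close> and the coins \<open>\<omega> n\<close> is therefore stated for the sigma-algebras they generate,
  indexed by the disjoint sum.\<close>

definition joint_events ::
    "'a measure \<Rightarrow> 'z measure \<Rightarrow> (nat \<Rightarrow> 'a \<Rightarrow> 'z) \<Rightarrow> (nat \<Rightarrow> 'a \<Rightarrow> bool) \<Rightarrow> nat + nat \<Rightarrow> 'a set set" where
  "joint_events M D \<zeta> \<omega> = case_sum
     (\<lambda>n. {\<zeta> n -` B \<inter> space M | B. B \<in> sets D})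
     (\<lambda>n. {\<omega> n -` C \<inter> space M | C. C \<in> UNIV})"

text \<open>The library's weak convergence of measures is confined to the real line.\<close>

definition weak_conv_borel ::
    "(nat \<Rightarrow> 'b::topological_space measure) \<Rightarrow> 'b measure \<Rightarrow> bool" where
  "weak_conv_borel \<mu> \<nu> \<longleftrightarrow>
     (\<forall>f::'b \<Rightarrow> real. continuous_on UNIV f \<and> bounded (range f) \<longrightarrow>
        (\<lambda>n. \<integral>x. f x \<partial>(\<mu> n)) \<longlonglongrightarrow> (\<integral>x. f x \<partial>\<nu>))"

definition conv_in_law ::
    "'a measure \<Rightarrow> (nat \<Rightarrow> 'a \<Rightarrow> 'b::topological_space) \<Rightarrow> 'b measure \<Rightarrow> bool" where
  "conv_in_law M X \<nu> \<longleftrightarrow> weak_conv_borel (\<lambda>n. distr M borel (X n)) \<nu>"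

definition conv_in_L2 ::
    "'a measure \<Rightarrow> (nat \<Rightarrow> 'a \<Rightarrow> 'b::real_normed_vector) \<Rightarrow> ('a \<Rightarrow> 'b) \<Rightarrow> bool" where
  "conv_in_L2 M X Y \<longleftrightarrow> (\<lambda>n. \<integral>\<^sup>+w. ennreal ((norm (X n w - Y w))\<^sup>2) \<partial>M) \<longlonglongrightarrow> 0"

end

theory Submission
  imports Defs "HOL-Real_Asymp.Real_Asymp"
begin

text \<open>
Split \<open>x\<^sub>n - x\<^sup>\<star>\<close> into the error \<open>e\<^sub>n = P x\<^sub>n - x\<^sup>\<star>\<close> and the component \<open>v\<^sub>n\<close> orthogonal to the constraint
space. The error obeys \<open>e\<^sub>n\<^sub>+\<^sub>1 = (I - \<eta>\<^sub>n P S P) e\<^sub>n - \<eta>\<^sub>n P S v\<^sub>n + \<eta>\<^sub>n P \<xi>\<^sub>n\<close>, while \<open>v\<^sub>n\<close> is killed by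
every projection and in between drifts along the vectors \<open>S\<^sup>i (S x\<^sup>\<star> - b)\<close>, of which only the \<open>k\<close>-th
is seen by \<open>P\<close>. Hence, up to a remainder that is negligible in \<open>L\<^sub>2\<close>, \<open>P S v\<^sub>n\<close> is a scalar \<open>a\<^sub>n\<close>,
depending on the coins only, times \<open>P S\<^sup>k (S x\<^sup>\<star> - b)\<close>. Its mean behaves like
\<open>(- \<eta>\<^sub>n\<^sup>1\<^sup>-\<^sup>\<beta> / \<gamma>)\<^sup>k\<close> and produces the bias \<open>m\<^sub>k\<close>. Its fluctuations are of the same order, but they
decorrelate after about \<open>1 / p\<^sub>n\<close> steps and are averaged out by \<open>e\<^sub>n\<close>; this is read off from a
recursion for the covariances of \<open>e\<^sub>n\<close> with the coefficients.

What remains is the linear recursion driven by the martingale differences \<open>\<xi>\<^sub>n\<close>. Its characteristic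
function at \<open>t\<close> is compared with \<open>exp (- \<eta>\<^sub>n t\<^sup>T \<Sigma>\<^sub>t t / 2)\<close>, uniformly in \<open>t\<close> up to
\<open>A\<^sub>n |t|\<^sup>2 + B\<^sub>n |t|\<^sup>r\<close>: the Lyapunov equation says exactly that the Gaussian satisfies the same recursion up
to higher order, so that \<open>A\<^sub>n\<close> and \<open>B\<^sub>n\<close> satisfy contractive scalar recursions.
\<close>

section \<open>Recursive inequalities\<close>

text \<open>The obstacle is the fluctuation of \<open>coef n w k\<close> about its mean: by
  Cauchy-Schwarz its covariance with the error that it drives is only of the order of the squared
  bias. The covariances with all coefficients form a triangular system: each is fed by the previous
  one and by covariances among coefficients, and is forgotten at rate \<open>p n\<close>, which
  yields a factor \<eta>/p of order \<eta>^(1-\<beta>) per level. The zeroth coefficient is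
  constant, so the system starts from 0, and at level k one factor more than needed has been gained.
  Orders come from one comparison principle, \<open>tracks\<close>: a recursion of gain c follows a
  forcing of size s if s decays more slowly than the recursion contracts. For \<alpha> = 1 the gain
  \<mu> * \<eta> is of order 1/n, like the relative decay of a power of \<eta>; the lower bound on
  \<open>eta0\<close> lets powers up to 2k be tracked, which covers the squared bias. The bound on
  characteristic functions must be uniform in t since every step replaces t by \<open>L n t\<close>.
  It is read off at t / sqrt \<eta>, so its two coefficients have to be o(\<eta>) and
  o(\<eta>^(r/2)).\<close>

lemma contraction_tendsto_zero:
  fixes z c h :: "nat \<Rightarrow> real"
  assumes c: "\<forall>\<^sub>F n in sequentially. 0 \<le> c n \<and> c n \<le> 1" "\<not> summable c"
    and z: "\<forall>\<^sub>F n in sequentially. 0 \<le> z n"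
    and rec: "\<forall>\<^sub>F n in sequentially. z (Suc n) \<le> (1 - c n) * z n + c n * h n"
    and h: "h \<longlonglongrightarrow> 0"
  shows "z \<longlonglongrightarrow> 0"
proof (rule LIMSEQ_I)
  fix r :: real assume "0 < r"
  define \<epsilon> where "\<epsilon> = r / 2"
  have \<epsilon>: "0 < \<epsilon>" using \<open>0 < r\<close> by (simp add: \<epsilon>_def)
  have "\<forall>\<^sub>F n in sequentially. h n < \<epsilon>" using order_tendstoD(2)[OF h \<epsilon>] .
  then have "\<forall>\<^sub>F n in sequentially. h n < \<epsilon> \<and> 0 \<le> c n \<and> c n \<le> 1 \<and> 0 \<le> z n \<and>
      z (Suc n) \<le> (1 - c n) * z n + c n * h n"
    using c(1) z rec by eventually_elim auto
  then obtain N where N: "\<And>n. n \<ge> N \<Longrightarrow> h n < \<epsilon>" "\<And>n. n \<ge> N \<Longrightarrow> 0 \<le> c n"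
    "\<And>n. n \<ge> N \<Longrightarrow> c n \<le> 1" "\<And>n. n \<ge> N \<Longrightarrow> 0 \<le> z n"
    "\<And>n. n \<ge> N \<Longrightarrow> z (Suc n) \<le> (1 - c n) * z n + c n * h n"
    by (auto simp: eventually_sequentially)
  \<comment> \<open>The excess over \<epsilon> obeys the recursion without forcing. If it never fell
    below \<epsilon>, it would lose at least c * \<epsilon> per step and the sums of c would stay
    bounded; once below \<epsilon> it remains there, as c lies in [0, 1].\<close>
  define d where "d n = max (z (n + N) - \<epsilon>) 0" for n
  have d0: "0 \<le> d n" for n by (simp add: d_def)
  have dS: "d (Suc n) \<le> (1 - c (n + N)) * d n" for n
  proof -
    have "z (Suc (n + N)) - \<epsilon> \<le> (1 - c (n + N)) * z (n + N) + c (n + N) * \<epsilon> - \<epsilon>"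
      using N(5)[of "n + N"] mult_left_mono[OF less_imp_le[OF N(1)[of "n + N"]] N(2)[of "n + N"]]
      by simp
    also have "\<dots> = (1 - c (n + N)) * (z (n + N) - \<epsilon>)" by (simp add: algebra_simps)
    also have "\<dots> \<le> (1 - c (n + N)) * d n"
      using N(3)[of "n + N"] by (intro mult_left_mono) (auto simp: d_def)
    finally show ?thesis using N(3)[of "n + N"] d0[of n] by (simp add: d_def)
  qed
  have ex: "\<exists>m. d m < \<epsilon>"
  proof (rule ccontr)
    assume "\<not> ?thesis"
    then have dge: "\<epsilon> \<le> d m" for m by (meson not_less)
    have "(\<Sum>i<m. c (i + N)) * \<epsilon> \<le> d 0 - d m" for m
    proof (induction m)
      case (Suc m)
      have "c (m + N) * \<epsilon> \<le> c (m + N) * d m"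
        using N(2)[of "m + N"] dge by (intro mult_left_mono) auto
      then show ?case using Suc dS[of m] by (simp add: algebra_simps)
    qed simp
    then have "(\<Sum>i<m. c (i + N)) \<le> d 0 / \<epsilon>" for m
      using d0[of m] \<epsilon> by (smt (verit) pos_le_divide_eq)
    then have "summable (\<lambda>i. c (i + N))"
      using N(2) by (intro summableI_nonneg_bounded) auto
    then show False using c(2) by (simp add: summable_iff_shift)
  qed
  then obtain m where m: "d m < \<epsilon>" by blast
  have dm: "d (m + j) < \<epsilon>" for j
  proof (induction j)
    case (Suc j)
    have "(1 - c (m + j + N)) * d (m + j) \<le> 1 * d (m + j)"
      using N(2)[of "m + j + N"] d0 by (intro mult_right_mono) auto
    then show ?case using Suc dS[of "m + j"] by simp
  qed (use m in simp)
  show "\<exists>no. \<forall>n\<ge>no. norm (z n - 0) < r"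
  proof (intro exI[of _ "m + N"] allI impI)
    fix n assume n: "n \<ge> m + N"
    have "d (m + (n - m - N)) < \<epsilon>" by (rule dm)
    then have "z n - \<epsilon> < \<epsilon>" using n by (simp add: d_def)
    then show "norm (z n - 0) < r" using N(4)[of n] n by (simp add: \<epsilon>_def)
  qed
qed

lemma contraction_bounded:
  fixes z c h :: "nat \<Rightarrow> real"
  assumes c: "\<forall>\<^sub>F n in sequentially. 0 \<le> c n \<and> c n \<le> 1"
    and rec: "\<forall>\<^sub>F n in sequentially. z (Suc n) \<le> (1 - c n) * z n + c n * h n"
    and h: "\<forall>\<^sub>F n in sequentially. h n \<le> B"
  shows "\<exists>C. \<forall>\<^sub>F n in sequentially. z n \<le> C"
proof -
  have "\<forall>\<^sub>F n in sequentially. h n \<le> B \<and> 0 \<le> c n \<and> c n \<le> 1 \<and>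
      z (Suc n) \<le> (1 - c n) * z n + c n * h n"
    using c h rec by eventually_elim auto
  then obtain N where N: "\<And>n. n \<ge> N \<Longrightarrow> h n \<le> B" "\<And>n. n \<ge> N \<Longrightarrow> 0 \<le> c n"
    "\<And>n. n \<ge> N \<Longrightarrow> c n \<le> 1" "\<And>n. n \<ge> N \<Longrightarrow> z (Suc n) \<le> (1 - c n) * z n + c n * h n"
    by (auto simp: eventually_sequentially)
  \<comment> \<open>The right-hand side of the recursion is a convex combination, so the larger of
    starting value and forcing is never exceeded.\<close>
  have "z n \<le> max (z N) B" if "n \<ge> N" for n
    using that
  proof (induction n rule: dec_induct)
    case (step n)
    have "z (Suc n) \<le> (1 - c n) * max (z N) B + c n * max (z N) B"
      using N[of n] step
      by (intro order_trans[OF N(4)[of n]] add_mono mult_left_mono) auto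
    then show ?case by (simp add: algebra_simps)
  qed simp
  then show ?thesis unfolding eventually_sequentially by blast
qed

text \<open>The gain \<open>c\<close> is large enough for a recursion \<open>x (n + 1) \<le> (1 - c n) x n + c n y n\<close> to
  track perturbations \<open>y\<close> of size \<open>s\<close>.\<close>

definition tracks :: "(nat \<Rightarrow> real) \<Rightarrow> (nat \<Rightarrow> real) \<Rightarrow> bool" where
  "tracks c s \<longleftrightarrow> (\<forall>\<^sub>F n in sequentially. 0 \<le> c n \<and> c n \<le> 1) \<and> \<not> summable c \<and>
     (\<forall>\<^sub>F n in sequentially. 0 < s n) \<and>
     (\<exists>\<theta><1. \<forall>\<^sub>F n in sequentially. (1 - \<theta> * c n) * s n \<le> s (Suc n))"

text \<open>Since s loses at most a factor 1 - \<theta> * c per step, the ratio x / s is again a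
  contraction, with the reduced gain \<kappa> = 1 - \<theta>. One factor 1 / \<kappa> comes from
  dividing by the lower bound for that loss, the other compensates for the smaller gain.\<close>

lemma tracks_normalized:
  fixes x y c s :: "nat \<Rightarrow> real"
  assumes cs: "tracks c s"
    and x: "\<forall>\<^sub>F n in sequentially. 0 \<le> x n"
    and rec: "\<forall>\<^sub>F n in sequentially. x (Suc n) \<le> (1 - c n) * x n + c n * y n"
  obtains \<kappa> where "0 < \<kappa>" "\<kappa> \<le> 1"
    "\<forall>\<^sub>F n in sequentially. x (Suc n) / s (Suc n) \<le>
       (1 - \<kappa> * c n) * (x n / s n) + \<kappa> * c n * (\<bar>y n\<bar> / s n / \<kappa>\<^sup>2)"
proof -
  from cs obtain \<theta>0 where \<theta>0: "\<theta>0 < 1"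
    "\<forall>\<^sub>F n in sequentially. (1 - \<theta>0 * c n) * s n \<le> s (Suc n)"
    and c: "\<forall>\<^sub>F n in sequentially. 0 \<le> c n \<and> c n \<le> 1" and s: "\<forall>\<^sub>F n in sequentially. 0 < s n"
    by (auto simp: tracks_def)
  define \<theta> where "\<theta> = max \<theta>0 0"
  define \<kappa> where "\<kappa> = 1 - \<theta>"
  have \<theta>: "0 \<le> \<theta>" "\<theta> < 1" using \<theta>0 by (auto simp: \<theta>_def)
  have \<kappa>: "0 < \<kappa>" "\<kappa> \<le> 1" using \<theta> by (auto simp: \<kappa>_def)
  have sS: "\<forall>\<^sub>F n in sequentially. 0 < s (Suc n)"
    using s eventually_sequentially_Suc[of "\<lambda>n. 0 < s n"] by simp
  have "\<forall>\<^sub>F n in sequentially. x (Suc n) / s (Suc n) \<le>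
       (1 - \<kappa> * c n) * (x n / s n) + \<kappa> * c n * (\<bar>y n\<bar> / s n / \<kappa>\<^sup>2)"
    using \<theta>0(2) c s sS x rec
  proof eventually_elim
    case (elim n)
    define t where "t = 1 - \<theta> * c n"
    have "\<theta> * c n \<le> \<theta> * 1" using elim \<theta> by (intro mult_left_mono) auto
    then have t: "\<kappa> \<le> t" "0 < t" using \<kappa> by (auto simp: t_def \<kappa>_def)
    have "t * s n \<le> (1 - \<theta>0 * c n) * s n"
      using elim by (intro mult_right_mono) (auto simp: t_def \<theta>_def intro!: mult_right_mono)
    then have ts: "t * s n \<le> s (Suc n)" using elim by linarith
    have nn: "0 \<le> (1 - c n) * x n + c n * \<bar>y n\<bar>" using elim by (intro add_nonneg_nonneg mult_nonneg_nonneg) auto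
    have "x (Suc n) / s (Suc n) \<le> ((1 - c n) * x n + c n * \<bar>y n\<bar>) / s (Suc n)"
      using elim by (intro divide_right_mono order_trans[OF elim(6)] add_left_mono mult_left_mono) auto
    also have "\<dots> \<le> ((1 - c n) * x n + c n * \<bar>y n\<bar>) / (t * s n)"
      using nn ts elim t by (intro divide_left_mono mult_pos_pos) auto
    also have "\<dots> = (1 - c n) / t * (x n / s n) + c n * (\<bar>y n\<bar> / s n) / t"
      using elim t by (simp add: field_simps)
    also have "\<dots> \<le> (1 - \<kappa> * c n) * (x n / s n) + c n * (\<bar>y n\<bar> / s n) / \<kappa>"
    proof (intro add_mono mult_right_mono divide_left_mono)
      \<comment> \<open>With \<kappa> + \<theta> = 1 the terms of first order in c agree and the
        quadratic one has the favourable sign; this is where \<theta> must be nonnegative.\<close>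
      have "(1 - \<kappa> * c n) * t = 1 - c n + \<theta> * \<kappa> * (c n)\<^sup>2"
        by (simp add: t_def \<kappa>_def algebra_simps power2_eq_square)
      then have "1 - c n \<le> (1 - \<kappa> * c n) * t" using \<theta> \<kappa> by simp
      then show "(1 - c n) / t \<le> 1 - \<kappa> * c n" using t by (simp add: pos_divide_le_eq)
    qed (use elim t \<kappa> in auto)
    also have "c n * (\<bar>y n\<bar> / s n) / \<kappa> = \<kappa> * c n * (\<bar>y n\<bar> / s n / \<kappa>\<^sup>2)"
      using \<kappa> by (simp add: power2_eq_square)
    finally show ?case .
  qed
  then show ?thesis using that \<kappa> by blast
qed

text \<open>Most rates below come from this lemma or its little-o version: a nonnegative quantity is
  shown to contract, and its forcing has a known order.\<close>

lemma tracks_bigo: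
  fixes x y c s :: "nat \<Rightarrow> real"
  assumes cs: "tracks c s"
    and x: "\<forall>\<^sub>F n in sequentially. 0 \<le> x n"
    and rec: "\<forall>\<^sub>F n in sequentially. x (Suc n) \<le> (1 - c n) * x n + c n * y n"
    and y: "y \<in> O(s)"
  shows "x \<in> O(s)"
proof -
  from tracks_normalized[OF cs x rec] obtain \<kappa> where \<kappa>: "0 < \<kappa>" "\<kappa> \<le> 1" and
    rec': "\<forall>\<^sub>F n in sequentially. x (Suc n) / s (Suc n) \<le>
       (1 - \<kappa> * c n) * (x n / s n) + \<kappa> * c n * (\<bar>y n\<bar> / s n / \<kappa>\<^sup>2)" .
  have c: "\<forall>\<^sub>F n in sequentially. 0 \<le> c n \<and> c n \<le> 1" and s: "\<forall>\<^sub>F n in sequentially. 0 < s n"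
    using cs by (auto simp: tracks_def)
  obtain B where "\<forall>\<^sub>F n in sequentially. norm (y n) \<le> B * norm (s n)"
    using landau_o.bigE[OF y] by blast
  then have B: "\<forall>\<^sub>F n in sequentially. \<bar>y n\<bar> / s n / \<kappa>\<^sup>2 \<le> B / \<kappa>\<^sup>2"
    using s by eventually_elim (intro divide_right_mono, auto simp: field_simps)
  have c': "\<forall>\<^sub>F n in sequentially. 0 \<le> \<kappa> * c n \<and> \<kappa> * c n \<le> 1"
    using c by eventually_elim (use \<kappa> in \<open>auto intro: mult_le_one\<close>)
  from contraction_bounded[OF c' rec' B] obtain C
    where "\<forall>\<^sub>F n in sequentially. x n / s n \<le> C" by blast
  then have "\<forall>\<^sub>F n in sequentially. norm (x n) \<le> C * norm (s n)"
    using s x by eventually_elim (auto simp: field_simps)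
  then show ?thesis by (rule landau_o.bigI[of "max 1 C", rotated, OF eventually_mono])
      (auto intro: order_trans intro!: mult_right_mono)
qed

lemma tracks_smallo:
  fixes x y c s :: "nat \<Rightarrow> real"
  assumes cs: "tracks c s"
    and x: "\<forall>\<^sub>F n in sequentially. 0 \<le> x n"
    and rec: "\<forall>\<^sub>F n in sequentially. x (Suc n) \<le> (1 - c n) * x n + c n * y n"
    and y: "y \<in> o(s)"
  shows "x \<in> o(s)"
proof -
  from tracks_normalized[OF cs x rec] obtain \<kappa> where \<kappa>: "0 < \<kappa>" "\<kappa> \<le> 1" and
    rec': "\<forall>\<^sub>F n in sequentially. x (Suc n) / s (Suc n) \<le>
       (1 - \<kappa> * c n) * (x n / s n) + \<kappa> * c n * (\<bar>y n\<bar> / s n / \<kappa>\<^sup>2)" .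
  have c: "\<forall>\<^sub>F n in sequentially. 0 \<le> c n \<and> c n \<le> 1" and s: "\<forall>\<^sub>F n in sequentially. 0 < s n"
    and nsum: "\<not> summable c"
    using cs by (auto simp: tracks_def)
  have c': "\<forall>\<^sub>F n in sequentially. 0 \<le> \<kappa> * c n \<and> \<kappa> * c n \<le> 1"
    using c by eventually_elim (use \<kappa> in \<open>auto intro: mult_le_one\<close>)
  have nsum': "\<not> summable (\<lambda>n. \<kappa> * c n)"
    using nsum \<kappa> summable_mult_D by fastforce
  have "(\<lambda>n. \<bar>y n / s n\<bar> / \<kappa>\<^sup>2) \<longlonglongrightarrow> 0"
    using smalloD_tendsto[OF y] by (intro tendsto_divide_zero tendsto_rabs_zero)
  then have h: "(\<lambda>n. \<bar>y n\<bar> / s n / \<kappa>\<^sup>2) \<longlonglongrightarrow> 0"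
    by (rule Lim_transform_eventually) (use s in \<open>eventually_elim; simp add: abs_divide\<close>)
  have z: "\<forall>\<^sub>F n in sequentially. 0 \<le> x n / s n" using x s by eventually_elim simp
  have "(\<lambda>n. x n / s n) \<longlonglongrightarrow> 0"
    by (rule contraction_tendsto_zero[OF c' nsum' z rec' h])
  then show ?thesis
    by (rule smalloI_tendsto) (use s in \<open>eventually_elim; simp\<close>)
qed

section \<open>Polynomially decaying step sizes\<close>

locale poly_steps =
  fixes \<eta> :: "nat \<Rightarrow> real" and eta0 \<alpha> :: real
  assumes eta0: "0 < eta0" and \<alpha>: "0 < \<alpha>" "\<alpha> \<le> 1"
    and \<eta>: "\<And>n. n \<ge> 1 \<Longrightarrow> \<eta> n = eta0 * real n powr (- \<alpha>)"
begin

lemma \<eta>_pos: "n \<ge> 1 \<Longrightarrow> 0 < \<eta> n"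
  using eta0 by (simp add: \<eta>)

lemma ev_\<eta>: "\<forall>\<^sub>F n in sequentially. \<eta> n = eta0 * real n powr (- \<alpha>)"
  using eventually_ge_at_top[of "1::nat"] by eventually_elim (simp add: \<eta>)

lemma ev_\<eta>_pos: "\<forall>\<^sub>F n in sequentially. 0 < \<eta> n"
  using eventually_ge_at_top[of "1::nat"] by eventually_elim (simp add: \<eta>_pos)

lemma \<eta>_powr: "n \<ge> 1 \<Longrightarrow> \<eta> n powr \<theta> = eta0 powr \<theta> * real n powr (- \<alpha> * \<theta>)"
  using eta0 by (simp add: \<eta> powr_mult powr_powr)

lemma \<eta>_tendsto: "\<eta> \<longlonglongrightarrow> 0"
proof -
  have "(\<lambda>n. eta0 * real n powr (- \<alpha>)) \<longlonglongrightarrow> 0" using \<alpha> by real_asymp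
  then show ?thesis by (rule Lim_transform_eventually) (use ev_\<eta> in \<open>eventually_elim; simp\<close>)
qed

lemma \<eta>_powr_tendsto: "0 < \<theta> \<Longrightarrow> (\<lambda>n. \<eta> n powr \<theta>) \<longlonglongrightarrow> 0"
  by (rule tendsto_zero_powrI[OF \<eta>_tendsto tendsto_const])
     (use ev_\<eta>_pos in \<open>auto elim: eventually_mono\<close>)

lemma \<eta>_powr_smallo: "b < a \<Longrightarrow> (\<lambda>n. \<eta> n powr a) \<in> o(\<lambda>n. \<eta> n powr b)"
proof (rule smalloI_tendsto)
  assume ab: "b < a"
  show "(\<lambda>n. \<eta> n powr a / \<eta> n powr b) \<longlonglongrightarrow> 0"
    using \<eta>_powr_tendsto[of "a - b"] ab
    by (simp add: powr_diff)
  show "\<forall>\<^sub>F n in sequentially. \<eta> n powr b \<noteq> 0" using ev_\<eta>_pos by eventually_elim simp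
qed

lemma \<eta>_powr_bigo: "b \<le> a \<Longrightarrow> (\<lambda>n. \<eta> n powr a) \<in> O(\<lambda>n. \<eta> n powr b)"
  using \<eta>_powr_smallo[of b a] by (cases "a = b") (auto intro: landau_o.small_imp_big)

text \<open>By ln (1 + 1/n) \<le> 1/n, a power \<eta>^\<theta> loses at most the fraction \<alpha> *
  \<theta> / n in one step. So tracking amounts to \<alpha> * \<theta> / n being at most a fixed
  fraction below 1 of the gain. This is automatic if the gain decays more slowly than 1/n; in the
  borderline case it compares constants, which is \<open>crit\<close>.\<close>

lemma tracks_powr:
  assumes K: "0 < K" and \<kappa>: "0 < \<kappa>" "\<alpha> * \<kappa> \<le> 1" and \<theta>: "0 \<le> \<theta>"
    and crit: "\<alpha> * \<kappa> = 1 \<Longrightarrow> \<alpha> * \<theta> < K * eta0 powr \<kappa>"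
  shows "tracks (\<lambda>n. K * \<eta> n powr \<kappa>) (\<lambda>n. \<eta> n powr \<theta>)"
  unfolding tracks_def
proof (intro conjI)
  have "(\<lambda>n. K * \<eta> n powr \<kappa>) \<longlonglongrightarrow> 0"
    using \<eta>_powr_tendsto[OF \<kappa>(1)] by (rule tendsto_mult_right_zero)
  then have "\<forall>\<^sub>F n in sequentially. K * \<eta> n powr \<kappa> < 1"
    by (rule order_tendstoD) simp
  then show "\<forall>\<^sub>F n in sequentially. 0 \<le> K * \<eta> n powr \<kappa> \<and> K * \<eta> n powr \<kappa> \<le> 1"
    by eventually_elim (use K in auto)
  show "\<not> summable (\<lambda>n. K * \<eta> n powr \<kappa>)"
  proof
    assume "summable (\<lambda>n. K * \<eta> n powr \<kappa>)"
    moreover have "\<forall>\<^sub>F n in sequentially. K * \<eta> n powr \<kappa> =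
        (K * eta0 powr \<kappa>) * real n powr (- \<alpha> * \<kappa>)"
      using eventually_ge_at_top[of "1::nat"] by eventually_elim (simp add: \<eta>_powr)
    ultimately have "summable (\<lambda>n. (K * eta0 powr \<kappa>) * real n powr (- \<alpha> * \<kappa>))"
      by (subst (asm) summable_cong)
    then have "summable (\<lambda>n. real n powr (- \<alpha> * \<kappa>))"
      using K eta0 summable_mult_D[of "K * eta0 powr \<kappa>"] by fastforce
    then show False using \<kappa> by (simp add: summable_real_powr_iff)
  qed
  show "\<forall>\<^sub>F n in sequentially. 0 < \<eta> n powr \<theta>" using ev_\<eta>_pos by eventually_elim simp
  have "\<exists>\<theta>'<1. \<forall>\<^sub>F n in sequentially. \<alpha> * \<theta> / real n \<le> \<theta>' * (K * \<eta> n powr \<kappa>)"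
  proof (cases "\<alpha> * \<kappa> = 1")
    case True
    have Kp: "0 < K * eta0 powr \<kappa>" using K eta0 by simp
    have "\<forall>\<^sub>F n in sequentially. \<alpha> * \<theta> / real n \<le> \<alpha> * \<theta> / (K * eta0 powr \<kappa>) * (K * \<eta> n powr \<kappa>)"
      using eventually_ge_at_top[of "1::nat"]
      by eventually_elim (use True Kp K eta0 in \<open>simp add: \<eta>_powr powr_minus field_simps\<close>)
    moreover have "\<alpha> * \<theta> / (K * eta0 powr \<kappa>) < 1" using crit[OF True] Kp by simp
    ultimately show ?thesis by blast
  next
    case False
    then have lt: "\<alpha> * \<kappa> < 1" using \<kappa> by simp
    have pos: "0 < K * eta0 powr \<kappa> / 2" using K eta0 by simp
    have "(\<lambda>n. \<alpha> * \<theta> * real n powr (\<alpha> * \<kappa> - 1)) \<longlonglongrightarrow> 0"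
      using lt by real_asymp
    then have "\<forall>\<^sub>F n in sequentially. \<alpha> * \<theta> * real n powr (\<alpha> * \<kappa> - 1) < K * eta0 powr \<kappa> / 2"
      using pos by (rule order_tendstoD)
    then have "\<forall>\<^sub>F n in sequentially. \<alpha> * \<theta> / real n \<le> 1/2 * (K * \<eta> n powr \<kappa>)"
      using eventually_ge_at_top[of "1::nat"]
    proof eventually_elim
      case (elim n)
      have "\<alpha> * \<theta> / real n = (\<alpha> * \<theta> * real n powr (\<alpha> * \<kappa> - 1)) * real n powr (- \<alpha> * \<kappa>)"
        using elim by (simp add: powr_diff powr_minus field_simps)
      also have "\<dots> \<le> (K * eta0 powr \<kappa> / 2) * real n powr (- \<alpha> * \<kappa>)"
        using elim by (intro mult_right_mono) auto
      finally show ?case using elim by (simp add: \<eta>_powr)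
    qed
    then show ?thesis by (intro exI[of _ "1/2"]) auto
  qed
  then obtain \<theta>' where \<theta>': "\<theta>' < 1"
    "\<forall>\<^sub>F n in sequentially. \<alpha> * \<theta> / real n \<le> \<theta>' * (K * \<eta> n powr \<kappa>)" by blast
  have "\<forall>\<^sub>F n in sequentially. (1 - \<theta>' * (K * \<eta> n powr \<kappa>)) * \<eta> n powr \<theta> \<le> \<eta> (Suc n) powr \<theta>"
    using \<theta>'(2) eventually_ge_at_top[of "1::nat"]
  proof eventually_elim
    case (elim n)
    have "1 - \<alpha> * \<theta> / real n \<le> exp (- (\<alpha> * \<theta> / real n))"
      using exp_ge_add_one_self[of "- (\<alpha> * \<theta> / real n)"] by simp
    also have "\<dots> \<le> exp (- (\<alpha> * \<theta> * ln (1 + 1 / real n)))"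
      using mult_left_mono[OF ln_add_one_self_le_self[of "1 / real n"], of "\<alpha> * \<theta>"] \<alpha> \<theta> by simp
    also have "\<dots> = (1 + 1 / real n) powr (- \<alpha> * \<theta>)"
      using elim by (auto simp: powr_def add_nonneg_eq_0_iff)
    finally have *: "1 - \<theta>' * (K * \<eta> n powr \<kappa>) \<le> (1 + 1 / real n) powr (- \<alpha> * \<theta>)"
      using elim by linarith
    have "real (Suc n) = real n * (1 + 1 / real n)" using elim by (simp add: field_simps)
    then have "\<eta> (Suc n) powr \<theta> = \<eta> n powr \<theta> * (1 + 1 / real n) powr (- \<alpha> * \<theta>)"
      using elim by (simp add: \<eta>_powr powr_mult del: of_nat_Suc)
    then show ?case using mult_right_mono[OF *, of "\<eta> n powr \<theta>"] by (simp add: mult.commute)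
  qed
  then show "\<exists>\<theta>'<1. \<forall>\<^sub>F n in sequentially.
      (1 - \<theta>' * (K * \<eta> n powr \<kappa>)) * \<eta> n powr \<theta> \<le> \<eta> (Suc n) powr \<theta>"
    using \<theta>'(1) by blast
qed

text \<open>The value of \<open>\<eta>\<close> at 0 is unspecified and may be negative, so
  \<open>\<eta> n powr 1\<close> can be replaced by \<open>\<eta> n\<close> only eventually.\<close>

lemma tracks_linear:
  assumes "0 < K" "0 \<le> \<theta>" "\<alpha> = 1 \<Longrightarrow> \<theta> < K * eta0"
  shows "tracks (\<lambda>n. K * \<eta> n) (\<lambda>n. \<eta> n powr \<theta>)"
proof -
  have t: "tracks (\<lambda>n. K * \<eta> n powr 1) (\<lambda>n. \<eta> n powr \<theta>)"
    using assms \<alpha> eta0 by (intro tracks_powr) auto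
  have ev: "\<forall>\<^sub>F n in sequentially. K * \<eta> n powr 1 = K * \<eta> n"
    using ev_\<eta>_pos by eventually_elim simp
  have 1: "\<forall>\<^sub>F n in sequentially. 0 \<le> K * \<eta> n \<and> K * \<eta> n \<le> 1"
    using ev t[unfolded tracks_def, THEN conjunct1] by eventually_elim (simp only: simp_thms)
  have 2: "\<not> summable (\<lambda>n. K * \<eta> n)"
    using t summable_cong[OF ev] by (auto simp: tracks_def)
  obtain \<theta>' where \<theta>': "\<theta>' < 1"
    "\<forall>\<^sub>F n in sequentially. (1 - \<theta>' * (K * \<eta> n powr 1)) * \<eta> n powr \<theta> \<le> \<eta> (Suc n) powr \<theta>"
    using t by (auto simp: tracks_def)
  have "\<forall>\<^sub>F n in sequentially. (1 - \<theta>' * (K * \<eta> n)) * \<eta> n powr \<theta> \<le> \<eta> (Suc n) powr \<theta>"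
    using \<theta>'(2) ev by eventually_elim (simp only:)
  then show ?thesis using 1 2 t \<theta>'(1) by (auto simp: tracks_def)
qed

lemma \<eta>_powr_diff_bigo:
  "(\<lambda>n. \<eta> n powr \<theta> - \<eta> (Suc n) powr \<theta>) \<in> O(\<lambda>n. \<eta> n powr \<theta> / real n)"
proof -
  have "(\<lambda>n. real n powr (- \<alpha> * \<theta>) - real (Suc n) powr (- \<alpha> * \<theta>)) \<in> O(\<lambda>n. real n powr (- \<alpha> * \<theta>) / real n)"
    by real_asymp
  then have "(\<lambda>n. eta0 powr \<theta> * (real n powr (- \<alpha> * \<theta>) - real (Suc n) powr (- \<alpha> * \<theta>)))
      \<in> O(\<lambda>n. eta0 powr \<theta> * (real n powr (- \<alpha> * \<theta>) / real n))"
    using eta0 by (intro landau_o.big.mult) auto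
  also have "?this \<longleftrightarrow> ?thesis"
    by (intro landau_o.big.cong_ex eventually_mono[OF eventually_ge_at_top[of "1::nat"]])
       (auto simp: \<eta>_powr algebra_simps)
  finally show ?thesis .
qed

lemma inverse_bigo_\<eta>: "(\<lambda>n. 1 / real n) \<in> O(\<eta>)"
proof -
  have "(\<lambda>n. 1 / real n) \<in> O(\<lambda>n. eta0 * real n powr (- \<alpha>))"
    using \<alpha> eta0 by (cases "\<alpha> = 1"; real_asymp)
  also have "O(\<lambda>n. eta0 * real n powr (- \<alpha>)) = O(\<eta>)"
    by (intro landau_o.big.cong eventually_mono[OF ev_\<eta>]) simp
  finally show ?thesis .
qed

text \<open>Only for \<open>\<alpha> = 1\<close> is the decay of a power of \<open>\<eta>\<close> visible on the scale of \<open>\<eta>\<close>.\<close>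

lemma \<eta>_powr_diff_smallo:
  "(\<lambda>n. \<eta> n powr \<theta> - \<eta> (Suc n) powr \<theta> - of_bool (\<alpha> = 1) * \<theta> / eta0 * \<eta> n * \<eta> n powr \<theta>)
     \<in> o(\<lambda>n. \<eta> n * \<eta> n powr \<theta>)"
proof (cases "\<alpha> = 1")
  case False
  then have a: "\<alpha> < 1" using \<alpha> by simp
  have "(\<lambda>n. 1 / real n) \<in> o(\<lambda>n. eta0 * real n powr (- \<alpha>))"
    using a eta0 by real_asymp
  also have "o(\<lambda>n. eta0 * real n powr (- \<alpha>)) = o(\<eta>)"
    by (intro landau_o.small.cong eventually_mono[OF ev_\<eta>]) simp
  finally have *: "(\<lambda>n. 1 / real n * \<eta> n powr \<theta>) \<in> o(\<lambda>n. \<eta> n * \<eta> n powr \<theta>)"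
    by (intro landau_o.small_big_mult) auto
  show ?thesis
    using landau_o.big_small_trans[OF \<eta>_powr_diff_bigo[of \<theta>], of "\<lambda>n. \<eta> n * \<eta> n powr \<theta>"] * False
    by simp
next
  case True
  \<comment> \<open>For \<alpha> = 1 the derivative of n^(-\<theta>) has the relative size \<theta>
    / n, that is \<theta> / \<open>eta0\<close> times \<eta>; only the second-order error
    remains.\<close>
  have "(\<lambda>n. real n powr (- \<theta>) - real (Suc n) powr (- \<theta>) - \<theta> / real n * real n powr (- \<theta>))
      \<in> o(\<lambda>n. real n powr (- \<theta>) / real n)"
    by real_asymp
  then have "(\<lambda>n. eta0 powr \<theta> * (real n powr (- \<theta>) - real (Suc n) powr (- \<theta>) - \<theta> / real n * real n powr (- \<theta>)))
      \<in> o(\<lambda>n. (eta0 * eta0 powr \<theta>) * (real n powr (- \<theta>) / real n))"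
    using eta0 by (intro landau_o.big_small_mult) auto
  also have "?this \<longleftrightarrow> ?thesis"
  proof (intro landau_o.small.cong_ex eventually_mono[OF eventually_ge_at_top[of "1::nat"]])
    fix n :: nat assume n: "1 \<le> n"
    have e: "\<eta> n powr \<theta> = eta0 powr \<theta> * real n powr - \<theta>"
      "\<eta> (Suc n) powr \<theta> = eta0 powr \<theta> * real (Suc n) powr - \<theta>"
      "\<eta> n * z = eta0 * z / real n" for z
      using n \<eta>_powr[of n \<theta>] \<eta>_powr[of "Suc n" \<theta>] \<eta>[of n] True
      by (simp_all add: powr_minus divide_inverse)
    show "eta0 powr \<theta> * (real n powr - \<theta> - real (Suc n) powr - \<theta> - \<theta> / real n * real n powr - \<theta>) =
      \<eta> n powr \<theta> - \<eta> (Suc n) powr \<theta> - of_bool (\<alpha> = 1) * \<theta> / eta0 * \<eta> n * \<eta> n powr \<theta>"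
      unfolding mult.assoc e using eta0 True by (simp add: algebra_simps del: of_nat_Suc)
    show "eta0 * eta0 powr \<theta> * (real n powr - \<theta> / real n) = \<eta> n * \<eta> n powr \<theta>"
      unfolding e by simp
  qed
  finally show ?thesis .
qed

lemma \<eta>_Suc_ratio: "(\<lambda>n. \<eta> (Suc n) powr \<theta> / \<eta> n powr \<theta>) \<longlonglongrightarrow> 1"
proof -
  have "(\<lambda>n. real (Suc n) powr (- \<alpha> * \<theta>) / real n powr (- \<alpha> * \<theta>)) \<longlonglongrightarrow> 1" by real_asymp
  then show ?thesis
    by (rule Lim_transform_eventually)
       (intro eventually_mono[OF eventually_ge_at_top[of "1::nat"]], use eta0 in \<open>simp add: \<eta>_powr del: of_nat_Suc\<close>)
qed

end

section \<open>Linear algebra\<close>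

lemma inner_matrix_vector: "x \<bullet> (A *v y) = (transpose A *v x) \<bullet> (y :: real^'n)"
  by (simp add: dot_lmul_matrix[symmetric])

lemma symmetric_inner:
  fixes S :: "real^'n^'n"
  assumes "transpose S = S"
  shows "x \<bullet> (S *v y) = y \<bullet> (S *v x)"
  using inner_matrix_vector[of x S y] assms by (simp add: inner_commute)

lemma mat_scaleR_vector: "mat c *v x = c *\<^sub>R (x :: real^'n)"
  by (simp add: vec_eq_iff matrix_vector_mult_def mat_def if_distrib[of "\<lambda>z. z * _"] sum.delta' cong: if_cong)

lemma transpose_eqI:
  fixes A :: "real^'n^'n"
  assumes "\<And>x y. x \<bullet> (A *v y) = (A *v x) \<bullet> y"
  shows "transpose A = A"
proof -
  have "transpose A *v x = A *v x" for x
    using assms[of x] inner_matrix_vector[of x A] vector_eq_rdot[of "transpose A *v x" "A *v x"] by auto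
  then show ?thesis by (simp add: matrix_eq)
qed

text \<open>Uniqueness of the orthogonal decomposition makes the definite description meaningful and
  forces it to be linear; linearity is what allows the map to be recovered from its
  \<open>matrix\<close>.\<close>

lemma orth_proj_works:
  fixes V :: "(real^'d) set"
  assumes V: "subspace V"
  shows "orth_proj V *v x \<in> V" "v \<in> V \<Longrightarrow> (x - orth_proj V *v x) \<bullet> v = 0"
proof -
  define pr where "pr x = (THE y. y \<in> V \<and> (\<forall>v\<in>V. orthogonal (x - y) v))" for x
  have uniq: "y = z" if "y \<in> V" "\<forall>v\<in>V. orthogonal (x - y) v" "z \<in> V" "\<forall>v\<in>V. orthogonal (x - z) v"
    for x y z
  proof -
    have "y - z \<in> V" using that V by (simp add: subspace_diff)
    then have "(x - z) \<bullet> (y - z) - (x - y) \<bullet> (y - z) = 0" using that by (simp add: orthogonal_def)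
    then have "(y - z) \<bullet> (y - z) = 0" by (simp add: inner_diff_left)
    then show ?thesis by simp
  qed
  have ex: "\<exists>y. y \<in> V \<and> (\<forall>v\<in>V. orthogonal (x - y) v)" for x
  proof -
    obtain y z where "y \<in> span V" "\<And>w. w \<in> span V \<Longrightarrow> orthogonal z w" "x = y + z"
      using orthogonal_subspace_decomp_exists[of V x] by metis
    then show ?thesis using V by (intro exI[of _ y]) (auto simp: span_eq_iff[THEN iffD2])
  qed
  have pr: "pr x \<in> V \<and> (\<forall>v\<in>V. orthogonal (x - pr x) v)" for x
    unfolding pr_def by (rule theI') (use ex uniq in blast)
  have prI: "pr x = y" if "y \<in> V" "\<And>v. v \<in> V \<Longrightarrow> (x - y) \<bullet> v = 0" for x y
    using uniq[of "pr x" x y] pr[of x] that by (simp add: orthogonal_def)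
  have "linear pr"
  proof (rule linearI)
    fix x y c
    show "pr (x + y) = pr x + pr y"
      using pr[of x] pr[of y] V
      by (intro prI) (auto simp: subspace_add orthogonal_def inner_diff_left inner_add_left)
    show "pr (c *\<^sub>R x) = c *\<^sub>R pr x"
      using pr[of x] V
      by (intro prI) (auto simp: subspace_scale orthogonal_def simp flip: scaleR_diff_right)
  qed
  then have "orth_proj V *v x = pr x" for x
    unfolding orth_proj_def pr_def[symmetric] by (simp add: matrix_works)
  then show "orth_proj V *v x \<in> V" "v \<in> V \<Longrightarrow> (x - orth_proj V *v x) \<bullet> v = 0"
    using pr[of x] by (auto simp: orthogonal_def)
qed

section \<open>Projection onto the null space of the transposed constraint matrix\<close>

context
  fixes A :: "real^'m^'d"
begin

lemma proj_perp_orth: "v \<in> span (columns A) \<Longrightarrow> (proj_perp A *v x) \<bullet> v = 0"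
  using orth_proj_works(2)[OF subspace_span[of "columns A"], where x = x]
  by (simp add: proj_perp_def proj_col_def matrix_vector_mult_diff_rdistrib)

lemma proj_perp_fixed:
  assumes "\<And>v. v \<in> span (columns A) \<Longrightarrow> y \<bullet> v = 0"
  shows "proj_perp A *v y = y"
proof -
  let ?p = "orth_proj (span (columns A)) *v y"
  have p: "?p \<in> span (columns A)" by (rule orth_proj_works) simp
  have "(y - ?p) \<bullet> ?p = 0" using orth_proj_works(2)[OF subspace_span p] .
  then have "?p \<bullet> ?p = 0" using assms[OF p] by (simp add: inner_diff_left)
  then show ?thesis by (simp add: proj_perp_def proj_col_def matrix_vector_mult_diff_rdistrib)
qed

lemma proj_perp_idem: "proj_perp A ** proj_perp A = proj_perp A"
  by (simp add: matrix_eq matrix_vector_mul_assoc[symmetric] proj_perp_fixed proj_perp_orth)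

lemma proj_perp_sym: "transpose (proj_perp A) = proj_perp A"
proof (rule transpose_eqI)
  fix x y :: "real^'d"
  have *: "(proj_perp A *v x) \<bullet> (y - proj_perp A *v y) = 0" for x y
  proof (rule proj_perp_orth)
    have "y - proj_perp A *v y = orth_proj (span (columns A)) *v y"
      by (simp add: proj_perp_def proj_col_def matrix_vector_mult_diff_rdistrib)
    then show "y - proj_perp A *v y \<in> span (columns A)"
      using orth_proj_works(1)[OF subspace_span] by metis
  qed
  show "x \<bullet> (proj_perp A *v y) = (proj_perp A *v x) \<bullet> y"
    using *[of x y] *[of y x] by (simp add: inner_diff_right inner_commute)
qed

lemma proj_perp_kernel:
  assumes "transpose A *v y = 0"
  shows "proj_perp A *v y = y"
proof (rule proj_perp_fixed)
  have col: "y \<bullet> column j A = 0" for j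
  proof -
    have "y \<bullet> (A *v axis j 1) = 0" using assms by (subst inner_matrix_vector) simp
    then show ?thesis by (simp add: matrix_vector_mult_basis)
  qed
  fix v assume "v \<in> span (columns A)"
  then show "y \<bullet> v = 0"
    by (induction rule: span_induct) (auto simp: columns_def col subspace_def inner_add_right)
qed

end

section \<open>Smallest eigenvalue of a symmetric matrix\<close>

lemma finite_eigenvalues:
  fixes S :: "real^'d^'d"
  assumes S: "transpose S = S"
  shows "finite {l. \<exists>v. v \<noteq> 0 \<and> S *v v = l *\<^sub>R v}" (is "finite ?E")
proof -
  define f where "f l = (SOME v. v \<noteq> 0 \<and> S *v v = l *\<^sub>R v)" for l
  have f: "f l \<noteq> 0" "S *v f l = l *\<^sub>R f l" if "l \<in> ?E" for l
    using that someI_ex[of "\<lambda>v. v \<noteq> 0 \<and> S *v v = l *\<^sub>R v"] unfolding f_def by auto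
  \<comment> \<open>Eigenvectors of distinct eigenvalues are orthogonal, hence independent, hence
    finite in number. So the \<open>Min\<close> in \<open>lambda_min\<close> is over a finite
    set.\<close>
  have orth: "f l \<bullet> f l' = 0" if "l \<in> ?E" "l' \<in> ?E" "l \<noteq> l'" for l l'
  proof -
    have "l' * (f l \<bullet> f l') = l * (f l \<bullet> f l')"
      using inner_matrix_vector[of "f l" S "f l'"] f(2)[OF that(1)] f(2)[OF that(2)] S by simp
    then show ?thesis using that by simp
  qed
  have inj: "inj_on f ?E"
  proof (rule inj_onI, rule ccontr)
    fix l l' assume "l \<in> ?E" "l' \<in> ?E" "f l = f l'" "l \<noteq> l'"
    then show False using orth[of l l'] f(1)[of l'] by simp
  qed
  have "pairwise orthogonal (f ` ?E)"
    using orth by (auto simp: pairwise_def orthogonal_def)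
  then have "independent (f ` ?E)"
    by (rule pairwise_orthogonal_independent) (use f(1) in fastforce)
  then have "finite (f ` ?E)" by (rule finiteI_independent)
  then show ?thesis using inj by (rule finite_imageD)
qed

lemma rayleigh_eigenvector:
  fixes S :: "real^'d^'d"
  assumes S: "transpose S = S"
  obtains v \<mu> where "v \<noteq> 0" "S *v v = \<mu> *\<^sub>R v" "\<And>x. \<mu> * (x \<bullet> x) \<le> x \<bullet> (S *v x)"
proof -
  have "continuous_on (sphere (0::real^'d) 1) (\<lambda>x. x \<bullet> (S *v x))"
    by (intro continuous_intros matrix_vector_mult_linear_continuous_on)
  moreover have "sphere (0::real^'d) 1 \<noteq> {}" by simp
  ultimately obtain v where v: "norm v = 1" "\<And>x. norm x = 1 \<Longrightarrow> v \<bullet> (S *v v) \<le> x \<bullet> (S *v x)"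
    using continuous_attains_inf[of "sphere (0::real^'d) 1" "\<lambda>x. x \<bullet> (S *v x)"] by auto
  define \<mu> where "\<mu> = v \<bullet> (S *v v)"
  have ray: "\<mu> * (x \<bullet> x) \<le> x \<bullet> (S *v x)" for x
  proof (cases "x = 0")
    case False
    have "\<mu> \<le> ((1 / norm x) *\<^sub>R x) \<bullet> (S *v ((1 / norm x) *\<^sub>R x))"
      unfolding \<mu>_def using False by (intro v(2)) simp
    also have "\<dots> = (x \<bullet> (S *v x)) / (x \<bullet> x)"
      by (simp add: matrix_vector_mult_scaleR power2_norm_eq_inner[symmetric] power2_eq_square)
    finally show ?thesis using False by (simp add: pos_le_divide_eq)
  qed simp
  \<comment> \<open>The residual of the eigenvalue equation is itself used as the direction of
    perturbation of the minimizer v. The quadratic in t obtained is nonnegative everywhere and has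
    linear coefficient 2 * (r \<bullet> r), which must therefore vanish.\<close>
  define r where "r = S *v v - \<mu> *\<^sub>R v"
  define c where "c = r \<bullet> (S *v r) - \<mu> * (r \<bullet> r)"
  have c: "0 \<le> c" using ray[of r] by (simp add: c_def)
  have quad: "0 \<le> 2 * t * (r \<bullet> r) + t\<^sup>2 * c" for t
  proof -
    have vv: "v \<bullet> v = 1" using v(1) by (simp add: norm_eq_1)
    have rS: "v \<bullet> (S *v r) = r \<bullet> (S *v v)"
      by (rule symmetric_inner[OF S])
    have "(v + t *\<^sub>R r) \<bullet> (S *v (v + t *\<^sub>R r)) - \<mu> * ((v + t *\<^sub>R r) \<bullet> (v + t *\<^sub>R r))
      = 2 * t * (r \<bullet> (S *v v) - \<mu> * (r \<bullet> v)) + t\<^sup>2 * c"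
      using rS vv
      by (simp add: c_def \<mu>_def[symmetric] matrix_vector_right_distrib matrix_vector_mult_scaleR inner_add_left
          inner_add_right power2_eq_square algebra_simps inner_commute)
    also have "r \<bullet> (S *v v) - \<mu> * (r \<bullet> v) = r \<bullet> r"
      by (simp add: r_def inner_diff_right)
    finally show ?thesis using ray[of "v + t *\<^sub>R r"] by simp
  qed
  have "r \<bullet> r = 0"
  proof (cases "c = 0")
    case True
    then show ?thesis using quad[of "-1"] inner_ge_zero[of r] by simp
  next
    case False
    have "2 * (- (r \<bullet> r) / c) * (r \<bullet> r) + (- (r \<bullet> r) / c)\<^sup>2 * c = - ((r \<bullet> r)\<^sup>2 / c)"
      using False by (simp add: field_simps power2_eq_square)
    then have "(r \<bullet> r)\<^sup>2 / c \<le> 0" using quad[of "- (r \<bullet> r) / c"] by linarith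
    then have "(r \<bullet> r)\<^sup>2 \<le> 0" using c False by (simp add: divide_le_0_iff)
    then show ?thesis by simp
  qed
  then have "S *v v = \<mu> *\<^sub>R v" by (simp add: r_def)
  moreover have "v \<noteq> 0" using v(1) by auto
  ultimately show ?thesis using that ray by blast
qed

lemma lambda_min_spd:
  fixes S :: "real^'d^'d"
  assumes S: "spd S"
  shows "0 < lambda_min S" "lambda_min S * (x \<bullet> x) \<le> x \<bullet> (S *v x)"
proof -
  let ?E = "{l. \<exists>v. v \<noteq> 0 \<and> S *v v = l *\<^sub>R v}"
  have sym: "transpose S = S" using S by (simp add: spd_def)
  obtain v \<mu> where \<mu>: "v \<noteq> 0" "S *v v = \<mu> *\<^sub>R v" "\<And>x. \<mu> * (x \<bullet> x) \<le> x \<bullet> (S *v x)"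
    using rayleigh_eigenvector[OF sym] by metis
  have fin: "finite ?E" by (rule finite_eigenvalues[OF sym])
  have "\<mu> \<in> ?E" using \<mu> by auto
  then have le: "lambda_min S \<le> \<mu>" unfolding lambda_min_def by (rule Min_le[OF fin])
  have "lambda_min S \<in> ?E" unfolding lambda_min_def using fin \<open>\<mu> \<in> ?E\<close> by (intro Min_in) auto
  then obtain z where z: "z \<noteq> 0" "S *v z = lambda_min S *\<^sub>R z" by auto
  have "0 < z \<bullet> (S *v z)" using S z(1) unfolding spd_def by blast
  then show "0 < lambda_min S" using z inner_ge_zero[of z] by (auto simp: zero_less_mult_iff)
  have "lambda_min S * (x \<bullet> x) \<le> \<mu> * (x \<bullet> x)" using le by (intro mult_right_mono) auto
  then show "lambda_min S * (x \<bullet> x) \<le> x \<bullet> (S *v x)" using \<mu>(3)[of x] by linarith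
qed

section \<open>Positive semidefinite matrices and their factorization\<close>

lemma psd_cauchy_schwarz:
  fixes C :: "real^'d^'d"
  assumes C: "psd C"
  shows "(x \<bullet> (C *v y))\<^sup>2 \<le> (x \<bullet> (C *v x)) * (y \<bullet> (C *v y))"
proof -
  have sym: "y \<bullet> (C *v x) = x \<bullet> (C *v y)"
    using C by (intro symmetric_inner) (simp add: psd_def)
  have quad: "0 \<le> x \<bullet> (C *v x) + 2 * t * (x \<bullet> (C *v y)) + t\<^sup>2 * (y \<bullet> (C *v y))" for t
  proof -
    have "0 \<le> (x + t *\<^sub>R y) \<bullet> (C *v (x + t *\<^sub>R y))" using C by (simp add: psd_def)
    then show ?thesis using sym
      by (simp add: matrix_vector_right_distrib matrix_vector_mult_scaleR inner_add_left
          inner_add_right power2_eq_square algebra_simps)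
  qed
  show ?thesis
  proof (cases "y \<bullet> (C *v y) = 0")
    case True
    have "x \<bullet> (C *v y) = 0"
    proof (rule ccontr)
      assume ne: "x \<bullet> (C *v y) \<noteq> 0"
      \<comment> \<open>If the quadratic coefficient is 0, the nonnegative function of t is affine;
        this t would give it the value -1.\<close>
      show False
        using quad[of "- (x \<bullet> (C *v x) + 1) / (2 * (x \<bullet> (C *v y)))"] True ne by (simp add: field_simps)
    qed
    then show ?thesis using True by simp
  next
    case False
    then have p: "0 < y \<bullet> (C *v y)" using C by (simp add: psd_def less_le)
    have "0 \<le> x \<bullet> (C *v x) - (x \<bullet> (C *v y))\<^sup>2 / (y \<bullet> (C *v y))"
      using quad[of "- (x \<bullet> (C *v y)) / (y \<bullet> (C *v y))"] False
      by (simp add: field_simps power2_eq_square)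
    then show ?thesis using p by (simp add: field_simps)
  qed
qed

text \<open>Cholesky factorization, by eliminating one coordinate of the support at a time.\<close>

lemma psd_factor_support:
  fixes C :: "real^'d^'d"
  assumes "psd C" "\<And>i l. l \<notin> J \<Longrightarrow> C $ i $ l = 0"
  shows "\<exists>B :: real^'d^'d. B ** transpose B = C \<and> (\<forall>i l. l \<notin> J \<longrightarrow> B $ i $ l = 0)"
proof -
  have "finite J" by simp
  then show ?thesis using assms
  proof (induction J arbitrary: C rule: finite_induct)
    case empty
    then have "C = 0" by (simp add: vec_eq_iff)
    then show ?case by (intro exI[of _ 0]) (simp add: vec_eq_iff matrix_matrix_mult_def)
  next
    case (insert j J)
    have sym: "C $ i $ l = C $ l $ i" for i l
    proof -
      have "C $ i $ l = transpose C $ i $ l" using insert.prems(1) by (simp add: psd_def)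
      then show ?thesis by (simp add: transpose_def)
    qed
    have ent: "axis i 1 \<bullet> (C *v axis l 1) = C $ i $ l" for i l
      by (simp add: matrix_vector_mult_basis inner_axis' column_def)
    have col: "x \<bullet> (C *v axis j 1) = (\<Sum>i\<in>UNIV. x $ i * C $ i $ j)" for x
      by (simp add: matrix_vector_mult_basis inner_vec_def column_def)
    show ?case
    proof (cases "C $ j $ j = 0")
      case True
      have "C $ i $ l = 0" if "l \<notin> J" for i l
      proof (cases "l = j")
        case True
        then show ?thesis
          using psd_cauchy_schwarz[OF insert.prems(1), of "axis i 1" "axis j 1"] \<open>C $ j $ j = 0\<close>
          by (simp add: ent)
      qed (use insert.prems(2) that in auto)
      with insert.IH[OF insert.prems(1)] show ?thesis by blast
    next
      case False
      let ?d = "C $ j $ j"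
      have d: "0 < ?d"
        using False insert.prems(1) ent[of j j] unfolding psd_def by (metis less_le)
      \<comment> \<open>The Schur complement of the pivot. Its quadratic form is that of C minus (x
        \<bullet> C e_j)^2 / d, which Cauchy-Schwarz keeps nonnegative; row and column j become
        0.\<close>
      define C' where "C' = (\<chi> i l. C $ i $ l - C $ i $ j * C $ l $ j / ?d)"
      have "psd C'" unfolding psd_def
      proof (intro conjI allI)
        show "transpose C' = C'"
          using sym by (simp add: C'_def transpose_def vec_eq_iff mult.commute)
        fix x :: "real^'d"
        have "C' *v x = C *v x - ((x \<bullet> (C *v axis j 1)) / ?d) *\<^sub>R (C *v axis j 1)"
          unfolding col
          by (simp add: vec_eq_iff matrix_vector_mult_basis column_def)
             (simp add: matrix_vector_mult_def C'_def right_diff_distrib sum_subtractf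
               sum_distrib_left sum_divide_distrib mult_ac)
        then have "x \<bullet> (C' *v x) = x \<bullet> (C *v x) - (x \<bullet> (C *v axis j 1))\<^sup>2 / ?d"
          by (simp add: inner_diff_right power2_eq_square)
        moreover have "(x \<bullet> (C *v axis j 1))\<^sup>2 \<le> (x \<bullet> (C *v x)) * ?d"
          using psd_cauchy_schwarz[OF insert.prems(1), of x "axis j 1"] ent by simp
        ultimately show "0 \<le> x \<bullet> (C' *v x)" using d by (simp add: pos_divide_le_eq)
      qed
      moreover have "C' $ i $ l = 0" if "l \<notin> J" for i l
      proof (cases "l = j")
        case False
        then have l: "C $ a $ l = 0" for a using insert.prems(2) that by auto
        then show ?thesis using sym[of l j] by (simp add: C'_def)
      qed (use d in \<open>simp add: C'_def\<close>)
      ultimately obtain B' :: "real^'d^'d" where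
        B': "B' ** transpose B' = C'" "\<And>i l. l \<notin> J \<Longrightarrow> B' $ i $ l = 0"
        using insert.IH by blast
      \<comment> \<open>Column j contributes exactly the rank-one term subtracted from C; in B' this
        column was zero, so nothing is overwritten.\<close>
      define B where "B = (\<chi> i l. if l = j then C $ i $ j / sqrt ?d else B' $ i $ l)"
      have "(B ** transpose B) $ i $ l = C $ i $ l" for i l
      proof -
        have "(B ** transpose B) $ i $ l = (\<Sum>k\<in>UNIV. B $ i $ k * B $ l $ k)"
          by (simp add: matrix_matrix_mult_def transpose_def)
        also have "\<dots> = B $ i $ j * B $ l $ j + (\<Sum>k\<in>UNIV - {j}. B $ i $ k * B $ l $ k)"
          by (simp add: sum.remove[of _ j])
        also have "(\<Sum>k\<in>UNIV - {j}. B $ i $ k * B $ l $ k) = (\<Sum>k\<in>UNIV - {j}. B' $ i $ k * B' $ l $ k)"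
          by (intro sum.cong) (auto simp: B_def)
        also have "\<dots> = (\<Sum>k\<in>UNIV. B' $ i $ k * B' $ l $ k)"
          using B'(2) insert.hyps by (simp add: sum.remove[of UNIV j])
        also have "\<dots> = (B' ** transpose B') $ i $ l"
          by (simp add: matrix_matrix_mult_def transpose_def)
        also have "\<dots> = C $ i $ l - C $ i $ j * C $ l $ j / ?d" by (simp add: B' C'_def)
        also have "B $ i $ j * B $ l $ j = C $ i $ j * C $ l $ j / ?d"
          using d by (simp add: B_def)
        finally show ?thesis by simp
      qed
      then have "B ** transpose B = C" by (simp add: vec_eq_iff)
      moreover have "\<forall>i l. l \<notin> insert j J \<longrightarrow> B $ i $ l = 0"
        using B'(2) by (simp add: B_def)
      ultimately show ?thesis by blast
    qed
  qed
qed

lemma psd_factor: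
  fixes C :: "real^'d^'d"
  assumes "psd C"
  shows "(SOME B :: real^'d^'d. B ** transpose B = C) ** transpose (SOME B :: real^'d^'d. B ** transpose B = C) = C"
  using psd_factor_support[OF assms, of UNIV] by (intro someI_ex[of "\<lambda>B. B ** transpose B = C"]) auto

section \<open>The Moore-Penrose pseudoinverse\<close>

lemma pinv_eqI:
  fixes M :: "real^'n^'m"
  assumes X: "M ** X ** M = M" "X ** M ** X = X" "transpose (M ** X) = M ** X" "transpose (X ** M) = X ** M"
  shows "pinv M = X"
  unfolding pinv_def
proof (rule the_equality)
  fix Y assume Y: "M ** Y ** M = M \<and> Y ** M ** Y = Y \<and> transpose (M ** Y) = M ** Y \<and> transpose (Y ** M) = Y ** M"
  \<comment> \<open>Symmetry allows the two products to be interchanged: M X = M Y M X = M X M Y = M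
    Y, and likewise X M = Y M. Then Y = Y M Y = Y M X = X M X = X.\<close>
  have "M ** X = transpose (M ** X)" by (simp add: X)
  also have "\<dots> = transpose ((M ** Y) ** (M ** X))" using Y by (simp add: matrix_mul_assoc)
  also have "\<dots> = (M ** X) ** (M ** Y)" using X Y by (simp add: matrix_transpose_mul)
  also have "\<dots> = M ** Y" using X by (simp add: matrix_mul_assoc)
  finally have MX: "M ** X = M ** Y" .
  have "X ** M = transpose (X ** M)" by (simp add: X)
  also have "\<dots> = transpose ((X ** M) ** (Y ** M))" using Y by (simp add: matrix_mul_assoc[symmetric])
  also have "\<dots> = (Y ** M) ** (X ** M)" using X Y by (simp add: matrix_transpose_mul)
  also have "\<dots> = Y ** M" using X by (simp add: matrix_mul_assoc[symmetric])
  finally have XM: "X ** M = Y ** M" .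
  have "Y = Y ** (M ** Y)" using Y by (simp add: matrix_mul_assoc)
  also have "\<dots> = (Y ** M) ** X" by (simp add: MX[symmetric] matrix_mul_assoc)
  also have "\<dots> = X" by (simp add: XM[symmetric] X)
  finally show "Y = X" .
qed (use X in simp)

text \<open>T is definite on the range of P and vanishes on the complement. Adding the complementary
  projection Q makes it invertible without changing it on the range, so the pseudoinverse is P times
  the inverse of T + Q, and T times it is P.\<close>

lemma pinv_solves:
  fixes P T :: "real^'d^'d"
  assumes P: "transpose P = P" "P ** P = P" and T: "P ** T = T" "T ** P = T"
    and pos: "\<And>x. P *v x = x \<Longrightarrow> x \<noteq> 0 \<Longrightarrow> 0 < x \<bullet> (T *v x)"
    and w: "P *v w = w"
  shows "T *v (pinv T *v w) = w" "P *v (pinv T *v w) = pinv T *v w"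
proof -
  define Q where "Q = mat 1 - P"
  have PQ: "P ** Q = 0" "Q ** P = 0" "Q ** T = 0" "T ** Q = 0" "Q ** Q = Q"
    by (simp_all add: matrix_eq matrix_vector_mul_assoc[symmetric] Q_def matrix_vector_mult_diff_rdistrib
       matrix_vector_mult_diff_distrib)
      (simp_all add: matrix_vector_mul_assoc P T)
  have "inj ((*v) (T + Q))"
  proof (rule injI)
    fix a b assume ab: "(T + Q) *v a = (T + Q) *v b"
    define x where "x = a - b"
    have x0: "T *v x + Q *v x = 0"
      using ab by (simp add: x_def matrix_vector_mult_diff_distrib matrix_vector_mult_add_rdistrib)
        (metis add_diff_add cancel_comm_monoid_add_class.diff_cancel)
    have "Q *v (T *v x + Q *v x) = Q *v x"
      by (simp add: matrix_vector_right_distrib matrix_vector_mul_assoc PQ)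
    then have Qx: "Q *v x = 0" using x0 by simp
    then have Px: "P *v x = x" by (simp add: Q_def matrix_vector_mult_diff_rdistrib)
    have "T *v x = 0" using x0 Qx by simp
    then have "x = 0" using pos[OF Px] by (cases "x = 0") auto
    then show "a = b" by (simp add: x_def)
  qed
  then obtain R where R: "R ** (T + Q) = mat 1"
    using matrix_left_invertible_injective by blast
  then have R': "(T + Q) ** R = mat 1" using matrix_left_right_inverse by blast
  define X where "X = P ** R"
  have TX: "T ** X = P"
  proof -
    have "T ** X = T ** R" by (simp add: X_def matrix_mul_assoc T)
    also have "T ** R = P ** (T + Q) ** R" by (simp add: matrix_add_ldistrib T PQ)
    also have "\<dots> = P" by (simp add: matrix_mul_assoc[symmetric] R')
    finally show ?thesis .
  qed
  have RP: "R ** T = P"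
  proof -
    have "R ** T = R ** ((T + Q) ** P)" by (simp add: matrix_eq matrix_vector_mul_assoc[symmetric] matrix_vector_mult_add_rdistrib)
        (simp add: matrix_vector_mul_assoc T PQ)
    also have "\<dots> = P" by (simp add: matrix_mul_assoc R)
    finally show ?thesis .
  qed
  have XT: "X ** T = P" by (simp add: X_def matrix_mul_assoc[symmetric] RP P)
  have PX: "P ** X = X" by (simp add: X_def matrix_mul_assoc P)
  have "pinv T = X"
    by (rule pinv_eqI) (simp_all add: TX XT PX P T matrix_mul_assoc[symmetric])
  then show "T *v (pinv T *v w) = w" "P *v (pinv T *v w) = pinv T *v w"
    by (simp_all add: matrix_vector_mul_assoc TX PX w)
qed

section \<open>Characteristic functions in Euclidean space\<close>

lemma norm_integral_le:
  fixes f :: "'a \<Rightarrow> 'b::{banach, second_countable_topology}"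
  assumes "integrable M f" "integrable M g" "\<And>x. x \<in> space M \<Longrightarrow> norm (f x) \<le> g x"
  shows "norm (\<integral>x. f x \<partial>M) \<le> (\<integral>x. g x \<partial>M)"
  using assms by (intro order_trans[OF integral_norm_bound] Bochner_Integration.integral_mono) auto

section \<open>Estimates for the complex exponential on the unit circle\<close>

lemma cis_eq_iexp: "cis x = iexp x"
  by (simp add: cis_conv_exp)

lemma borel_measurable_cis [measurable]: "cis \<in> borel_measurable borel"
  by (intro borel_measurable_continuous_onI continuous_intros)

lemma norm_cis_diff_le: "norm (cis a - cis b) \<le> \<bar>a - b\<bar>"
proof -
  have "cis a - cis b = cis b * (cis (a - b) - 1)" by (simp add: algebra_simps cis_mult)
  then have "norm (cis a - cis b) = norm (cis (a - b) - 1)" by (simp add: norm_mult)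
  also have "\<dots> \<le> \<bar>a - b\<bar>" using iexp_approx1[of "a - b" 0] by (simp add: cis_eq_iexp)
  finally show ?thesis .
qed

text \<open>Interpolates between the cubic remainder for small arguments and the quadratic one for
  large arguments, so that a noise with only r moments, 2 < r \<le> 3, suffices.\<close>

lemma norm_cis_taylor_le:
  assumes r: "2 \<le> r" "r \<le> 3"
  shows "norm (cis x - (1 + \<i> * of_real x - of_real (x\<^sup>2) / 2)) \<le> \<bar>x\<bar> powr r"
proof -
  have s: "(\<Sum>k\<le>2. (\<i> * of_real x) ^ k / fact k) = 1 + \<i> * of_real x - of_real (x\<^sup>2) / 2"
    by (simp add: numeral_2_eq_2 power_mult_distrib)
  have 1: "norm (cis x - (1 + \<i> * of_real x - of_real (x\<^sup>2) / 2)) \<le> \<bar>x\<bar> ^ 3 / 6"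
    using iexp_approx1[of x 2] unfolding s by (simp add: cis_eq_iexp eval_nat_numeral)
  have 2: "norm (cis x - (1 + \<i> * of_real x - of_real (x\<^sup>2) / 2)) \<le> \<bar>x\<bar> ^ 2"
    using iexp_approx2[of x 2] unfolding s by (simp add: cis_eq_iexp eval_nat_numeral)
  show ?thesis
  proof (cases "\<bar>x\<bar> \<le> 1")
    case True
    have "\<bar>x\<bar> ^ 3 \<le> \<bar>x\<bar> powr r"
    proof (cases "x = 0")
      case False
      then have "\<bar>x\<bar> powr 3 \<le> \<bar>x\<bar> powr r" using True r by (intro powr_mono') auto
      then show ?thesis using False by simp
    qed (use r in simp)
    moreover have "0 \<le> \<bar>x\<bar> ^ 3" by simp
    ultimately show ?thesis using 1 by linarith
  next
    case False
    then have "\<bar>x\<bar> powr 2 \<le> \<bar>x\<bar> powr r" using r by (intro powr_mono) auto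
    then show ?thesis using 2 False by simp
  qed
qed

text \<open>Finite combinations of characters: the functions whose integrals converge as soon as
  characteristic functions do. They are closed under products, which lets polynomials in sines
  belong to the class.\<close>

inductive trig_poly :: "('b::euclidean_space \<Rightarrow> complex) \<Rightarrow> bool" where
  monomial: "trig_poly (\<lambda>x. c * cis (t \<bullet> x))"
| add: "trig_poly f \<Longrightarrow> trig_poly g \<Longrightarrow> trig_poly (\<lambda>x. f x + g x)"

lemma trig_poly_const: "trig_poly (\<lambda>x. c)"
  using trig_poly.monomial[of c 0] by simp

lemma trig_poly_mult_monomial: "trig_poly f \<Longrightarrow> trig_poly (\<lambda>x. c * cis (t \<bullet> x) * f x)"
proof (induction rule: trig_poly.induct)
  case (monomial d s)
  have "(\<lambda>x. c * cis (t \<bullet> x) * (d * cis (s \<bullet> x))) = (\<lambda>x. c * d * cis ((t + s) \<bullet> x))"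
    by (auto simp: fun_eq_iff inner_add_left cis_mult[symmetric])
  then show ?case by (simp add: trig_poly.monomial)
next
  case (add f g)
  then show ?case by (simp add: distrib_left trig_poly.add)
qed

lemma trig_poly_mult: "trig_poly f \<Longrightarrow> trig_poly g \<Longrightarrow> trig_poly (\<lambda>x. f x * g x)"
  by (induction rule: trig_poly.induct)
     (simp_all add: trig_poly_mult_monomial distrib_right trig_poly.add)

lemma trig_poly_sum: "finite I \<Longrightarrow> (\<And>i. i \<in> I \<Longrightarrow> trig_poly (f i)) \<Longrightarrow> trig_poly (\<lambda>x. \<Sum>i\<in>I. f i x)"
  by (induction rule: finite_induct) (simp_all add: trig_poly_const trig_poly.add)

lemma trig_poly_sin: "trig_poly (\<lambda>x. of_real (sin (t \<bullet> x)))"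
proof -
  have "trig_poly (\<lambda>x. 1 / (2 * \<i>) * cis (t \<bullet> x) + (- 1 / (2 * \<i>)) * cis ((- t) \<bullet> x))"
    by (intro trig_poly.intros)
  also have "(\<lambda>x. 1 / (2 * \<i>) * cis (t \<bullet> x) + (- 1 / (2 * \<i>)) * cis ((- t) \<bullet> x)) = (\<lambda>x. of_real (sin (t \<bullet> x)))"
    by (auto simp: fun_eq_iff complex_eq_iff)
  finally show ?thesis .
qed

definition sin_map :: "real \<Rightarrow> 'b::euclidean_space \<Rightarrow> 'b" where
  "sin_map K x = (\<Sum>b\<in>Basis. sin (x \<bullet> b / K) *\<^sub>R b)"

lemma trig_poly_compose_sin_map:
  "real_polynomial_function p \<Longrightarrow> trig_poly (\<lambda>x::'b::euclidean_space. of_real (p (sin_map K x)))"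
proof (induction rule: real_polynomial_function.induct)
  case (linear f)
  have "of_real (f (sin_map K x)) =
      (\<Sum>b\<in>Basis. of_real (sin (((1 / K) *\<^sub>R b) \<bullet> x)) * (of_real (f b) :: complex))" for x :: 'b
  proof -
    have "f (sin_map K x) = (\<Sum>b\<in>Basis. sin (x \<bullet> b / K) * f b)"
      unfolding sin_map_def linear_sum[OF bounded_linear.linear[OF linear]]
      by (simp add: linear_scale[OF bounded_linear.linear[OF linear]])
    then show ?thesis by (simp add: inner_commute)
  qed
  moreover have "trig_poly (\<lambda>x. of_real (sin (((1 / K) *\<^sub>R b) \<bullet> x)) * (of_real (f b) :: complex))" for b
    by (intro trig_poly_mult trig_poly_sin trig_poly_const)
  ultimately show ?case by (simp only: trig_poly_sum finite_Basis)
qed (simp_all add: trig_poly_const trig_poly.add trig_poly_mult)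

text \<open>The sines of the rescaled coordinates are a coordinate system on a large cube and take values
  in a fixed compact cube everywhere; hence a polynomial approximation of \<open>f\<close> in these coordinates
  is a trigonometric polynomial that is controlled on the whole space.\<close>

lemma trig_poly_approximation:
  fixes f :: "'b::euclidean_space \<Rightarrow> real"
  assumes f: "continuous_on UNIV f" "\<And>x. \<bar>f x\<bar> \<le> B" and K: "0 < K" and e: "0 < e"
  obtains T where "trig_poly (\<lambda>x. of_real (T x))" "T \<in> borel_measurable borel"
    "\<And>x. \<bar>T x\<bar> \<le> B + e" "\<And>x. norm x \<le> K \<Longrightarrow> \<bar>f x - T x\<bar> \<le> e"
proof -
  define S :: "'b set" where "S = cbox (- One) One"
  have S: "y \<in> S \<longleftrightarrow> (\<forall>b\<in>Basis. - 1 \<le> y \<bullet> b \<and> y \<bullet> b \<le> 1)" for y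
    by (simp add: S_def mem_box)
  define F where "F y = f (\<Sum>b\<in>Basis. (K * arcsin (y \<bullet> b)) *\<^sub>R b)" for y
  have "continuous_on S (\<lambda>y. \<Sum>b\<in>Basis. (K * arcsin (y \<bullet> b)) *\<^sub>R b)"
    by (intro continuous_intros) (auto simp: S)
  then have F: "continuous_on S F"
    unfolding F_def by (intro continuous_on_compose2[OF f(1)]) auto
  obtain p where p: "real_polynomial_function p" "\<And>y. y \<in> S \<Longrightarrow> \<bar>F y - p y\<bar> < e"
    by (rule Stone_Weierstrass_real_polynomial_function[OF _ F e]) (simp_all add: S_def)
  have sinS: "sin_map K x \<in> S" for x by (simp add: S sin_map_def)
  show ?thesis
  proof
    show "trig_poly (\<lambda>x. of_real (p (sin_map K x)))" by (rule trig_poly_compose_sin_map[OF p(1)])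
    have "continuous_on UNIV (\<lambda>x. p (sin_map K x))"
      using K p(1) unfolding sin_map_def
      by (intro continuous_on_compose2[OF continuous_on_polymonial_function[of p UNIV]])
         (auto intro!: continuous_intros simp: real_polynomial_function_eq)
    then show "(\<lambda>x. p (sin_map K x)) \<in> borel_measurable borel"
      by (rule borel_measurable_continuous_onI)
    show "\<bar>p (sin_map K x)\<bar> \<le> B + e" for x
    proof -
      have "\<bar>F (sin_map K x)\<bar> \<le> B" unfolding F_def by (rule f(2))
      then show ?thesis using p(2)[OF sinS[of x]] by linarith
    qed
    fix x :: 'b assume x: "norm x \<le> K"
    have "F (sin_map K x) = f x"
    proof -
      have "K * arcsin (sin (x \<bullet> b / K)) = x \<bullet> b" if b: "b \<in> Basis" for b
      proof -
        \<comment> \<open>On the ball of radius K the arguments lie in [-1, 1], inside the interval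
          where \<open>arcsin\<close> inverts \<open>sin\<close>.\<close>
        have "\<bar>x \<bullet> b / K\<bar> \<le> 1" using Basis_le_norm[OF b, of x] x K by simp
        then have "- (pi / 2) \<le> x \<bullet> b / K" "x \<bullet> b / K \<le> pi / 2"
          using pi_gt3 by linarith+
        then show ?thesis using K by (simp add: arcsin_sin)
      qed
      then show ?thesis
        by (simp add: F_def sin_map_def euclidean_representation)
    qed
    then show "\<bar>f x - p (sin_map K x)\<bar> \<le> e" using p(2)[OF sinS[of x]] by simp
  qed
qed

lemma integral_approx_off_ball:
  fixes \<mu> :: "'b::euclidean_space measure"
  assumes \<mu>: "prob_space \<mu>" "sets \<mu> = sets borel"
    and f: "f \<in> borel_measurable borel" "\<And>x. \<bar>f x\<bar> \<le> B"
    and T: "T \<in> borel_measurable borel" "\<And>x. \<bar>T x\<bar> \<le> B + e" "\<And>x. norm x \<le> K \<Longrightarrow> \<bar>f x - T x\<bar> \<le> e"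
    and e: "0 < e" and tail: "measure \<mu> {x. K < norm x} \<le> \<delta>"
  shows "\<bar>(\<integral>x. f x \<partial>\<mu>) - (\<integral>x. T x \<partial>\<mu>)\<bar> \<le> e + (2 * B + e) * \<delta>"
proof -
  interpret prob_space \<mu> by fact
  have m: "borel_measurable \<mu> = borel_measurable borel"
    by (rule measurable_cong_sets[OF \<mu>(2) refl])
  have B: "0 \<le> B" using f(2)[of undefined] by linarith
  have fi: "integrable \<mu> f" using f by (intro integrable_const_bound[of f B]) (auto simp: m)
  have Ti: "integrable \<mu> T" using T by (intro integrable_const_bound[of T "B + e"]) (auto simp: m)
  have A: "{x. K < norm x} \<in> sets \<mu>" unfolding \<mu>(2) by measurable
  have "\<bar>(\<integral>x. f x \<partial>\<mu>) - (\<integral>x. T x \<partial>\<mu>)\<bar> = \<bar>\<integral>x. f x - T x \<partial>\<mu>\<bar>"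
    using fi Ti by simp
  also have "\<dots> \<le> (\<integral>x. e + (2 * B + e) * indicator {x. K < norm x} x \<partial>\<mu>)"
  proof (rule integral_abs_bound_integral)
    show "integrable \<mu> (\<lambda>x. f x - T x)" using fi Ti by simp
    show "integrable \<mu> (\<lambda>x. e + (2 * B + e) * indicator {x. K < norm x} x)"
      using A by (intro Bochner_Integration.integrable_add integrable_mult_right integrable_real_indicator)
        (auto simp: less_top[symmetric])
    fix x
    show "\<bar>f x - T x\<bar> \<le> e + (2 * B + e) * indicator {x. K < norm x} x"
    proof (cases "K < norm x")
      case True
      then show ?thesis using f(2)[of x] T(2)[of x] e by (simp add: indicator_def)
    qed (use T(3)[of x] in simp)
  qed
  also have "\<dots> = e + (2 * B + e) * measure \<mu> {x. K < norm x}"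
    using A by (simp add: prob_space less_top[symmetric] Int_absorb2 sets.sets_into_space)
  also have "\<dots> \<le> e + (2 * B + e) * \<delta>"
    using tail B e by (intro add_left_mono mult_left_mono) auto
  finally show ?thesis .
qed

section \<open>From characteristic functions to convergence in law\<close>

lemma trig_poly_integral_tendsto:
  fixes \<mu> :: "nat \<Rightarrow> 'b::euclidean_space measure"
  assumes T: "trig_poly T"
    and \<mu>: "\<And>n. n \<ge> n0 \<Longrightarrow> prob_space (\<mu> n)" "\<And>n. n \<ge> n0 \<Longrightarrow> sets (\<mu> n) = sets borel"
    and \<nu>: "prob_space \<nu>" "sets \<nu> = sets borel"
    and char: "\<And>t. (\<lambda>n. \<integral>x. cis (t \<bullet> x) \<partial>\<mu> n) \<longlonglongrightarrow> (\<integral>x. cis (t \<bullet> x) \<partial>\<nu>)"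
  shows "(\<lambda>n. \<integral>x. T x \<partial>\<mu> n) \<longlonglongrightarrow> (\<integral>x. T x \<partial>\<nu>)"
proof -
  have int: "integrable M (\<lambda>x. c * cis (t \<bullet> x))"
    if "prob_space M" "sets M = sets borel" for M :: "'b measure" and c t
  proof -
    interpret prob_space M by fact
    have m: "borel_measurable M = borel_measurable borel"
      by (rule measurable_cong_sets[OF that(2) refl])
    have "(\<lambda>x. cis (t \<bullet> x)) \<in> borel_measurable borel" by measurable
    then show ?thesis by (intro integrable_mult_right integrable_const_bound[of _ 1]) (auto simp: m)
  qed
  have "(\<forall>n\<ge>n0. integrable (\<mu> n) T) \<and> integrable \<nu> T \<and> (\<lambda>n. \<integral>x. T x \<partial>\<mu> n) \<longlonglongrightarrow> (\<integral>x. T x \<partial>\<nu>)"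
    using T
  proof (induction rule: trig_poly.induct)
    case (monomial c t)
    then show ?case using int[OF \<mu>] int[OF \<nu>] char[of t] by (auto intro!: tendsto_intros)
  next
    case (add f g)
    have "(\<lambda>n. (\<integral>x. f x \<partial>\<mu> n) + (\<integral>x. g x \<partial>\<mu> n)) \<longlonglongrightarrow> (\<integral>x. f x \<partial>\<nu>) + (\<integral>x. g x \<partial>\<nu>)"
      using add by (auto intro: tendsto_add)
    then have "(\<lambda>n. \<integral>x. f x + g x \<partial>\<mu> n) \<longlonglongrightarrow> (\<integral>x. f x \<partial>\<nu>) + (\<integral>x. g x \<partial>\<nu>)"
      by (rule Lim_transform_eventually)
         (use add in \<open>auto intro!: eventually_mono[OF eventually_ge_at_top[of n0]]\<close>)
    then show ?case using add by simp
  qed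
  then show ?thesis by simp
qed

text \<open>Levy's continuity theorem with a known limit law. Bounded second moments give tightness
  through the Markov inequality; on a large ball the test function is replaced by a trigonometric
  polynomial, and off the ball both are bounded and the mass is small.\<close>

proposition conv_in_law_of_char:
  fixes X :: "nat \<Rightarrow> 'a \<Rightarrow> 'b::euclidean_space"
  assumes M: "prob_space M" and X: "\<And>n. n \<ge> n0 \<Longrightarrow> X n \<in> borel_measurable M"
    and sq: "\<And>n. n \<ge> n0 \<Longrightarrow> integrable M (\<lambda>w. (norm (X n w))\<^sup>2)"
    and sq_le: "\<And>n. n \<ge> n0 \<Longrightarrow> (\<integral>w. (norm (X n w))\<^sup>2 \<partial>M) \<le> C"
    and \<nu>: "prob_space \<nu>" "sets \<nu> = sets borel"
    and char: "\<And>t. (\<lambda>n. \<integral>w. cis (t \<bullet> X n w) \<partial>M) \<longlonglongrightarrow> (\<integral>x. cis (t \<bullet> x) \<partial>\<nu>)"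
  shows "conv_in_law M X \<nu>"
  unfolding conv_in_law_def weak_conv_borel_def
proof (intro allI impI, elim conjE)
  interpret prob_space M by fact
  interpret \<nu>: prob_space \<nu> by fact
  fix f :: "'b \<Rightarrow> real" assume fc: "continuous_on UNIV f" and "bounded (range f)"
  then obtain B where B: "\<And>x. \<bar>f x\<bar> \<le> B" by (auto simp: bounded_iff)
  have f: "f \<in> borel_measurable borel" using fc by (rule borel_measurable_continuous_onI)
  let ?\<mu> = "\<lambda>n. distr M borel (X n)"
  have \<mu>: "prob_space (?\<mu> n)" "sets (?\<mu> n) = sets borel" if "n \<ge> n0" for n
    using X[OF that] by (auto intro: prob_space_distr)
  have charm: "(\<lambda>n. \<integral>x. cis (t \<bullet> x) \<partial>?\<mu> n) \<longlonglongrightarrow> (\<integral>x. cis (t \<bullet> x) \<partial>\<nu>)" for t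
    by (rule Lim_transform_eventually[OF char[of t]])
       (auto intro!: eventually_mono[OF eventually_ge_at_top[of n0]] simp: integral_distr X)
  show "(\<lambda>n. \<integral>x. f x \<partial>?\<mu> n) \<longlonglongrightarrow> (\<integral>x. f x \<partial>\<nu>)"
  proof (rule LIMSEQ_I)
    fix r :: real assume r: "0 < r"
    have B0: "0 \<le> B" using B[of undefined] by linarith
    have C0: "0 \<le> C" using order_trans[OF Bochner_Integration.integral_nonneg sq_le[of n0]] by auto
    \<comment> \<open>Two approximation errors of size \<delta> + (2 * B + \<delta>) * \<delta>, one
      for each measure, and one \<delta> for the trigonometric polynomial have to fit below
      r.\<close>
    define \<delta> where "\<delta> = min 1 (r / (8 * (B + 1)))"
    have \<delta>: "0 < \<delta>" "\<delta> \<le> 1" "\<delta> * (8 * (B + 1)) \<le> r"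
      using r B0 min.cobounded2[of 1 "r / (8 * (B + 1))"]
      by (auto simp: \<delta>_def pos_le_divide_eq simp del: min.cobounded2)
    have small: "\<delta> + (2 * B + \<delta>) * \<delta> < r / 2 - \<delta>"
    proof -
      have "(2 * B + \<delta>) * \<delta> \<le> (2 * B + 1) * \<delta>" using \<delta> by (intro mult_right_mono) auto
      moreover have "0 \<le> B * \<delta>" using B0 \<delta> by simp
      moreover have "(2 * B + 1) * \<delta> = 2 * (B * \<delta>) + \<delta>" "\<delta> * (8 * (B + 1)) = 8 * (B * \<delta>) + 8 * \<delta>"
        by (simp_all add: algebra_simps)
      ultimately show ?thesis using \<delta> by linarith
    qed
    have "(\<lambda>K. measure \<nu> {x. real K < norm x}) \<longlonglongrightarrow> measure \<nu> (\<Inter>K. {x. real K < norm x})"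
    proof (rule \<nu>.finite_Lim_measure_decseq)
      have "{x :: 'b. real K < norm x} \<in> sets borel" for K by measurable
      then show "range (\<lambda>K. {x. real K < norm x}) \<subseteq> sets \<nu>" unfolding \<nu>(2) by blast
    qed (auto simp: decseq_def)
    also have "(\<Inter>K. {x :: 'b. real K < norm x}) = {}"
    proof -
      have "\<exists>K. \<not> real K < norm x" for x :: 'b
        using reals_Archimedean2[of "norm x"] by (meson less_asym)
      then show ?thesis by blast
    qed
    finally have lim: "(\<lambda>K. measure \<nu> {x. real K < norm x}) \<longlonglongrightarrow> 0" by simp
    have "\<forall>\<^sub>F K in sequentially. measure \<nu> {x. real K < norm x} < \<delta> \<and> C / (real K)\<^sup>2 < \<delta> \<and> 0 < K"
    proof (intro eventually_conj)
      show "\<forall>\<^sub>F K in sequentially. measure \<nu> {x. real K < norm x} < \<delta>"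
        using order_tendstoD(2)[OF lim \<delta>(1)] .
      have "(\<lambda>K. C / (real K)\<^sup>2) \<longlonglongrightarrow> 0"
        by (intro tendsto_divide_0[OF tendsto_const] filterlim_at_top_imp_at_infinity
            filterlim_pow_at_top filterlim_real_sequentially) auto
      then show "\<forall>\<^sub>F K in sequentially. C / (real K)\<^sup>2 < \<delta>"
        using \<delta>(1) by (rule order_tendstoD)
    qed (rule eventually_gt_at_top)
    then obtain K where K: "measure \<nu> {x. real K < norm x} < \<delta>" "C / (real K)\<^sup>2 < \<delta>" "0 < K"
      by (auto simp: eventually_sequentially)
    obtain T where T: "trig_poly (\<lambda>x. of_real (T x))" "T \<in> borel_measurable borel"
      "\<And>x. \<bar>T x\<bar> \<le> B + \<delta>" "\<And>x. norm x \<le> K \<Longrightarrow> \<bar>f x - T x\<bar> \<le> \<delta>"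
      using trig_poly_approximation[OF fc B, of K \<delta>] K(3) \<delta>(1) by (metis of_nat_0_less_iff)
    have tail: "measure (?\<mu> n) {x. real K < norm x} \<le> \<delta>" if n: "n \<ge> n0" for n
    proof -
      have [measurable]: "X n \<in> borel_measurable M" using X[OF n] .
      have "measure (?\<mu> n) {x. real K < norm x} = measure M {w \<in> space M. real K < norm (X n w)}"
        by (subst measure_distr) (auto simp: vimage_def Int_def conj_commute)
      also have "\<dots> \<le> measure M {w \<in> space M. (norm (X n w))\<^sup>2 \<ge> (real K)\<^sup>2}"
        by (intro finite_measure_mono) (auto intro: power_mono)
      also have "\<dots> \<le> (\<integral>w. (norm (X n w))\<^sup>2 \<partial>M) / (real K)\<^sup>2"
        using K(3) by (intro integral_Markov_inequality_measure[OF sq[OF n], of "{}"]) auto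
      also have "\<dots> \<le> C / (real K)\<^sup>2" using sq_le[OF n] by (intro divide_right_mono) auto
      finally show ?thesis using K(2) by simp
    qed
    have "(\<lambda>n. \<integral>x. complex_of_real (T x) \<partial>?\<mu> n) \<longlonglongrightarrow> (\<integral>x. complex_of_real (T x) \<partial>\<nu>)"
      by (rule trig_poly_integral_tendsto[OF T(1) \<mu> \<nu> charm])
    then have "(\<lambda>n. \<integral>x. T x \<partial>?\<mu> n) \<longlonglongrightarrow> (\<integral>x. T x \<partial>\<nu>)"
      by (simp add: integral_complex_of_real tendsto_of_real_iff)
    then obtain n1 where n1: "\<And>n. n \<ge> n1 \<Longrightarrow> \<bar>(\<integral>x. T x \<partial>?\<mu> n) - (\<integral>x. T x \<partial>\<nu>)\<bar> < \<delta>"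
      using LIMSEQ_D[OF _ \<delta>(1)] by (metis real_norm_def)
    show "\<exists>no. \<forall>n\<ge>no. norm ((\<integral>x. f x \<partial>?\<mu> n) - (\<integral>x. f x \<partial>\<nu>)) < r"
    proof (intro exI[of _ "max n0 n1"] allI impI)
      fix n assume n: "n \<ge> max n0 n1"
      have "\<bar>(\<integral>x. f x \<partial>?\<mu> n) - (\<integral>x. T x \<partial>?\<mu> n)\<bar> \<le> \<delta> + (2 * B + \<delta>) * \<delta>"
        using n by (intro integral_approx_off_ball[OF \<mu> f B T(2-4) \<delta>(1) tail]) auto
      moreover have "\<bar>(\<integral>x. f x \<partial>\<nu>) - (\<integral>x. T x \<partial>\<nu>)\<bar> \<le> \<delta> + (2 * B + \<delta>) * \<delta>"
        using K(1) by (intro integral_approx_off_ball[OF \<nu> f B T(2-4) \<delta>(1)]) auto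
      ultimately show "norm ((\<integral>x. f x \<partial>?\<mu> n) - (\<integral>x. f x \<partial>\<nu>)) < r"
        using n1[of n] n small unfolding real_norm_def by linarith
    qed
  qed
qed

text \<open>Slutsky's argument on characteristic functions: x \<mapsto> cis x is 1-Lipschitz, so
  replacing R by m costs at most |t| times the mean of |R - m|, which nonnegativity of the variance
  bounds by the L2 norm.\<close>

lemma char_add_L2:
  fixes X R :: "nat \<Rightarrow> 'a \<Rightarrow> 'b::euclidean_space"
  assumes M: "prob_space M"
    and X: "\<And>n. n \<ge> n0 \<Longrightarrow> X n \<in> borel_measurable M" and R: "\<And>n. n \<ge> n0 \<Longrightarrow> R n \<in> borel_measurable M"
    and sq: "\<And>n. n \<ge> n0 \<Longrightarrow> integrable M (\<lambda>w. (norm (R n w - m))\<^sup>2)"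
    and R0: "(\<lambda>n. \<integral>w. (norm (R n w - m))\<^sup>2 \<partial>M) \<longlonglongrightarrow> 0"
    and char: "(\<lambda>n. \<integral>w. cis (t \<bullet> X n w) \<partial>M) \<longlonglongrightarrow> \<phi>"
  shows "(\<lambda>n. \<integral>w. cis (t \<bullet> (X n w + R n w)) \<partial>M) \<longlonglongrightarrow> cis (t \<bullet> m) * \<phi>"
proof -
  interpret prob_space M by fact
  have bound: "norm ((\<integral>w. cis (t \<bullet> (X n w + R n w)) \<partial>M) - cis (t \<bullet> m) * (\<integral>w. cis (t \<bullet> X n w) \<partial>M))
      \<le> norm t * sqrt (\<integral>w. (norm (R n w - m))\<^sup>2 \<partial>M)" if n: "n \<ge> n0" for n
  proof -
    have [measurable]: "X n \<in> borel_measurable M" "R n \<in> borel_measurable M" using X R n by auto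
    have ci: "integrable M (\<lambda>w. cis (f w))" if [measurable]: "f \<in> borel_measurable M" for f
      by (rule integrable_const_bound[of _ 1]) auto
    have sqi: "integrable M (\<lambda>w. (norm (R n w - m))\<^sup>2)" by (rule sq[OF n])
    have ni: "integrable M (\<lambda>w. norm (R n w - m))"
    proof (rule Bochner_Integration.integrable_bound[of _ "\<lambda>w. 1 + (norm (R n w - m))\<^sup>2"])
      show "AE w in M. norm (norm (R n w - m)) \<le> norm (1 + (norm (R n w - m))\<^sup>2)"
      proof (intro AE_I2)
        fix w
        have "2 * norm (R n w - m) \<le> 1 + (norm (R n w - m))\<^sup>2"
          using zero_le_power2[of "norm (R n w - m) - 1"] by (simp add: power2_eq_square algebra_simps)
        then show "norm (norm (R n w - m)) \<le> norm (1 + (norm (R n w - m))\<^sup>2)"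
          using norm_ge_zero[of "R n w - m"] by (simp del: norm_ge_zero)
      qed
    qed (use sqi in auto)
    have "(\<integral>w. cis (t \<bullet> (X n w + R n w)) \<partial>M) - cis (t \<bullet> m) * (\<integral>w. cis (t \<bullet> X n w) \<partial>M) =
        (\<integral>w. cis (t \<bullet> (X n w + R n w)) - cis (t \<bullet> m) * cis (t \<bullet> X n w) \<partial>M)"
      by (subst Bochner_Integration.integral_diff) (auto intro!: ci integrable_mult_right)
    also have "norm \<dots> \<le> (\<integral>w. norm t * norm (R n w - m) \<partial>M)"
    proof (rule norm_integral_le)
      show "integrable M (\<lambda>w. cis (t \<bullet> (X n w + R n w)) - cis (t \<bullet> m) * cis (t \<bullet> X n w))"
        by (auto intro!: ci integrable_mult_right)
      fix w
      have "norm (cis (t \<bullet> (X n w + R n w)) - cis (t \<bullet> m) * cis (t \<bullet> X n w)) \<le> \<bar>t \<bullet> (R n w - m)\<bar>"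
        using norm_cis_diff_le[of "t \<bullet> (X n w + R n w)" "t \<bullet> m + t \<bullet> X n w"]
        by (simp add: cis_mult inner_add_right inner_diff_right algebra_simps)
      also have "\<dots> \<le> norm t * norm (R n w - m)" by (rule Cauchy_Schwarz_ineq2)
      finally show "norm (cis (t \<bullet> (X n w + R n w)) - cis (t \<bullet> m) * cis (t \<bullet> X n w)) \<le> norm t * norm (R n w - m)" .
    qed (use ni in auto)
    also have "\<dots> = norm t * expectation (\<lambda>w. norm (R n w - m))" by simp
    also have "\<dots> \<le> norm t * sqrt (\<integral>w. (norm (R n w - m))\<^sup>2 \<partial>M)"
    proof (intro mult_left_mono real_le_rsqrt)
      have "0 \<le> variance (\<lambda>w. norm (R n w - m))" by (intro Bochner_Integration.integral_nonneg) auto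
      then show "(expectation (\<lambda>w. norm (R n w - m)))\<^sup>2 \<le> (\<integral>w. (norm (R n w - m))\<^sup>2 \<partial>M)"
        using variance_eq[OF ni sqi] by simp
    qed auto
    finally show ?thesis .
  qed
  have "(\<lambda>n. norm t * sqrt (\<integral>w. (norm (R n w - m))\<^sup>2 \<partial>M)) \<longlonglongrightarrow> norm t * sqrt 0"
    by (intro tendsto_intros R0)
  then have "(\<lambda>n. norm t * sqrt (\<integral>w. (norm (R n w - m))\<^sup>2 \<partial>M)) \<longlonglongrightarrow> 0" by simp
  then have "(\<lambda>n. (\<integral>w. cis (t \<bullet> (X n w + R n w)) \<partial>M) - cis (t \<bullet> m) * (\<integral>w. cis (t \<bullet> X n w) \<partial>M)) \<longlonglongrightarrow> 0"
    by (rule Lim_null_comparison[rotated])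
       (use bound in \<open>auto intro!: eventually_mono[OF eventually_ge_at_top[of n0]]\<close>)
  from tendsto_add[OF this tendsto_mult[OF tendsto_const char, of "cis (t \<bullet> m)"]]
  show ?thesis by simp
qed

section \<open>The multivariate normal distribution\<close>

lemma prod_Basis_vec: "(\<Prod>b\<in>Basis. f (z \<bullet> b)) = (\<Prod>i\<in>UNIV. f ((z :: real^'d) $ i))"
proof -
  have B: "(Basis :: (real^'d) set) = range (\<lambda>i. axis i 1)" by (auto simp: Basis_vec_def)
  have inj: "inj (\<lambda>i::'d. axis i (1::real))" by (auto simp: inj_on_def axis_eq_axis)
  show ?thesis unfolding B by (simp add: prod.reindex[OF inj] inner_axis)
qed

lemma std_normal_vec_eq:
  "std_normal_vec = density lborel (\<lambda>z :: real^'d. ennreal (\<Prod>b\<in>Basis. std_normal_density (z \<bullet> b)))"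
  unfolding std_normal_vec_def prod_Basis_vec ..

lemma sets_std_normal_vec [simp, measurable_cong]: "sets std_normal_vec = sets borel"
  by (simp add: std_normal_vec_def)

lemma prob_space_std_normal_vec: "prob_space (std_normal_vec :: (real^'d) measure)"
proof
  have 1: "(\<integral>\<^sup>+x. ennreal (std_normal_density x) \<partial>lborel) = 1"
  proof -
    interpret real_distribution std_normal_distribution by (rule real_dist_normal_dist)
    show ?thesis using emeasure_space_1 by (simp add: emeasure_density)
  qed
  have "emeasure (std_normal_vec :: (real^'d) measure) (space std_normal_vec) =
      (\<integral>\<^sup>+z. (\<Prod>b\<in>Basis. ennreal (std_normal_density (z \<bullet> b))) \<partial>(lborel :: (real^'d) measure))"
    unfolding std_normal_vec_eq
    by (subst emeasure_density) (auto simp: prod_ennreal)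
  also have "\<dots> = 1" by (subst nn_integral_lborel_prod) (auto simp: 1)
  finally show "emeasure (std_normal_vec :: (real^'d) measure) (space std_normal_vec) = 1" .
qed

lemma char_std_normal_vec:
  "(\<integral>z. cis (s \<bullet> z) \<partial>std_normal_vec) = of_real (exp (- ((s :: real^'d) \<bullet> s) / 2))"
proof -
  \<comment> \<open>Density and character both factor over the coordinates, so the integral over the
    product space reduces to one-dimensional normal characteristic functions.\<close>
  define h where "h b x = of_real (std_normal_density x) * cis ((s \<bullet> b) * x)" for b :: "real^'d" and x
  have h_meas [measurable]: "h b \<in> borel_measurable borel" for b unfolding h_def by measurable
  have h_int: "integrable lborel (h b)" for b
    by (rule Bochner_Integration.integrable_bound[OF integrable_normal_density[of 1 0]])
       (auto simp: h_def norm_mult)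
  have h_val: "(\<integral>x. h b x \<partial>lborel) = of_real (exp (- ((s \<bullet> b)\<^sup>2) / 2))" for b
  proof -
    have "(\<integral>x. h b x \<partial>lborel) = char std_normal_distribution (s \<bullet> b)"
      unfolding char_def
      unfolding h_def by (subst integral_density) (auto simp: cis_eq_iexp scaleR_conv_of_real)
    then show ?thesis by (simp add: char_std_normal_distribution)
  qed
  interpret product_sigma_finite "\<lambda>_ :: real^'d. lborel :: real measure" ..
  have "(\<integral>z. cis (s \<bullet> z) \<partial>std_normal_vec) =
      (\<integral>z. (\<Prod>b\<in>Basis. std_normal_density (z \<bullet> b)) *\<^sub>R cis (s \<bullet> z) \<partial>lborel)"
    unfolding std_normal_vec_eq by (subst integral_density) (auto intro!: prod_nonneg)
  also have "(\<lambda>z. (\<Prod>b\<in>Basis. std_normal_density (z \<bullet> b)) *\<^sub>R cis (s \<bullet> z)) = (\<lambda>z. \<Prod>b\<in>Basis. h b (z \<bullet> b))"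
  proof
    fix z :: "real^'d"
    have cis_sum: "cis (\<Sum>b\<in>I. g b) = (\<Prod>b\<in>I. cis (g b))" if "finite I" for g :: "real^'d \<Rightarrow> real" and I
      using that by (induction rule: finite_induct) (auto simp: cis_mult[symmetric])
    have "s \<bullet> z = (\<Sum>b\<in>Basis. (s \<bullet> b) * (z \<bullet> b))" by (rule euclidean_inner)
    then show "(\<Prod>b\<in>Basis. std_normal_density (z \<bullet> b)) *\<^sub>R cis (s \<bullet> z) = (\<Prod>b\<in>Basis. h b (z \<bullet> b))"
      by (simp add: h_def cis_sum prod.distrib scaleR_conv_of_real)
  qed
  also have "(\<integral>z. (\<Prod>b\<in>Basis. h b (z \<bullet> b)) \<partial>lborel) =
      (\<integral>f. (\<Prod>b\<in>Basis. h b (f b)) \<partial>(\<Pi>\<^sub>M b\<in>Basis. lborel))"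
    by (subst lborel_eq, subst integral_distr) auto
  also have "\<dots> = (\<Prod>b\<in>Basis. \<integral>x. h b x \<partial>lborel)"
    by (rule product_integral_prod) (auto simp: h_int)
  also have "\<dots> = of_real (\<Prod>b\<in>Basis. exp (- ((s \<bullet> b)\<^sup>2) / 2))" by (simp add: h_val)
  also have "(\<Prod>b\<in>Basis. exp (- ((s \<bullet> b)\<^sup>2) / 2)) = exp (\<Sum>b\<in>Basis. - ((s \<bullet> b)\<^sup>2) / 2)"
    by (simp add: exp_sum)
  also have "(\<Sum>b\<in>Basis. - ((s \<bullet> b)\<^sup>2) / 2) = - (s \<bullet> s) / 2"
    by (subst (2) euclidean_inner) (simp add: sum_negf sum_divide_distrib power2_eq_square)
  finally show ?thesis .
qed

lemma measurable_affine [measurable]: "(\<lambda>z. m + B *v z) \<in> borel_measurable (borel :: (real^'d) measure)"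
  by (intro borel_measurable_continuous_onI continuous_intros matrix_vector_mult_linear_continuous_on)

lemma prob_space_multi_normal: "prob_space (multi_normal m C)"
  unfolding multi_normal_def
  by (intro prob_space.prob_space_distr prob_space_std_normal_vec) measurable

lemma sets_multi_normal [simp]: "sets (multi_normal m C) = sets borel"
  by (simp add: multi_normal_def)

section \<open>Square integrable functions\<close>

definition sq_int :: "'a measure \<Rightarrow> ('a \<Rightarrow> 'b::euclidean_space) \<Rightarrow> bool" where
  "sq_int M f \<longleftrightarrow> f \<in> borel_measurable M \<and> integrable M (\<lambda>w. (norm (f w))\<^sup>2)"

definition msq :: "'a measure \<Rightarrow> ('a \<Rightarrow> 'b::euclidean_space) \<Rightarrow> real" where
  "msq M f = (\<integral>w. (norm (f w))\<^sup>2 \<partial>M)"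

lemma sq_int_measurable [measurable_dest]: "sq_int M f \<Longrightarrow> f \<in> borel_measurable M"
  by (simp add: sq_int_def)

lemma sq_int_norm_sq: "sq_int M f \<Longrightarrow> integrable M (\<lambda>w. (norm (f w))\<^sup>2)"
  by (simp add: sq_int_def)

lemma msq_nonneg: "0 \<le> msq M f"
  by (simp add: msq_def)

lemma norm_add_sq_le: "(norm (x + y))\<^sup>2 \<le> 2 * (norm x)\<^sup>2 + 2 * (norm (y :: 'b::real_normed_vector))\<^sup>2"
proof -
  have "(norm (x + y))\<^sup>2 \<le> (norm x + norm y)\<^sup>2" by (intro power_mono norm_triangle_ineq) auto
  also have "\<dots> \<le> 2 * (norm x)\<^sup>2 + 2 * (norm y)\<^sup>2"
    using zero_le_power2[of "norm x - norm y"] by (simp add: power2_eq_square algebra_simps)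
  finally show ?thesis .
qed

lemma sq_int_add:
  assumes "sq_int M f" "sq_int M g"
  shows "sq_int M (\<lambda>w. f w + g w)"
  unfolding sq_int_def
proof
  show [measurable]: "(\<lambda>w. f w + g w) \<in> borel_measurable M" using assms by measurable
  show "integrable M (\<lambda>w. (norm (f w + g w))\<^sup>2)"
  proof (rule Bochner_Integration.integrable_bound)
    show "integrable M (\<lambda>w. 2 * (norm (f w))\<^sup>2 + 2 * (norm (g w))\<^sup>2)"
      using assms by (simp add: sq_int_def)
    show "AE w in M. norm ((norm (f w + g w))\<^sup>2) \<le> norm (2 * (norm (f w))\<^sup>2 + 2 * (norm (g w))\<^sup>2)"
      by (intro AE_I2) (simp add: norm_add_sq_le)
  qed measurable
qed

lemma sq_int_bound:
  assumes f: "sq_int M f" and g: "g \<in> borel_measurable M"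
    and le: "\<And>w. w \<in> space M \<Longrightarrow> norm (g w) \<le> K * norm (f w)"
  shows "sq_int M g"
  unfolding sq_int_def
proof
  note [measurable] = g
  show "integrable M (\<lambda>w. (norm (g w))\<^sup>2)"
  proof (rule Bochner_Integration.integrable_bound)
    show "integrable M (\<lambda>w. K\<^sup>2 * (norm (f w))\<^sup>2)" using f by (simp add: sq_int_def)
    show "AE w in M. norm ((norm (g w))\<^sup>2) \<le> norm (K\<^sup>2 * (norm (f w))\<^sup>2)"
      using le by (intro AE_I2) (auto simp flip: power_mult_distrib intro!: power_mono)
  qed measurable
qed fact

lemma sq_int_scaleR: "sq_int M f \<Longrightarrow> sq_int M (\<lambda>w. c *\<^sub>R f w)"
  by (rule sq_int_bound[of M f _ "\<bar>c\<bar>"]) (auto simp: sq_int_def)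

lemma sq_int_times: "sq_int M (f :: 'a \<Rightarrow> real) \<Longrightarrow> sq_int M (\<lambda>w. c * f w)"
  using sq_int_scaleR[of M f c] by simp

lemma sq_int_diff: "sq_int M f \<Longrightarrow> sq_int M g \<Longrightarrow> sq_int M (\<lambda>w. f w - g w)"
  using sq_int_add[of M f "\<lambda>w. (- 1) *\<^sub>R g w"] sq_int_scaleR[of M g "- 1"] by simp

lemma borel_measurable_matrix_vector [measurable]:
  "(*v) (A :: real^'n^'m) \<in> borel_measurable borel"
  by (intro borel_measurable_continuous_onI matrix_vector_mult_linear_continuous_on)

lemma sq_int_matrix: "sq_int M f \<Longrightarrow> sq_int M (\<lambda>w. (A :: real^'n^'m) *v f w)"
proof (rule sq_int_bound[of M f _ "onorm ((*v) A)"])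
  assume "sq_int M f"
  then show "(\<lambda>w. A *v f w) \<in> borel_measurable M"
    by (intro measurable_compose[OF _ borel_measurable_matrix_vector]) (simp add: sq_int_def)
qed (auto intro!: onorm matrix_vector_mul_bounded_linear)

lemma sq_int_scaleR_const: "sq_int M (f :: 'a \<Rightarrow> real) \<Longrightarrow> sq_int M (\<lambda>w. f w *\<^sub>R (v :: 'b::euclidean_space))"
  by (rule sq_int_bound[of M f _ "norm v"]) (auto simp: sq_int_def)

lemma (in prob_space) sq_int_const: "sq_int M (\<lambda>w. c)"
  by (simp add: sq_int_def)

lemma (in prob_space) sq_int_sum:
  "finite I \<Longrightarrow> (\<And>i. i \<in> I \<Longrightarrow> sq_int M (f i)) \<Longrightarrow> sq_int M (\<lambda>w. \<Sum>i\<in>I. f i w)"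
  by (induction rule: finite_induct) (auto intro: sq_int_add sq_int_const)

lemma sq_int_cong: "(\<And>w. w \<in> space M \<Longrightarrow> f w = g w) \<Longrightarrow> sq_int M f = sq_int M g"
  unfolding sq_int_def by (intro conj_cong measurable_cong Bochner_Integration.integrable_cong) auto

lemma msq_cong: "(\<And>w. w \<in> space M \<Longrightarrow> f w = g w) \<Longrightarrow> msq M f = msq M g"
  unfolding msq_def by (intro Bochner_Integration.integral_cong) auto

lemma sq_int_norm_mult_integrable:
  assumes "sq_int M f" "sq_int M g"
  shows "integrable M (\<lambda>w. norm (f w) * norm (g w))"
proof (rule Bochner_Integration.integrable_bound)
  show "integrable M (\<lambda>w. (norm (f w))\<^sup>2 + (norm (g w))\<^sup>2)" using assms by (simp add: sq_int_def)
  show "(\<lambda>w. norm (f w) * norm (g w)) \<in> borel_measurable M" using assms by measurable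
  show "AE w in M. norm (norm (f w) * norm (g w)) \<le> norm ((norm (f w))\<^sup>2 + (norm (g w))\<^sup>2)"
  proof (intro AE_I2)
    fix w
    have 1: "0 \<le> (norm (f w) - norm (g w))\<^sup>2" and 2: "0 \<le> norm (f w) * norm (g w)" by simp_all
    have "norm (f w) * norm (g w) \<le> (norm (f w))\<^sup>2 + (norm (g w))\<^sup>2"
      using 1 2 unfolding power2_diff by linarith
    then show "norm (norm (f w) * norm (g w)) \<le> norm ((norm (f w))\<^sup>2 + (norm (g w))\<^sup>2)" by simp
  qed
qed

lemma sq_int_inner_integrable:
  assumes "sq_int M f" "sq_int M g"
  shows "integrable M (\<lambda>w. f w \<bullet> g w)"
  by (rule Bochner_Integration.integrable_bound[OF sq_int_norm_mult_integrable[OF assms]])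
     (use assms in \<open>auto simp: Cauchy_Schwarz_ineq2\<close>)

lemma sq_int_scaleR_integrable:
  assumes "sq_int M (f :: 'a \<Rightarrow> real)" "sq_int M g"
  shows "integrable M (\<lambda>w. f w *\<^sub>R g w)"
  by (rule Bochner_Integration.integrable_bound[OF sq_int_norm_mult_integrable[OF assms]])
     (use assms in \<open>auto\<close>)

lemma (in prob_space) sq_int_integrable:
  assumes "sq_int M f"
  shows "integrable M f"
  using sq_int_scaleR_integrable[OF sq_int_const[of "1::real"] assms] by simp

lemma msq_add_le:
  assumes "sq_int M f" "sq_int M g"
  shows "msq M (\<lambda>w. f w + g w) \<le> 2 * msq M f + 2 * msq M g"
proof -
  have "msq M (\<lambda>w. f w + g w) \<le> (\<integral>w. 2 * (norm (f w))\<^sup>2 + 2 * (norm (g w))\<^sup>2 \<partial>M)"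
    unfolding msq_def using assms sq_int_add[OF assms]
    by (intro Bochner_Integration.integral_mono norm_add_sq_le) (auto simp: sq_int_def)
  then show ?thesis using assms by (simp add: sq_int_def msq_def)
qed

lemma msq_scaleR: "msq M (\<lambda>w. c *\<^sub>R f w) = c\<^sup>2 * msq M f"
  by (simp add: msq_def power_mult_distrib)

lemma msq_mono:
  assumes "sq_int M f" "sq_int M g" "\<And>w. w \<in> space M \<Longrightarrow> norm (f w) \<le> norm (g w)"
  shows "msq M f \<le> msq M g"
  unfolding msq_def using assms
  by (intro Bochner_Integration.integral_mono power_mono) (auto simp: sq_int_def)

lemma msq_matrix_le:
  assumes "sq_int M f"
  shows "msq M (\<lambda>w. (A :: real^'n^'m) *v f w) \<le> (onorm ((*v) A))\<^sup>2 * msq M f"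
proof -
  have "msq M (\<lambda>w. A *v f w) \<le> msq M (\<lambda>w. onorm ((*v) A) *\<^sub>R f w)"
    by (intro msq_mono sq_int_matrix sq_int_scaleR assms)
       (simp add: abs_of_nonneg[OF onorm_pos_le] matrix_vector_mul_bounded_linear onorm)
  then show ?thesis by (simp add: msq_scaleR)
qed

text \<open>Young's inequality with a free weight s, to be chosen so as to balance two factors of
  different orders of decay.\<close>

lemma (in prob_space) norm_expectation_scaleR_le:
  assumes "sq_int M (f :: 'a \<Rightarrow> real)" "sq_int M g" "0 < s"
  shows "norm (expectation (\<lambda>w. f w *\<^sub>R g w)) \<le> s * msq M f + msq M g / s"
proof -
  have "norm (expectation (\<lambda>w. f w *\<^sub>R g w)) \<le> expectation (\<lambda>w. s * (norm (f w))\<^sup>2 + (norm (g w))\<^sup>2 / s)"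
  proof (rule norm_integral_le[OF sq_int_scaleR_integrable[OF assms(1,2)]])
    show "integrable M (\<lambda>w. s * (norm (f w))\<^sup>2 + (norm (g w))\<^sup>2 / s)"
      using assms by (simp add: sq_int_def)
    fix w
    have 1: "0 \<le> (s * norm (f w) - norm (g w))\<^sup>2" and 2: "0 \<le> s * norm (f w) * norm (g w)"
      using assms(3) by simp_all
    have "s * (norm (f w) * norm (g w)) \<le> (s * norm (f w))\<^sup>2 + (norm (g w))\<^sup>2"
      using 1 2 unfolding power2_diff by linarith
    also have "\<dots> = s * (s * (norm (f w))\<^sup>2 + (norm (g w))\<^sup>2 / s)"
      using assms(3) by (simp add: power2_eq_square field_simps)
    finally have "s * (norm (f w) * norm (g w)) \<le> s * (s * (norm (f w))\<^sup>2 + (norm (g w))\<^sup>2 / s)" .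
    then show "norm (f w *\<^sub>R g w) \<le> s * (norm (f w))\<^sup>2 + (norm (g w))\<^sup>2 / s"
      using assms(3) by (simp add: mult_le_cancel_left_pos)
  qed
  then show ?thesis using assms by (simp add: sq_int_def msq_def)
qed

section \<open>Independent samples and coins\<close>

text \<open>Freezing of an independent variable: the joint law is a product and Fubini integrates Y
  out. This stands in for conditional expectations.\<close>

lemma (in prob_space) integral_indep_pair:
  fixes \<phi> :: "'b \<times> 'c \<Rightarrow> 'd::{banach, second_countable_topology}"
  assumes X [measurable]: "X \<in> measurable M N" and Y [measurable]: "Y \<in> measurable M N'"
    and ind: "\<And>A B. A \<in> sets N \<Longrightarrow> B \<in> sets N' \<Longrightarrow>
      prob ((X -` A \<inter> space M) \<inter> (Y -` B \<inter> space M)) = prob (X -` A \<inter> space M) * prob (Y -` B \<inter> space M)"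
    and \<phi>: "\<phi> \<in> borel_measurable (N \<Otimes>\<^sub>M N')"
    and int: "integrable M (\<lambda>w. \<phi> (X w, Y w))"
  shows "expectation (\<lambda>w. \<phi> (X w, Y w)) = expectation (\<lambda>w. \<integral>y. \<phi> (X w, y) \<partial>distr M N' Y)"
proof -
  interpret X: prob_space "distr M N X" by (rule prob_space_distr) measurable
  interpret Y: prob_space "distr M N' Y" by (rule prob_space_distr) measurable
  interpret pair_sigma_finite "distr M N X" "distr M N' Y" ..
  have eq: "distr M N X \<Otimes>\<^sub>M distr M N' Y = distr M (N \<Otimes>\<^sub>M N') (\<lambda>w. (X w, Y w))"
  proof (rule pair_measure_eqI)
    fix A B assume "A \<in> sets (distr M N X)" "B \<in> sets (distr M N' Y)"
    then have AB [measurable]: "A \<in> sets N" "B \<in> sets N'" by simp_all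
    have "(\<lambda>w. (X w, Y w)) -` (A \<times> B) \<inter> space M = (X -` A \<inter> space M) \<inter> (Y -` B \<inter> space M)" by auto
    then show "emeasure (distr M N X) A * emeasure (distr M N' Y) B =
        emeasure (distr M (N \<Otimes>\<^sub>M N') (\<lambda>w. (X w, Y w))) (A \<times> B)"
      using ind[OF AB] by (simp add: emeasure_distr emeasure_eq_measure ennreal_mult'')
  qed (auto simp: X.sigma_finite_measure_axioms Y.sigma_finite_measure_axioms)
  note [measurable] = \<phi>
  have int': "integrable (distr M N X \<Otimes>\<^sub>M distr M N' Y) \<phi>"
    unfolding eq using int by (subst integrable_distr_eq) auto
  have "expectation (\<lambda>w. \<phi> (X w, Y w)) = integral\<^sup>L (distr M N X \<Otimes>\<^sub>M distr M N' Y) \<phi>"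
    unfolding eq by (subst integral_distr) auto
  also have "\<dots> = (\<integral>x. (\<integral>y. \<phi> (x, y) \<partial>distr M N' Y) \<partial>distr M N X)"
    using integral_fst'[OF int'] by simp
  also have "\<dots> = expectation (\<lambda>w. \<integral>y. \<phi> (X w, y) \<partial>distr M N' Y)"
  proof (subst integral_distr)
    have "(\<lambda>x. \<integral>y. \<phi> (x, y) \<partial>distr M N' Y) \<in> borel_measurable (distr M N X)"
      using integrable_fst'[OF int'] by (rule borel_measurable_integrable)
    then show "(\<lambda>x. \<integral>y. \<phi> (x, y) \<partial>distr M N' Y) \<in> borel_measurable N" by simp
  qed auto
  finally show ?thesis .
qed

locale samples_and_coins = prob_space M for M :: "'a measure" +
  fixes D :: "'z measure" and \<zeta> :: "nat \<Rightarrow> 'a \<Rightarrow> 'z" and \<omega> :: "nat \<Rightarrow> 'a \<Rightarrow> bool" and p :: "nat \<Rightarrow> real"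
  assumes p01: "\<And>n. n \<ge> 1 \<Longrightarrow> 0 \<le> p n \<and> p n \<le> 1"
    and \<zeta>_meas: "\<And>n. n \<ge> 1 \<Longrightarrow> \<zeta> n \<in> measurable M D"
    and \<zeta>_distr: "\<And>n. n \<ge> 1 \<Longrightarrow> distr M D (\<zeta> n) = D"
    and \<omega>_meas: "\<And>n. n \<ge> 1 \<Longrightarrow> \<omega> n \<in> measurable M (count_space UNIV)"
    and \<omega>_distr: "\<And>n. n \<ge> 1 \<Longrightarrow> distr M (count_space UNIV) (\<omega> n) = measure_pmf (bernoulli_pmf (p n))"
    and indep: "indep_sets (joint_events M D \<zeta> \<omega>) ({1..} <+> {1..})"
begin

section \<open>Histories of samples and coins as generated sigma-algebras\<close>

definition hist :: "(nat + nat) set \<Rightarrow> 'a measure" where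
  "hist J = sigma (space M) (\<Union>j\<in>J. joint_events M D \<zeta> \<omega> j)"

text \<open>\<open>past n\<close> is the sigma-algebra before step \<open>n\<close>; \<open>past_half n\<close> also knows the sample of
  step \<open>n\<close>, but not its coin.\<close>

definition past :: "nat \<Rightarrow> 'a measure" where
  "past n = hist ({1..<n} <+> {1..<n})"

definition past_half :: "nat \<Rightarrow> 'a measure" where
  "past_half n = hist ({1..<Suc n} <+> {1..<n})"

lemma joint_events_Pow: "joint_events M D \<zeta> \<omega> j \<subseteq> Pow (space M)"
  by (cases j) (auto simp: joint_events_def)

lemma space_hist [simp]: "space (hist J) = space M"
  unfolding hist_def by (rule space_measure_of) (use joint_events_Pow in blast)

lemma space_past [simp]: "space (past n) = space M" "space (past_half n) = space M"
  by (simp_all add: past_def past_half_def)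

lemma sets_hist: "sets (hist J) = sigma_sets (space M) (\<Union>j\<in>J. joint_events M D \<zeta> \<omega> j)"
  unfolding hist_def by (rule sets_measure_of) (use joint_events_Pow in blast)

lemma measurable_hist_mono: "J \<subseteq> J' \<Longrightarrow> f \<in> measurable (hist J) N \<Longrightarrow> f \<in> measurable (hist J') N"
  by (rule measurable_from_subalg[of _ "hist J"]) (auto simp: subalgebra_def sets_hist intro!: sigma_sets_mono')

lemma measurable_hist: "J \<subseteq> {1..} <+> {1..} \<Longrightarrow> f \<in> measurable (hist J) N \<Longrightarrow> f \<in> measurable M N"
proof (rule measurable_from_subalg[of _ "hist J"])
  assume J: "J \<subseteq> {1..} <+> {1..}"
  have "(\<Union>j\<in>J. joint_events M D \<zeta> \<omega> j) \<subseteq> sets M"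
    using indep J by (auto simp: indep_sets_def)
  then show "subalgebra M (hist J)"
    by (simp add: subalgebra_def sets_hist sets.sigma_sets_subset)
qed

lemma measurable_past: "f \<in> measurable (past n) N \<Longrightarrow> f \<in> measurable M N"
  unfolding past_def by (rule measurable_hist[rotated]) auto

lemma measurable_past_half: "f \<in> measurable (past_half n) N \<Longrightarrow> f \<in> measurable M N"
  unfolding past_half_def by (rule measurable_hist[rotated]) auto

lemma past_imp_half: "f \<in> measurable (past n) N \<Longrightarrow> f \<in> measurable (past_half n) N"
  unfolding past_def past_half_def by (rule measurable_hist_mono[rotated]) auto

lemma half_imp_past_Suc: "f \<in> measurable (past_half n) N \<Longrightarrow> f \<in> measurable (past (Suc n)) N"
  unfolding past_def past_half_def by (rule measurable_hist_mono[rotated]) auto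

lemma past_imp_Suc: "f \<in> measurable (past n) N \<Longrightarrow> f \<in> measurable (past (Suc n)) N"
  by (intro half_imp_past_Suc past_imp_half)

lemma \<zeta>_past_half: "n \<ge> 1 \<Longrightarrow> \<zeta> n \<in> measurable (past_half n) D"
proof (rule measurableI)
  fix B assume n: "n \<ge> 1" and B: "B \<in> sets D"
  have "\<zeta> n -` B \<inter> space M \<in> joint_events M D \<zeta> \<omega> (Inl n)" using B by (auto simp: joint_events_def)
  then show "\<zeta> n -` B \<inter> space (past_half n) \<in> sets (past_half n)"
    unfolding space_past past_half_def sets_hist using n by (intro sigma_sets.Basic UN_I[of "Inl n"]) auto
qed (use \<zeta>_meas in \<open>auto dest: measurable_space\<close>)

lemma \<omega>_past_Suc: "n \<ge> 1 \<Longrightarrow> \<omega> n \<in> measurable (past (Suc n)) (count_space UNIV)"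
proof (rule measurableI)
  fix C :: "bool set" assume n: "n \<ge> 1"
  have "\<omega> n -` C \<inter> space M \<in> joint_events M D \<zeta> \<omega> (Inr n)" by (auto simp: joint_events_def)
  then show "\<omega> n -` C \<inter> space (past (Suc n)) \<in> sets (past (Suc n))"
    unfolding space_past past_def sets_hist using n by (intro sigma_sets.Basic UN_I[of "Inr n"]) auto
qed auto

lemma Int_stable_joint_events: "Int_stable (joint_events M D \<zeta> \<omega> j)"
proof (cases j)
  case (Inl n)
  show ?thesis unfolding Int_stable_def
  proof (intro ballI)
    fix a b assume "a \<in> joint_events M D \<zeta> \<omega> j" "b \<in> joint_events M D \<zeta> \<omega> j"
    then obtain A B where "a = \<zeta> n -` A \<inter> space M" "b = \<zeta> n -` B \<inter> space M" "A \<in> sets D" "B \<in> sets D"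
      by (auto simp: joint_events_def Inl)
    then show "a \<inter> b \<in> joint_events M D \<zeta> \<omega> j"
      by (auto simp: joint_events_def Inl intro!: exI[of _ "A \<inter> B"])
  qed
next
  case (Inr n)
  show ?thesis unfolding Int_stable_def
  proof (intro ballI)
    fix a b assume "a \<in> joint_events M D \<zeta> \<omega> j" "b \<in> joint_events M D \<zeta> \<omega> j"
    then obtain A B where "a = \<omega> n -` A \<inter> space M" "b = \<omega> n -` B \<inter> space M"
      by (auto simp: joint_events_def Inr)
    then show "a \<inter> b \<in> joint_events M D \<zeta> \<omega> j"
      by (auto simp: joint_events_def Inr intro!: exI[of _ "A \<inter> B"])
  qed
qed

text \<open>Grouping of independent families: the index set is split into the two blocks J and {i},
  and stability under intersection carries independence from the generators to the generated
  sigma-algebras.\<close>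

lemma indep_set_hist:
  assumes J: "J \<subseteq> {1..} <+> {1..}" and i: "i \<in> {1..} <+> {1..}" "i \<notin> J"
  shows "indep_set (sets (hist J)) (sigma_sets (space M) (joint_events M D \<zeta> \<omega> i))"
proof -
  have "indep_sets (\<lambda>j. sigma_sets (space M) (\<Union>i\<in>(case j of True \<Rightarrow> J | False \<Rightarrow> {i}). joint_events M D \<zeta> \<omega> i)) UNIV"
  proof (rule indep_sets_collect_sigma)
    show "indep_sets (joint_events M D \<zeta> \<omega>) (\<Union>j\<in>UNIV. case j of True \<Rightarrow> J | False \<Rightarrow> {i})"
      by (rule indep_sets_mono_index[OF _ indep]) (use J i in \<open>auto split: bool.splits\<close>)
    show "disjoint_family_on (case_bool J {i}) UNIV"
      using i by (auto simp: disjoint_family_on_def split: bool.splits)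
  qed (rule Int_stable_joint_events)
  then show ?thesis
    unfolding indep_set_def sets_hist
    by (rule indep_sets_mono_sets) (auto split: bool.splits)
qed

lemma integral_indep_hist:
  fixes \<phi> :: "'b \<times> 'c \<Rightarrow> 'd::{banach, second_countable_topology}"
  assumes J: "J \<subseteq> {1..} <+> {1..}" and i: "i \<in> {1..} <+> {1..}" "i \<notin> J"
    and X: "X \<in> measurable (hist J) N"
    and Y: "Y \<in> measurable M N'" "\<And>A. A \<in> sets N' \<Longrightarrow> Y -` A \<inter> space M \<in> joint_events M D \<zeta> \<omega> i"
    and \<phi>: "\<phi> \<in> borel_measurable (N \<Otimes>\<^sub>M N')" and int: "integrable M (\<lambda>w. \<phi> (X w, Y w))"
  shows "expectation (\<lambda>w. \<phi> (X w, Y w)) = expectation (\<lambda>w. \<integral>y. \<phi> (X w, y) \<partial>distr M N' Y)"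
proof (rule integral_indep_pair[OF measurable_hist[OF J X] Y(1) _ \<phi> int])
  fix A B assume A: "A \<in> sets N" and B: "B \<in> sets N'"
  have "X -` A \<inter> space M \<in> sets (hist J)" using measurable_sets[OF X A] by simp
  then show "prob ((X -` A \<inter> space M) \<inter> (Y -` B \<inter> space M)) = prob (X -` A \<inter> space M) * prob (Y -` B \<inter> space M)"
    by (rule indep_setD[OF indep_set_hist[OF J i]]) (use Y(2)[OF B] in auto)
qed

text \<open>A projection resets everything orthogonal to the constraint space to 0, whence the form
  of the integrand. The coin of step n is independent of \<open>past_half n\<close>, so it only
  contributes the probability of no projection.\<close>

lemma expectation_coin:
  fixes f :: "'a \<Rightarrow> 'c::euclidean_space"
  assumes n: "n \<ge> 1" and f: "f \<in> borel_measurable (past_half n)" "integrable M f"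
  shows "integrable M (\<lambda>w. if \<omega> n w then 0 else f w)"
    "expectation (\<lambda>w. if \<omega> n w then 0 else f w) = (1 - p n) *\<^sub>R expectation f"
proof -
  have [measurable]: "\<omega> n \<in> measurable M (count_space UNIV)" by (rule \<omega>_meas[OF n])
  show int: "integrable M (\<lambda>w. if \<omega> n w then 0 else f w)"
    by (rule Bochner_Integration.integrable_bound[OF f(2)]) (use f(2) in auto)
  have "expectation (\<lambda>w. if \<omega> n w then 0 else f w) =
      expectation (\<lambda>w. (\<lambda>(y, c). if c then 0 else y) (f w, \<omega> n w))" by simp
  also have "\<dots> = expectation (\<lambda>w. \<integral>c. (\<lambda>(y, c). if c then 0 else y) (f w, c) \<partial>distr M (count_space UNIV) (\<omega> n))"
    by (rule integral_indep_hist[of "{1..<Suc n} <+> {1..<n}" "Inr n"])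
       (use n f(1) int \<omega>_meas[OF n] in \<open>auto simp: joint_events_def past_half_def\<close>)
  also have "\<dots> = expectation (\<lambda>w. (1 - p n) *\<^sub>R f w)"
  proof (intro Bochner_Integration.integral_cong refl)
    fix w
    have "(\<integral>c. (if c then 0 else f w) \<partial>measure_pmf (bernoulli_pmf (p n))) = (1 - p n) *\<^sub>R f w"
      using p01[OF n] by (subst integral_measure_pmf[of UNIV]) (auto simp: UNIV_bool)
    then show "(\<integral>c. (\<lambda>(y, c). if c then 0 else y) (f w, c) \<partial>distr M (count_space UNIV) (\<omega> n)) = (1 - p n) *\<^sub>R f w"
      unfolding \<omega>_distr[OF n] by simp
  qed
  also have "\<dots> = (1 - p n) *\<^sub>R expectation f" by simp
  finally show "expectation (\<lambda>w. if \<omega> n w then 0 else f w) = (1 - p n) *\<^sub>R expectation f" .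
qed

lemma sq_int_coin:
  fixes f :: "'a \<Rightarrow> 'c::euclidean_space"
  assumes n: "n \<ge> 1" and f: "sq_int M f"
  shows "sq_int M (\<lambda>w. if \<omega> n w then 0 else f w)"
proof (rule sq_int_bound[OF f, of _ 1])
  have [measurable]: "\<omega> n \<in> measurable M (count_space UNIV)" by (rule \<omega>_meas[OF n])
  show "(\<lambda>w. if \<omega> n w then 0 else f w) \<in> borel_measurable M" using f by measurable
qed auto

lemma msq_coin:
  fixes f :: "'a \<Rightarrow> 'c::euclidean_space"
  assumes n: "n \<ge> 1" and f: "f \<in> borel_measurable (past_half n)" "sq_int M f"
  shows "msq M (\<lambda>w. if \<omega> n w then 0 else f w) = (1 - p n) * msq M f"
proof -
  have "msq M (\<lambda>w. if \<omega> n w then 0 else f w) = expectation (\<lambda>w. if \<omega> n w then 0 else (norm (f w))\<^sup>2)"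
    unfolding msq_def by (intro Bochner_Integration.integral_cong) auto
  also have "\<dots> = (1 - p n) *\<^sub>R expectation (\<lambda>w. (norm (f w))\<^sup>2)"
    using f by (intro expectation_coin[OF n]) (auto simp: sq_int_def)
  finally show ?thesis by (simp add: msq_def)
qed

lemma expectation_sample:
  fixes \<phi> :: "'b \<times> 'z \<Rightarrow> 'c::{banach, second_countable_topology}"
  assumes n: "n \<ge> 1" and X: "X \<in> measurable (past n) N" and \<phi>: "\<phi> \<in> borel_measurable (N \<Otimes>\<^sub>M D)"
    and int: "integrable M (\<lambda>w. \<phi> (X w, \<zeta> n w))"
  shows "expectation (\<lambda>w. \<phi> (X w, \<zeta> n w)) = expectation (\<lambda>w. \<integral>z. \<phi> (X w, z) \<partial>D)"
proof -
  have "expectation (\<lambda>w. \<phi> (X w, \<zeta> n w)) = expectation (\<lambda>w. \<integral>z. \<phi> (X w, z) \<partial>distr M D (\<zeta> n))"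
    by (rule integral_indep_hist[of "{1..<n} <+> {1..<n}" "Inl n"])
       (use n X \<phi> int \<zeta>_meas[OF n] in \<open>auto simp: joint_events_def past_def\<close>)
  then show ?thesis unfolding \<zeta>_distr[OF n] .
qed

end

section \<open>The iterates\<close>

text \<open>The strict gap between \<mu> and the coercivity constant in \<open>S_coercive\<close>
  absorbs the terms of order \<eta>^2, so that the clean contraction factor 1 - \<mu> * \<eta> holds
  from some index on. \<open>crit\<close> is the condition on the initial step size expressed by
  \<mu>.\<close>

locale lpsa = samples_and_coins M D \<zeta> \<omega> p + poly_steps \<eta> eta0 \<alpha>
  for M :: "'a measure" and D :: "'z measure" and \<zeta> \<omega> p \<eta> eta0 \<alpha> +
  fixes S P :: "real^'d^'d" and b xstar x1 :: "real^'d" and k :: nat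
    and \<mu> \<gamma> \<beta> q :: real and g :: "real^'d \<Rightarrow> 'z \<Rightarrow> real^'d" and x :: "nat \<Rightarrow> 'a \<Rightarrow> real^'d"
  assumes S_sym: "transpose S = S"
    and \<mu>: "0 < \<mu>" and S_coercive: "\<exists>\<mu>'>\<mu>. \<forall>z. \<mu>' * (z \<bullet> z) \<le> z \<bullet> (S *v z)"
    and P_sym: "transpose P = P" and P_idem: "P ** P = P" and P_xstar: "P *v xstar = xstar"
    and k: "k \<ge> 1" and deg: "\<And>i. i < k \<Longrightarrow> P *v (matpow S i *v (S *v xstar - b)) = 0"
    and crit: "\<alpha> = 1 \<Longrightarrow> 2 * real k < \<mu> * eta0"
    and \<gamma>: "0 < \<gamma>" and \<beta>: "0 < \<beta>" "\<beta> < 1" and q: "2 < q"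
    and p: "\<And>n. n \<ge> 1 \<Longrightarrow> p n = min (\<gamma> * \<eta> n powr \<beta>) 1"
    and g_meas: "(\<lambda>(y, z). g y z) \<in> borel_measurable (borel \<Otimes>\<^sub>M D)"
    and g_unbiased: "\<And>y. has_bochner_integral D (g y) (S *v y - b)"
    and x_1: "\<And>w. w \<in> space M \<Longrightarrow> x 1 w = x1"
    and x_Suc: "\<And>n w. n \<ge> 1 \<Longrightarrow> w \<in> space M \<Longrightarrow> x (Suc n) w =
      (if \<omega> n w then P *v (x n w - \<eta> n *\<^sub>R g (x n w) (\<zeta> n w)) else x n w - \<eta> n *\<^sub>R g (x n w) (\<zeta> n w))"
    and noise_moment: "\<exists>C. \<forall>n\<ge>1. (\<integral>\<^sup>+w. ennreal (norm ((S *v x n w - b) - g (x n w) (\<zeta> n w)) powr q) \<partial>M) \<le> ennreal C"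
begin

text \<open>Third moments are all that the Taylor expansion of characteristic functions can use.\<close>

definition r :: real where "r = min q 3"

definition h :: "real^'d \<Rightarrow> 'z \<Rightarrow> real^'d" where "h y z = (S *v y - b) - g y z"
definition noise :: "nat \<Rightarrow> 'a \<Rightarrow> real^'d" where "noise n w = h (x n w) (\<zeta> n w)"
definition Q :: "real^'d^'d" where "Q = mat 1 - P"
definition L :: "nat \<Rightarrow> real^'d \<Rightarrow> real^'d" where "L n z = z - \<eta> n *\<^sub>R (P *v (S *v z))"

definition kry :: "nat \<Rightarrow> real^'d" where "kry i = matpow S i *v (S *v xstar - b)"
definition w0 :: "real^'d" where "w0 = P *v kry k"
definition err :: "nat \<Rightarrow> 'a \<Rightarrow> real^'d" where "err n w = P *v x n w - xstar"

text \<open>Between two projections the component of \<open>x n\<close> outside the constraint space moves along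
  \<open>kry 0, kry 1, \<dots>\<close>; \<open>coef n w i\<close> is the scalar (depending on the coins only) in front of
  \<open>kry (i - 1)\<close>, and \<open>res\<close> is what remains of that component.\<close>

primrec coef :: "nat \<Rightarrow> 'a \<Rightarrow> nat \<Rightarrow> real" where
  "coef 0 w i = of_bool (i = 0)"
| "coef (Suc n) w i = (if n = 0 \<or> i = 0 then of_bool (i = 0)
     else if \<omega> n w then 0 else coef n w i - \<eta> n * coef n w (i - 1))"

text \<open>The recursion of \<open>coef\<close> with the coin integrated out, hence its mean. The
  guard at n = 0 makes 1 the initial index, as for the iterates; there the component along every
  \<open>kry i\<close> is still counted as part of \<open>res\<close>.\<close>

primrec mcoef :: "nat \<Rightarrow> nat \<Rightarrow> real" where
  "mcoef 0 i = of_bool (i = 0)"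
| "mcoef (Suc n) i = (if n = 0 \<or> i = 0 then of_bool (i = 0)
     else (1 - p n) * (mcoef n i - \<eta> n * mcoef n (i - 1)))"

definition res :: "nat \<Rightarrow> 'a \<Rightarrow> real^'d" where
  "res n w = Q *v x n w - (\<Sum>i<k. coef n w (Suc i) *\<^sub>R kry i)"

text \<open>\<open>mart\<close>, \<open>fluct\<close> and \<open>drift\<close> split the linear
  recursion of \<open>err\<close> by its inputs: noise, coefficient minus mean, mean of the
  coefficient. All start from 0 at index 1, so the initial error and the influence of
  \<open>res\<close> are left to \<open>rest\<close>.\<close>

primrec mart :: "nat \<Rightarrow> 'a \<Rightarrow> real^'d" where
  "mart 0 w = 0"
| "mart (Suc n) w = (if n = 0 then 0 else L n (mart n w) + \<eta> n *\<^sub>R (P *v noise n w))"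

primrec fluct :: "nat \<Rightarrow> 'a \<Rightarrow> real^'d" where
  "fluct 0 w = 0"
| "fluct (Suc n) w = (if n = 0 then 0 else L n (fluct n w) - (\<eta> n * (coef n w k - mcoef n k)) *\<^sub>R w0)"

primrec drift :: "nat \<Rightarrow> real^'d" where
  "drift 0 = 0"
| "drift (Suc n) = (if n = 0 then 0 else L n (drift n) - (\<eta> n * mcoef n k) *\<^sub>R w0)"

definition rest :: "nat \<Rightarrow> 'a \<Rightarrow> real^'d" where
  "rest n w = err n w - mart n w - fluct n w - drift n"

section \<open>Exact one-step identities\<close>

lemma r: "2 < r" "r \<le> 3"
  using q by (auto simp: r_def)

lemma Q_vec: "Q *v z = z - P *v z"
  by (simp add: Q_def matrix_vector_mult_diff_rdistrib)

lemma PP: "P *v (P *v z) = P *v z"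
  by (simp add: matrix_vector_mul_assoc P_idem)

lemmas lin_simps = matrix_vector_right_distrib matrix_vector_mult_diff_distrib matrix_vector_mult_scaleR

lemma L_add: "L n (y + z) = L n y + L n z" and L_diff: "L n (y - z) = L n y - L n z"
  and L_scaleR: "L n (c *\<^sub>R z) = c *\<^sub>R L n z" and L_0: "L n 0 = 0"
  by (simp_all add: L_def lin_simps algebra_simps)

lemma P_L: "P *v z = z \<Longrightarrow> P *v L n z = L n z"
  by (simp add: L_def lin_simps PP)

lemma inner_P: "(P *v y) \<bullet> z = y \<bullet> (P *v z)"
  using symmetric_inner[OF P_sym, of z y] by (simp add: inner_commute)

text \<open>On the range of P the operator is self-adjoint. This moves it from \<open>mart\<close>
  to the argument of the characteristic function.\<close>

lemma inner_L:
  assumes "P *v y = y" "P *v z = z"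
  shows "y \<bullet> L n z = L n y \<bullet> z"
proof -
  have "y \<bullet> (P *v (S *v z)) = (P *v (S *v y)) \<bullet> z"
    using assms by (metis inner_P inner_commute symmetric_inner[OF S_sym])
  then show ?thesis by (simp add: L_def inner_diff_left inner_diff_right)
qed

lemma norm_P_le: "norm (P *v z) \<le> norm z"
proof -
  have "(norm (P *v z))\<^sup>2 = (P *v z) \<bullet> z"
    by (simp add: power2_norm_eq_inner inner_P PP)
  also have "\<dots> \<le> norm (P *v z) * norm z" by (rule norm_cauchy_schwarz)
  finally show ?thesis
    by (cases "P *v z = 0") (auto simp: power2_eq_square)
qed

lemma kry_Suc: "S *v kry i = kry (Suc i)"
  by (simp add: kry_def matrix_vector_mul_assoc)

lemma P_kry: "i < k \<Longrightarrow> P *v kry i = 0"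
  using deg by (simp add: kry_def)

lemma Q_kry: "i < k \<Longrightarrow> Q *v kry i = kry i"
  by (simp add: Q_vec P_kry)

lemma P_w0: "P *v w0 = w0"
  by (simp add: w0_def PP)

lemma grad_split: "S *v y - b = kry 0 + S *v (y - xstar)"
  by (simp add: kry_def lin_simps)

lemma coef_0 [simp]: "coef n w 0 = 1" and mcoef_0 [simp]: "mcoef n 0 = 1"
  by (cases n; simp)+

lemma coef_Suc: "n \<ge> 1 \<Longrightarrow> coef (Suc n) w (Suc i) =
    (if \<omega> n w then 0 else coef n w (Suc i) - \<eta> n * coef n w i)"
  and mcoef_Suc: "n \<ge> 1 \<Longrightarrow> mcoef (Suc n) (Suc i) = (1 - p n) * (mcoef n (Suc i) - \<eta> n * mcoef n i)"
  by simp_all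

lemma P_err: "P *v err n w = err n w"
  by (simp add: err_def lin_simps PP P_xstar)

lemma P_mart: "P *v mart n w = mart n w"
  by (induction n) (auto simp: lin_simps PP P_L)

lemma P_fluct: "P *v fluct n w = fluct n w"
  by (induction n) (auto simp: lin_simps P_w0 P_L)

lemma P_drift: "P *v drift n = drift n"
  by (induction n) (auto simp: lin_simps P_w0 P_L)

lemma P_rest: "P *v rest n w = rest n w"
  by (simp add: rest_def lin_simps P_err P_mart P_fluct P_drift)

lemma x_split: "x n w - xstar = err n w + (\<Sum>i<k. coef n w (Suc i) *\<^sub>R kry i) + res n w"
  by (simp add: err_def res_def Q_vec)

lemma S_sum_kry: "S *v (\<Sum>i<k. coef n w (Suc i) *\<^sub>R kry i) = (\<Sum>i<k. coef n w (Suc i) *\<^sub>R kry (Suc i))"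
  by (simp add: linear_sum[OF matrix_vector_mul_linear] lin_simps kry_Suc)

lemma P_S_sum_kry: "P *v (S *v (\<Sum>i<k. coef n w (Suc i) *\<^sub>R kry i)) = coef n w k *\<^sub>R w0"
proof -
  obtain j where j: "k = Suc j" using k by (cases k) auto
  have "(\<Sum>i<k. coef n w (Suc i) *\<^sub>R (P *v kry (Suc i))) = coef n w k *\<^sub>R (P *v kry k)"
    using P_kry by (simp add: j)
  then show ?thesis
    unfolding S_sum_kry by (simp add: linear_sum[OF matrix_vector_mul_linear] lin_simps w0_def)
qed

lemma half_step: "x n w - \<eta> n *\<^sub>R g (x n w) (\<zeta> n w) = x n w - \<eta> n *\<^sub>R (S *v x n w - b) + \<eta> n *\<^sub>R noise n w"
  by (simp add: noise_def h_def algebra_simps)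

text \<open>Both outcomes of the coin have the same image under P, so the error does not see the
  coin directly. The constant part \<open>kry 0\<close> of the gradient is killed by P because k is
  at least 1.\<close>

lemma err_Suc:
  assumes n: "n \<ge> 1" and w: "w \<in> space M"
  shows "err (Suc n) w = L n (err n w) - \<eta> n *\<^sub>R (coef n w k *\<^sub>R w0 + P *v (S *v res n w)) + \<eta> n *\<^sub>R (P *v noise n w)"
proof -
  have "err (Suc n) w = P *v (x n w - \<eta> n *\<^sub>R (S *v x n w - b) + \<eta> n *\<^sub>R noise n w) - xstar"
    unfolding err_def x_Suc[OF n w] half_step by (simp add: PP)
  also have "\<dots> = err n w - \<eta> n *\<^sub>R (P *v (S *v x n w - b)) + \<eta> n *\<^sub>R (P *v noise n w)"
    by (simp add: err_def lin_simps)
  also have "P *v (S *v x n w - b) = P *v (S *v err n w) + coef n w k *\<^sub>R w0 + P *v (S *v res n w)"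
    unfolding grad_split x_split using P_kry[of 0] k
    by (simp add: matrix_vector_right_distrib P_S_sum_kry)
  finally show ?thesis by (simp add: L_def algebra_simps)
qed

text \<open>The recursion of the coefficients is designed to swallow the gradient at
  \<open>xstar\<close> and the shift of the \<open>kry i\<close> by S. Only the top term, where the
  shift leaves the range i < k, remains as an input.\<close>

lemma res_Suc:
  assumes n: "n \<ge> 1" and w: "w \<in> space M"
  shows "res (Suc n) w = (if \<omega> n w then 0 else
    res n w - \<eta> n *\<^sub>R (Q *v (S *v res n w) + Q *v (S *v err n w) + coef n w k *\<^sub>R (Q *v kry k))
      + \<eta> n *\<^sub>R (Q *v noise n w))"
proof (cases "\<omega> n w")
  case True
  have "Q *v (P *v z) = 0" for z by (simp add: Q_vec PP)
  then show ?thesis using True n by (simp add: res_def x_Suc[OF n w])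
next
  case False
  obtain j where j: "k = Suc j" using k by (cases k) auto
  let ?a = "coef n w"
  have QS: "Q *v (S *v (\<Sum>i<k. ?a (Suc i) *\<^sub>R kry i)) = (\<Sum>i<j. ?a (Suc i) *\<^sub>R kry (Suc i)) + ?a k *\<^sub>R (Q *v kry k)"
    unfolding S_sum_kry by (simp add: linear_sum[OF matrix_vector_mul_linear] lin_simps j Q_kry)
  have c: "(\<Sum>i<k. coef (Suc n) w (Suc i) *\<^sub>R kry i) =
      (\<Sum>i<k. ?a (Suc i) *\<^sub>R kry i) - \<eta> n *\<^sub>R (kry 0 + (\<Sum>i<j. ?a (Suc i) *\<^sub>R kry (Suc i)))"
  proof -
    have "(\<Sum>i<k. coef (Suc n) w (Suc i) *\<^sub>R kry i) = (\<Sum>i<k. ?a (Suc i) *\<^sub>R kry i) - \<eta> n *\<^sub>R (\<Sum>i<k. ?a i *\<^sub>R kry i)"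
      using n False by (simp add: scaleR_diff_left sum_subtractf scaleR_sum_right)
    \<comment> \<open>The shifted sum has the zeroth coefficient in front, which is 1 by convention
      and stands for the constant part of the gradient.\<close>
    also have "(\<Sum>i<k. ?a i *\<^sub>R kry i) = kry 0 + (\<Sum>i<j. ?a (Suc i) *\<^sub>R kry (Suc i))"
      unfolding j by (subst sum.lessThan_Suc_shift) simp
    finally show ?thesis .
  qed
  have "Q *v x (Suc n) w = Q *v x n w - \<eta> n *\<^sub>R (Q *v (S *v x n w - b)) + \<eta> n *\<^sub>R (Q *v noise n w)"
    unfolding x_Suc[OF n w] half_step using False by (simp add: lin_simps)
  also have "Q *v (S *v x n w - b) = kry 0 + Q *v (S *v err n w) +
      ((\<Sum>i<j. ?a (Suc i) *\<^sub>R kry (Suc i)) + ?a k *\<^sub>R (Q *v kry k)) + Q *v (S *v res n w)"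
    unfolding grad_split x_split using Q_kry[of 0] k QS
    by (simp add: matrix_vector_right_distrib)
  finally show ?thesis
    using False unfolding res_def c by (simp add: algebra_simps)
qed

lemma rest_Suc:
  assumes n: "n \<ge> 1" and w: "w \<in> space M"
  shows "rest (Suc n) w = L n (rest n w) - \<eta> n *\<^sub>R (P *v (S *v res n w))"
  using n by (simp add: rest_def err_Suc[OF n w] L_diff L_add algebra_simps)

subsection \<open>Measurability and integrability\<close>

lemma g_meas' [measurable]: "(\<lambda>yz. g (fst yz) (snd yz)) \<in> borel_measurable (borel \<Otimes>\<^sub>M D)"
  using g_meas by (simp add: case_prod_beta')

lemma h_meas [measurable]: "(\<lambda>yz. h (fst yz) (snd yz)) \<in> borel_measurable (borel \<Otimes>\<^sub>M D)"
  unfolding h_def by measurable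

lemma x_past: "n \<ge> 1 \<Longrightarrow> x n \<in> borel_measurable (past n)"
proof (induction n rule: nat_induct_at_least)
  case base
  have "x 1 \<in> borel_measurable (past 1) \<longleftrightarrow> (\<lambda>w. x1) \<in> borel_measurable (past 1)"
    by (rule measurable_cong) (simp only: space_past x_1)
  then show ?case by simp
next
  case (Suc n)
  have [measurable]: "x n \<in> borel_measurable (past (Suc n))" "\<zeta> n \<in> measurable (past (Suc n)) D"
    "\<omega> n \<in> measurable (past (Suc n)) (count_space UNIV)"
    by (rule past_imp_Suc[OF Suc.IH], rule half_imp_past_Suc[OF \<zeta>_past_half[OF Suc.hyps]], rule \<omega>_past_Suc[OF Suc.hyps])
  have [measurable]: "(\<lambda>w. g (x n w) (\<zeta> n w)) \<in> borel_measurable (past (Suc n))"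
    using measurable_compose[OF measurable_Pair g_meas', of "x n" "past (Suc n)" "\<zeta> n"] by simp
  have "x (Suc n) \<in> borel_measurable (past (Suc n)) \<longleftrightarrow>
     (\<lambda>w. if \<omega> n w then P *v (x n w - \<eta> n *\<^sub>R g (x n w) (\<zeta> n w)) else x n w - \<eta> n *\<^sub>R g (x n w) (\<zeta> n w))
       \<in> borel_measurable (past (Suc n))"
    using Suc by (intro measurable_cong) (simp only: space_past x_Suc)
  also have "\<dots>" by measurable
  finally show ?case .
qed

lemma noise_half: "n \<ge> 1 \<Longrightarrow> noise n \<in> borel_measurable (past_half n)"
  using measurable_compose[OF measurable_Pair h_meas, of "x n" "past_half n" "\<zeta> n"]
    past_imp_half[OF x_past] \<zeta>_past_half
  by (simp add: noise_def[abs_def])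

lemma coef_past: "n \<ge> 1 \<Longrightarrow> (\<lambda>w. coef n w i) \<in> borel_measurable (past n)"
proof (induction n arbitrary: i rule: nat_induct_at_least)
  case base
  show ?case by simp
next
  case (Suc n)
  have [measurable]: "(\<lambda>w. coef n w i) \<in> borel_measurable (past (Suc n))"
    "\<omega> n \<in> measurable (past (Suc n)) (count_space UNIV)" for i
    by (rule past_imp_Suc[OF Suc.IH], rule \<omega>_past_Suc[OF Suc.hyps])
  show ?case by simp
qed

lemma mart_past: "n \<ge> 1 \<Longrightarrow> mart n \<in> borel_measurable (past n)"
proof (induction n rule: nat_induct_at_least)
  case (Suc n)
  have [measurable]: "mart n \<in> borel_measurable (past (Suc n))" "noise n \<in> borel_measurable (past (Suc n))"
    by (rule past_imp_Suc[OF Suc.IH], rule half_imp_past_Suc[OF noise_half[OF Suc.hyps]])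
  show ?case unfolding mart.simps L_def by measurable
qed simp

lemma fluct_past: "n \<ge> 1 \<Longrightarrow> fluct n \<in> borel_measurable (past n)"
proof (induction n rule: nat_induct_at_least)
  case (Suc n)
  have [measurable]: "fluct n \<in> borel_measurable (past (Suc n))" "(\<lambda>w. coef n w k) \<in> borel_measurable (past (Suc n))"
    by (rule past_imp_Suc[OF Suc.IH], rule past_imp_Suc[OF coef_past[OF Suc.hyps]])
  show ?case unfolding fluct.simps L_def by measurable
qed simp

text \<open>\<open>fluct (Suc n)\<close> involves \<open>coef n\<close> only, so it is already
  determined before step n. Hence the coin of step n is independent of it, which the recursion of
  the covariances exploits.\<close>

lemma fluct_past': "n \<ge> 1 \<Longrightarrow> fluct (Suc n) \<in> borel_measurable (past n)"
proof -
  assume "n \<ge> 1"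
  then have [measurable]: "fluct n \<in> borel_measurable (past n)" "(\<lambda>w. coef n w k) \<in> borel_measurable (past n)"
    by (auto intro: fluct_past coef_past)
  show ?thesis unfolding fluct.simps L_def by measurable
qed

lemma err_past: "n \<ge> 1 \<Longrightarrow> err n \<in> borel_measurable (past n)"
proof -
  assume "n \<ge> 1"
  then have [measurable]: "x n \<in> borel_measurable (past n)" by (rule x_past)
  show ?thesis unfolding err_def[abs_def] by measurable
qed

lemma res_past: "n \<ge> 1 \<Longrightarrow> res n \<in> borel_measurable (past n)"
proof -
  assume "n \<ge> 1"
  then have [measurable]: "x n \<in> borel_measurable (past n)" "(\<lambda>w. coef n w i) \<in> borel_measurable (past n)" for i
    by (auto intro: x_past coef_past)
  show ?thesis unfolding res_def[abs_def] by measurable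
qed

lemma powr_le_one_plus: "a powr i \<le> 1 + a powr j" if "0 \<le> a" "0 \<le> i" "i \<le> j" for a i j :: real
proof (cases "a \<le> 1")
  case True
  then have "a powr i \<le> 1" using that by (intro powr_le1) auto
  then show ?thesis using powr_ge_zero[of a j] by linarith
next
  case False
  then have "a powr i \<le> a powr j" using that by (intro powr_mono) auto
  then show ?thesis by simp
qed

lemma powr_r_le: "a\<^sup>2 \<le> 1 + a powr r" if "0 \<le> a" for a :: real
  using powr_le_one_plus[OF that, of 2 r] r that by (simp add: powr_numeral split: if_splits)

text \<open>Lower moments are controlled by higher ones through a^i \<le> 1 + a^j for i \<le> j,
  first from q to r and then from r to 2; one constant serves for both.\<close>

lemma noise_bounds:
  obtains C where "0 \<le> C" "\<And>n. n \<ge> 1 \<Longrightarrow> sq_int M (noise n)" "\<And>n. n \<ge> 1 \<Longrightarrow> msq M (noise n) \<le> C"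
    "\<And>n. n \<ge> 1 \<Longrightarrow> integrable M (\<lambda>w. norm (noise n w) powr r)"
    "\<And>n. n \<ge> 1 \<Longrightarrow> expectation (\<lambda>w. norm (noise n w) powr r) \<le> C"
proof -
  obtain C' where C': "\<And>n. n \<ge> 1 \<Longrightarrow> (\<integral>\<^sup>+w. ennreal (norm (noise n w) powr q) \<partial>M) \<le> ennreal C'"
    using noise_moment unfolding noise_def h_def by blast
  define C where "C = 1 + max C' 0"
  have C: "integrable M (\<lambda>w. norm (noise n w) powr r)" "expectation (\<lambda>w. norm (noise n w) powr r) \<le> C"
    if n: "n \<ge> 1" for n
  proof -
    have [measurable]: "noise n \<in> borel_measurable M" using measurable_past_half[OF noise_half[OF n]] .
    have "(\<integral>\<^sup>+w. ennreal (norm (noise n w) powr r) \<partial>M) \<le> (\<integral>\<^sup>+w. 1 + ennreal (norm (noise n w) powr q) \<partial>M)"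
      using powr_le_one_plus[of "norm (noise n w)" r q for w] r
      by (intro nn_integral_mono) (simp add: ennreal_plus[symmetric] ennreal_leI r_def del: ennreal_plus flip: ennreal_1)
    also have "\<dots> = 1 + (\<integral>\<^sup>+w. ennreal (norm (noise n w) powr q) \<partial>M)"
      by (subst nn_integral_add) (auto simp: emeasure_space_1)
    also have "\<dots> \<le> 1 + ennreal (max C' 0)"
      using order_trans[OF C'[OF n] ennreal_leI[of C' "max C' 0"]] by (intro add_left_mono) auto
    also have "\<dots> = ennreal C" by (simp add: C_def ennreal_plus)
    finally have le: "(\<integral>\<^sup>+w. ennreal (norm (noise n w) powr r) \<partial>M) \<le> ennreal C" .
    show int: "integrable M (\<lambda>w. norm (noise n w) powr r)"
      by (rule integrableI_bounded) (use le in \<open>auto intro: le_less_trans\<close>)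
    have "ennreal (expectation (\<lambda>w. norm (noise n w) powr r)) \<le> ennreal C"
      using le by (subst nn_integral_eq_integral[symmetric, OF int]) auto
    then show "expectation (\<lambda>w. norm (noise n w) powr r) \<le> C"
      by (subst (asm) ennreal_le_iff) (auto simp: C_def)
  qed
  have C0: "0 \<le> C" using order_trans[OF Bochner_Integration.integral_nonneg C(2)[of 1]] by simp
  have sq: "sq_int M (noise n)" if n: "n \<ge> 1" for n
    unfolding sq_int_def
  proof
    show [measurable]: "noise n \<in> borel_measurable M" using measurable_past_half[OF noise_half[OF n]] .
    show "integrable M (\<lambda>w. (norm (noise n w))\<^sup>2)"
      by (rule Bochner_Integration.integrable_bound[of _ "\<lambda>w. 1 + norm (noise n w) powr r"])
         (use C(1)[OF n] powr_r_le in auto)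
  qed
  have "msq M (noise n) \<le> 1 + C" if n: "n \<ge> 1" for n
  proof -
    have "msq M (noise n) \<le> expectation (\<lambda>w. 1 + norm (noise n w) powr r)"
      unfolding msq_def using sq[OF n] C(1)[OF n]
      by (intro Bochner_Integration.integral_mono powr_r_le) (auto simp: sq_int_def)
    also have "\<dots> = 1 + expectation (\<lambda>w. norm (noise n w) powr r)" using C(1)[OF n] by (simp add: prob_space)
    finally show ?thesis using C(2)[OF n] by simp
  qed
  then show ?thesis using that[of "1 + C"] C C0 sq by fastforce
qed

lemma noise_sq: "n \<ge> 1 \<Longrightarrow> sq_int M (noise n)"
  using noise_bounds by metis

lemma x_sq: "n \<ge> 1 \<Longrightarrow> sq_int M (x n)"
proof (induction n rule: nat_induct_at_least)
  case base
  show ?case using sq_int_const[of x1] by (subst sq_int_cong[of M _ "\<lambda>w. x1"]) (auto simp del: One_nat_def intro: x_1)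
next
  case (Suc n)
  let ?y = "\<lambda>w. x n w - \<eta> n *\<^sub>R (S *v x n w - b) + \<eta> n *\<^sub>R noise n w"
  have y: "sq_int M ?y"
    using Suc noise_sq[of n] by (intro sq_int_add sq_int_diff sq_int_scaleR sq_int_matrix sq_int_const) auto
  show ?case
  proof (rule sq_int_bound[OF y, of _ 1])
    show "x (Suc n) \<in> borel_measurable M" using measurable_past[OF x_past[of "Suc n"]] by simp
    fix w assume w: "w \<in> space M"
    show "norm (x (Suc n) w) \<le> 1 * norm (?y w)"
      unfolding x_Suc[OF Suc.hyps w] half_step using norm_P_le by simp
  qed
qed

lemma coef_sq: "n \<ge> 1 \<Longrightarrow> sq_int M (\<lambda>w. coef n w i)"
proof (induction n arbitrary: i rule: nat_induct_at_least)
  case base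
  show ?case by (simp add: sq_int_const)
next
  case (Suc n)
  show ?case
  proof (cases i)
    case (Suc j)
    have "sq_int M (\<lambda>w. if \<omega> n w then 0 else coef n w (Suc j) - \<eta> n * coef n w j)"
      using Suc.hyps by (intro sq_int_coin sq_int_diff sq_int_times Suc.IH)
    then show ?thesis unfolding \<open>i = Suc j\<close> coef_Suc[OF Suc.hyps] .
  qed (simp add: sq_int_const)
qed

lemma sq_int_L: "sq_int M f \<Longrightarrow> sq_int M (\<lambda>w. L n (f w))"
  unfolding L_def by (intro sq_int_diff sq_int_scaleR sq_int_matrix)

lemma err_sq: "n \<ge> 1 \<Longrightarrow> sq_int M (err n)"
  unfolding err_def[abs_def] by (intro sq_int_diff sq_int_matrix sq_int_const x_sq)

lemma res_sq: "n \<ge> 1 \<Longrightarrow> sq_int M (res n)"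
  unfolding res_def[abs_def]
  by (intro sq_int_diff sq_int_matrix x_sq sq_int_sum sq_int_scaleR_const coef_sq) auto

lemma mart_sq: "n \<ge> 1 \<Longrightarrow> sq_int M (mart n)"
proof (induction n rule: nat_induct_at_least)
  case base
  show ?case using sq_int_const[of "0::real^'d"] by simp
next
  case (Suc n)
  have "sq_int M (\<lambda>w. L n (mart n w) + \<eta> n *\<^sub>R (P *v noise n w))"
    using Suc by (intro sq_int_add sq_int_L sq_int_scaleR sq_int_matrix noise_sq)
  then show ?case using Suc by simp
qed

lemma fluct_sq: "n \<ge> 1 \<Longrightarrow> sq_int M (fluct n)"
proof (induction n rule: nat_induct_at_least)
  case base
  show ?case using sq_int_const[of "0::real^'d"] by simp
next
  case (Suc n)
  have "sq_int M (\<lambda>w. L n (fluct n w) - (\<eta> n * (coef n w k - mcoef n k)) *\<^sub>R w0)"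
    using Suc by (intro sq_int_diff sq_int_L sq_int_scaleR_const sq_int_times coef_sq sq_int_const)
  then show ?case using Suc by simp
qed

lemma rest_sq: "n \<ge> 1 \<Longrightarrow> sq_int M (rest n)"
  unfolding rest_def[abs_def] by (intro sq_int_diff err_sq mart_sq fluct_sq sq_int_const)

subsection \<open>Conditional moments of the noise\<close>

lemma h_integral: "integrable D (h y)" "(\<integral>z. h y z \<partial>D) = 0"
proof -
  interpret D: prob_space D
    using prob_space_distr[OF \<zeta>_meas[of 1]] \<zeta>_distr[of 1] by simp
  have "has_bochner_integral D (h y) ((S *v y - b) - (S *v y - b))"
    unfolding h_def
    by (intro has_bochner_integral_diff g_unbiased)
       (simp_all add: has_bochner_integral_iff D.prob_space)
  then show "integrable D (h y)" "(\<integral>z. h y z \<partial>D) = 0"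
    by (simp_all add: has_bochner_integral_iff)
qed

lemma expectation_inner_noise:
  assumes n: "n \<ge> 1" and f: "f \<in> borel_measurable (past n)" "sq_int M f"
  shows "expectation (\<lambda>w. f w \<bullet> noise n w) = 0"
proof -
  let ?\<phi> = "\<lambda>((y, u), z). y \<bullet> h u z"
  have X: "(\<lambda>w. (f w, x n w)) \<in> measurable (past n) (borel \<Otimes>\<^sub>M borel)"
    using f x_past[OF n] by measurable
  have [measurable]: "(\<lambda>q. h (snd (fst q)) (snd q)) \<in> borel_measurable ((borel \<Otimes>\<^sub>M borel) \<Otimes>\<^sub>M D)"
    using measurable_compose[OF measurable_Pair h_meas, of "\<lambda>q. snd (fst q)" "(borel \<Otimes>\<^sub>M borel) \<Otimes>\<^sub>M D" snd]
    by simp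
  have \<phi>: "?\<phi> \<in> borel_measurable ((borel \<Otimes>\<^sub>M borel) \<Otimes>\<^sub>M D)"
    unfolding case_prod_beta' by measurable
  have "expectation (\<lambda>w. f w \<bullet> noise n w) = expectation (\<lambda>w. ?\<phi> ((f w, x n w), \<zeta> n w))"
    by (simp add: noise_def)
  also have "\<dots> = expectation (\<lambda>w. \<integral>z. ?\<phi> ((f w, x n w), z) \<partial>D)"
    using sq_int_inner_integrable[OF f(2) noise_sq[OF n]]
    by (intro expectation_sample[OF n X \<phi>]) (simp add: noise_def)
  also have "\<dots> = 0" by (simp add: h_integral)
  finally show ?thesis .
qed

text \<open>The noise is orthogonal in L2 to everything known before the step, so variances add. In
  one step it therefore costs \<eta>^2 and not \<eta>.\<close>

lemma msq_add_noise:
  assumes n: "n \<ge> 1" and f: "f \<in> borel_measurable (past n)" "sq_int M f"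
  shows "msq M (\<lambda>w. f w + c *\<^sub>R (A *v noise n w)) = msq M f + c\<^sup>2 * msq M (\<lambda>w. A *v noise n w)"
proof -
  have An: "sq_int M (\<lambda>w. A *v noise n w)" by (intro sq_int_matrix noise_sq n)
  have [measurable]: "f \<in> borel_measurable (past n)" by fact
  have tf: "(\<lambda>w. transpose A *v f w) \<in> borel_measurable (past n)" by measurable
  have "expectation (\<lambda>w. (transpose A *v f w) \<bullet> noise n w) = 0"
    by (rule expectation_inner_noise[OF n tf]) (intro sq_int_matrix f)
  then have z: "expectation (\<lambda>w. f w \<bullet> (A *v noise n w)) = 0"
    by (simp only: inner_matrix_vector)
  have "msq M (\<lambda>w. f w + c *\<^sub>R (A *v noise n w)) =
      expectation (\<lambda>w. (norm (f w))\<^sup>2 + 2 * c * (f w \<bullet> (A *v noise n w)) + c\<^sup>2 * (norm (A *v noise n w))\<^sup>2)"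
    unfolding msq_def
    by (intro Bochner_Integration.integral_cong refl)
       (simp only: power2_norm_eq_inner, simp add: inner_add_left inner_add_right inner_commute power2_eq_square algebra_simps)
  then show ?thesis
    using f(2) An sq_int_inner_integrable[OF f(2) An] z by (simp add: sq_int_def msq_def)
qed

end

section \<open>Arithmetic of orders of powers of the step size\<close>

context poly_steps
begin

lemma bigo_powr_mult:
  "f \<in> O(\<lambda>n. \<eta> n powr a) \<Longrightarrow> g \<in> O(\<lambda>n. \<eta> n powr c) \<Longrightarrow> (\<lambda>n. f n * g n) \<in> O(\<lambda>n. \<eta> n powr (a + c))"
  using landau_o.big.mult[of f _ "\<lambda>n. \<eta> n powr a" g "\<lambda>n. \<eta> n powr c"] by (simp add: powr_add)

lemma smallo_powr_mult:
  "f \<in> O(\<lambda>n. \<eta> n powr a) \<Longrightarrow> g \<in> o(\<lambda>n. \<eta> n powr c) \<Longrightarrow> (\<lambda>n. f n * g n) \<in> o(\<lambda>n. \<eta> n powr (a + c))"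
  using landau_o.big_small_mult[of f _ "\<lambda>n. \<eta> n powr a" g "\<lambda>n. \<eta> n powr c"] by (simp add: powr_add)

lemma bigo_powr_weaken: "f \<in> O(\<lambda>n. \<eta> n powr a) \<Longrightarrow> c \<le> a \<Longrightarrow> f \<in> O(\<lambda>n. \<eta> n powr c)"
  by (rule landau_o.big.trans[OF _ \<eta>_powr_bigo])

lemma bigo_powr_smallo: "f \<in> O(\<lambda>n. \<eta> n powr a) \<Longrightarrow> c < a \<Longrightarrow> f \<in> o(\<lambda>n. \<eta> n powr c)"
  by (rule landau_o.big_small_trans[OF _ \<eta>_powr_smallo])

lemma \<eta>_bigo: "\<eta> \<in> O(\<lambda>n. \<eta> n powr 1)"
  by (rule bigoI[of _ 1]) (use ev_\<eta>_pos in \<open>auto elim: eventually_mono\<close>)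

lemma const_bigo: "(\<lambda>n. c) \<in> O(\<lambda>n. \<eta> n powr 0)"
  by (rule bigoI[of _ "\<bar>c\<bar>"]) (rule eventually_mono[OF ev_\<eta>_pos], simp)

end

lemma smallo_cmult: "f \<in> o[F](s) \<Longrightarrow> (\<lambda>n. c * f n) \<in> o[F](s)" for c :: real
  by (cases "c = 0") auto

lemma norm_diff_scaleR_sq:
  fixes z y :: "'b::real_inner"
  shows "(norm (z - (a * c) *\<^sub>R y))\<^sup>2 = (norm z)\<^sup>2 - 2 * a * ((c *\<^sub>R z) \<bullet> y) + a\<^sup>2 * (norm y)\<^sup>2 * (norm c)\<^sup>2"
proof -
  have "(norm (z - (a * c) *\<^sub>R y))\<^sup>2 = z \<bullet> z - 2 * (a * c) * (z \<bullet> y) + (a * c)\<^sup>2 * (y \<bullet> y)"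
    unfolding power2_norm_eq_inner inner_diff_left inner_diff_right inner_commute[of y z] inner_scaleR_left
      inner_scaleR_right by (simp add: power2_eq_square algebra_simps)
  then show ?thesis by (simp add: power2_norm_eq_inner power_mult_distrib)
qed

lemma msq_young:
  assumes f: "sq_int M f" and g: "sq_int M g" and d: "0 < d"
  shows "msq M (\<lambda>w. f w + g w) \<le> (1 + d) * msq M f + (1 + 1 / d) * msq M g"
proof -
  have "msq M (\<lambda>w. f w + g w) \<le> (\<integral>w. (1 + d) * (norm (f w))\<^sup>2 + (1 + 1 / d) * (norm (g w))\<^sup>2 \<partial>M)"
    unfolding msq_def
  proof (intro Bochner_Integration.integral_mono)
    show "integrable M (\<lambda>w. (norm (f w + g w))\<^sup>2)" using sq_int_add[OF f g] by (simp add: sq_int_def)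
    show "integrable M (\<lambda>w. (1 + d) * (norm (f w))\<^sup>2 + (1 + 1 / d) * (norm (g w))\<^sup>2)"
      using f g by (simp add: sq_int_def)
    fix w
    let ?a = "norm (f w)" and ?c = "norm (g w)"
    have "(norm (f w + g w))\<^sup>2 \<le> (?a + ?c)\<^sup>2" by (intro power_mono norm_triangle_ineq) auto
    also have "\<dots> = (1 + d) * ?a\<^sup>2 + (1 + 1 / d) * ?c\<^sup>2 - (d * ?a - ?c)\<^sup>2 / d"
      using d by (simp add: power2_eq_square field_simps)
    also have "\<dots> \<le> (1 + d) * ?a\<^sup>2 + (1 + 1 / d) * ?c\<^sup>2" using d by simp
    finally show "(norm (f w + g w))\<^sup>2 \<le> (1 + d) * ?a\<^sup>2 + (1 + 1 / d) * ?c\<^sup>2" .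
  qed
  then show ?thesis using f g by (simp add: sq_int_def msq_def)
qed

lemma msq_diff_le: "sq_int M f \<Longrightarrow> sq_int M g \<Longrightarrow> msq M (\<lambda>w. f w - g w) \<le> 2 * msq M f + 2 * msq M g"
  using msq_add_le[of M f "\<lambda>w. (- 1) *\<^sub>R g w"] sq_int_scaleR[of M g "- 1"] msq_scaleR[of M "- 1" g] by simp

lemma msq_scaleR_const: "msq M (\<lambda>w. f w *\<^sub>R v) = (norm v)\<^sup>2 * msq M (f :: 'a \<Rightarrow> real)"
  by (simp add: msq_def power_mult_distrib mult.commute)

context lpsa
begin

text \<open>The exponent of \<eta> / p: eventually \<open>p n\<close> is \<gamma> * \<eta>^\<beta>,
  and about 1 / p steps pass between two projections, so a unit drift accumulates to the order
  \<eta>^\<tau>.\<close>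

definition \<tau> :: real where "\<tau> = 1 - \<beta>"

lemma \<tau>: "0 < \<tau>" "\<tau> < 1" using \<beta> by (auto simp: \<tau>_def)

lemma ev_p: "\<forall>\<^sub>F n in sequentially. 1 \<le> n \<and> 0 < \<eta> n \<and> 0 < p n \<and> p n \<le> 1 \<and> p n = \<gamma> * \<eta> n powr \<beta>"
proof -
  have "(\<lambda>n. \<gamma> * \<eta> n powr \<beta>) \<longlonglongrightarrow> 0"
    using \<eta>_powr_tendsto[OF \<beta>(1)] by (rule tendsto_mult_right_zero)
  then have "\<forall>\<^sub>F n in sequentially. \<gamma> * \<eta> n powr \<beta> < 1" by (rule order_tendstoD) simp
  then show ?thesis using ev_\<eta>_pos eventually_ge_at_top[of 1]
    by eventually_elim (use p \<gamma> in auto)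
qed

lemma ev_\<eta>_over_p: "\<forall>\<^sub>F n in sequentially. \<eta> n / p n = \<eta> n powr \<tau> / \<gamma>"
  using ev_p by eventually_elim (simp add: \<tau>_def powr_diff)

lemma \<eta>_over_p_bigo: "(\<lambda>n. \<eta> n / p n) \<in> O(\<lambda>n. \<eta> n powr \<tau>)"
proof -
  have "(\<lambda>n. \<eta> n powr \<tau> / \<gamma>) \<in> O(\<lambda>n. \<eta> n powr \<tau>)" using \<gamma> by simp
  then show ?thesis by (subst landau_o.big.in_cong[OF ev_\<eta>_over_p])
qed

lemma p_bigo: "p \<in> O(\<lambda>n. \<eta> n powr \<beta>)"
  by (rule bigoI[of _ \<gamma>]) (use ev_p in \<open>eventually_elim; use \<gamma> in auto\<close>)

lemma ev_\<eta>_small: "0 < e \<Longrightarrow> \<forall>\<^sub>F n in sequentially. \<eta> n \<le> e"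
  using order_tendstoD(2)[OF \<eta>_tendsto, of e] by (auto elim: eventually_mono)

lemma ev_\<eta>_le_p: "0 < e \<Longrightarrow> \<forall>\<^sub>F n in sequentially. \<eta> n \<le> e * p n"
proof -
  assume e: "0 < e"
  have "(\<lambda>n. \<eta> n powr \<tau> / \<gamma>) \<longlonglongrightarrow> 0"
    using \<eta>_powr_tendsto[OF \<tau>(1)] by (rule tendsto_divide_zero)
  then have "\<forall>\<^sub>F n in sequentially. \<eta> n powr \<tau> / \<gamma> < e" using e by (rule order_tendstoD)
  then show ?thesis using ev_\<eta>_over_p ev_p
  proof eventually_elim
    case (elim n)
    then have "\<eta> n / p n \<le> e" by simp
    then show ?case using elim by (simp add: pos_divide_le_eq)
  qed
qed

text \<open>For \<alpha> = 1 exponents below \<mu> * \<open>eta0\<close> are tracked, and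
  \<open>crit\<close> puts 2k below this number. At half the gain, as in the next lemma, exponents
  up to 1 are still covered because k is at least 1.\<close>

lemma tracks_\<mu>: "0 \<le> \<theta> \<Longrightarrow> \<theta> \<le> 2 * real k \<Longrightarrow> tracks (\<lambda>n. \<mu> * \<eta> n) (\<lambda>n. \<eta> n powr \<theta>)"
  using crit by (intro tracks_linear \<mu>) auto

lemma tracks_half_\<mu>: "0 \<le> \<theta> \<Longrightarrow> \<theta> \<le> 1 \<Longrightarrow> tracks (\<lambda>n. \<mu> / 2 * \<eta> n) (\<lambda>n. \<eta> n powr \<theta>)"
  using crit k \<mu> by (intro tracks_linear) (auto simp: field_simps)

lemma tracks_p: "0 < c \<Longrightarrow> 0 \<le> \<theta> \<Longrightarrow> tracks (\<lambda>n. c * \<gamma> * \<eta> n powr \<beta>) (\<lambda>n. \<eta> n powr \<theta>)"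
proof (rule tracks_powr)
  show "\<alpha> * \<beta> \<le> 1" using \<alpha> \<beta> by (intro mult_le_one) auto
  show "\<alpha> * \<theta> < c * \<gamma> * eta0 powr \<beta>" if "\<alpha> * \<beta> = 1"
  proof -
    have "\<alpha> * \<beta> \<le> 1 * \<beta>" using \<alpha> \<beta> by (intro mult_right_mono) auto
    then show ?thesis using that \<beta> by simp
  qed
qed (use \<gamma> \<beta> in auto)

lemma contraction:
  "\<forall>\<^sub>F n in sequentially. 1 \<le> n \<and> 0 < \<eta> n \<and> \<mu> * \<eta> n \<le> 1 \<and>
     (\<forall>z. P *v z = z \<longrightarrow> norm (L n z) \<le> (1 - \<mu> * \<eta> n) * norm z)"
proof -
  obtain \<mu>' where \<mu>': "\<mu> < \<mu>'" "\<And>z. \<mu>' * (z \<bullet> z) \<le> z \<bullet> (S *v z)" using S_coercive by blast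
  define K where "K = onorm ((*v) S) + 1"
  have K0: "0 < K" unfolding K_def using onorm_pos_le[OF matrix_vector_mul_bounded_linear[of S]] by linarith
  have K: "norm (S *v z) \<le> K * norm z" for z
    using onorm[OF matrix_vector_mul_bounded_linear[of S], of z] unfolding K_def
    by (simp add: distrib_right add_increasing2)
  \<comment> \<open>Below this threshold \<eta>^2 * K^2 is at most 2 * \<eta> * (\<mu>' - \<mu>), so
    the quadratic term is paid for by the gap between the two constants.\<close>
  have "\<forall>\<^sub>F n in sequentially. \<eta> n \<le> 2 * (\<mu>' - \<mu>) / K\<^sup>2" using \<mu>' K0 by (intro ev_\<eta>_small) auto
  moreover have "\<forall>\<^sub>F n in sequentially. \<eta> n \<le> 1 / \<mu>" using \<mu> by (intro ev_\<eta>_small) auto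
  ultimately show ?thesis using ev_\<eta>_pos eventually_ge_at_top[of 1]
  proof eventually_elim
    case (elim n)
    have le1: "\<mu> * \<eta> n \<le> 1" using elim \<mu> by (simp add: field_simps)
    have "norm (L n z) \<le> (1 - \<mu> * \<eta> n) * norm z" if z: "P *v z = z" for z
    proof (rule power2_le_imp_le)
      have zS: "z \<bullet> (P *v (S *v z)) = z \<bullet> (S *v z)" using inner_P[of z "S *v z"] z by simp
      have "(norm (L n z))\<^sup>2 = (norm z)\<^sup>2 - 2 * \<eta> n * (z \<bullet> (S *v z)) + (\<eta> n)\<^sup>2 * (norm (P *v (S *v z)))\<^sup>2"
        unfolding L_def power2_norm_eq_inner
        by (simp add: inner_diff_left inner_diff_right zS inner_commute[of "P *v (S *v z)" z] power2_eq_square algebra_simps)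
      also have "\<dots> \<le> (norm z)\<^sup>2 - 2 * \<eta> n * (\<mu>' * (norm z)\<^sup>2) + (\<eta> n)\<^sup>2 * (K * norm z)\<^sup>2"
        using \<mu>'(2)[of z] elim order_trans[OF norm_P_le K]
        by (intro add_mono diff_mono mult_left_mono power_mono) (auto simp: power2_norm_eq_inner)
      also have "\<dots> = (norm z)\<^sup>2 * (1 - 2 * \<eta> n * \<mu>') + \<eta> n * (norm z)\<^sup>2 * (\<eta> n * K\<^sup>2)"
        by (simp add: power2_eq_square algebra_simps)
      also have "\<dots> \<le> (norm z)\<^sup>2 * (1 - 2 * \<eta> n * \<mu>') + \<eta> n * (norm z)\<^sup>2 * (2 * (\<mu>' - \<mu>))"
        using elim K0 by (intro add_mono mult_left_mono) (auto simp: field_simps)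
      also have "\<dots> = (norm z)\<^sup>2 * (1 - 2 * \<mu> * \<eta> n)" by (simp add: algebra_simps)
      also have "\<dots> \<le> (norm z)\<^sup>2 * (1 - \<mu> * \<eta> n)\<^sup>2"
        using zero_le_square[of "\<mu> * \<eta> n"] by (intro mult_left_mono) (simp_all add: power2_eq_square algebra_simps)
      finally show "(norm (L n z))\<^sup>2 \<le> ((1 - \<mu> * \<eta> n) * norm z)\<^sup>2"
        by (simp add: power_mult_distrib mult.commute)
    qed (use le1 in auto)
    then show ?case using elim le1 by auto
  qed
qed

text \<open>Written as \<mu> * \<eta> times Y / \<mu>, the perturbation makes the step a convex
  combination. Convexity of the square then keeps the full rate, which a Young inequality would
  reduce.\<close>

lemma msq_L_step:
  assumes n: "0 < \<eta> n" "\<mu> * \<eta> n \<le> 1" "\<And>z. P *v z = z \<Longrightarrow> norm (L n z) \<le> (1 - \<mu> * \<eta> n) * norm z"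
    and f: "sq_int M f" "\<And>w. P *v f w = f w" and Y: "sq_int M Y"
  shows "msq M (\<lambda>w. L n (f w) - \<eta> n *\<^sub>R Y w) \<le> (1 - \<mu> * \<eta> n) * msq M f + \<mu> * \<eta> n * (msq M Y / \<mu>\<^sup>2)"
proof -
  let ?c = "\<mu> * \<eta> n"
  have c: "0 < ?c" using n \<mu> by simp
  have "msq M (\<lambda>w. L n (f w) - \<eta> n *\<^sub>R Y w) \<le>
      (\<integral>w. (1 - ?c) * (norm (f w))\<^sup>2 + ?c * ((norm (Y w))\<^sup>2 / \<mu>\<^sup>2) \<partial>M)"
    unfolding msq_def
  proof (intro Bochner_Integration.integral_mono)
    have "sq_int M (\<lambda>w. L n (f w) - \<eta> n *\<^sub>R Y w)" by (intro sq_int_diff sq_int_L sq_int_scaleR f Y)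
    then show "integrable M (\<lambda>w. (norm (L n (f w) - \<eta> n *\<^sub>R Y w))\<^sup>2)" by (simp add: sq_int_def)
    show "integrable M (\<lambda>w. (1 - ?c) * (norm (f w))\<^sup>2 + ?c * ((norm (Y w))\<^sup>2 / \<mu>\<^sup>2))"
      using f Y by (simp add: sq_int_def)
    fix w
    let ?a = "norm (f w)" and ?d = "norm (Y w) / \<mu>"
    have "norm (L n (f w) - \<eta> n *\<^sub>R Y w) \<le> norm (L n (f w)) + norm (\<eta> n *\<^sub>R Y w)" by (rule norm_triangle_ineq4)
    also have "\<dots> \<le> (1 - ?c) * ?a + ?c * ?d"
      using n(3)[OF f(2)] n(1) \<mu> by simp
    finally have "(norm (L n (f w) - \<eta> n *\<^sub>R Y w))\<^sup>2 \<le> ((1 - ?c) * ?a + ?c * ?d)\<^sup>2"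
      by (intro power_mono) auto
    also have "\<dots> = (1 - ?c) * ?a\<^sup>2 + ?c * ?d\<^sup>2 - ?c * (1 - ?c) * (?a - ?d)\<^sup>2"
      by (simp add: power2_eq_square algebra_simps)
    also have "\<dots> \<le> (1 - ?c) * ?a\<^sup>2 + ?c * ?d\<^sup>2"
      using c n(2) mult_nonneg_nonneg[of "?c * (1 - ?c)" "(?a - ?d)\<^sup>2"] by simp
    finally show "(norm (L n (f w) - \<eta> n *\<^sub>R Y w))\<^sup>2 \<le> (1 - ?c) * (norm (f w))\<^sup>2 + ?c * ((norm (Y w))\<^sup>2 / \<mu>\<^sup>2)"
      by (simp add: power_divide)
  qed
  then show ?thesis using f Y by (simp add: sq_int_def msq_def)
qed

subsection \<open>Moments of the coefficients\<close>

text \<open>\<open>(1 - p)(1 + p/2) \<le> 1 - p/2\<close>: the coin turns Young's inequality into a contraction.\<close>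

lemma msq_coin_young:
  assumes n: "n \<ge> 1" and p: "0 < p n" "p n \<le> 1"
    and f: "f \<in> borel_measurable (past_half n)" "sq_int M f"
    and f': "f' \<in> borel_measurable (past_half n)" "sq_int M f'"
  shows "msq M (\<lambda>w. if \<omega> n w then 0 else f w + f' w) \<le> (1 - p n / 2) * msq M f + 2 / p n * msq M f'"
proof -
  note [measurable] = f(1) f'(1)
  have "msq M (\<lambda>w. if \<omega> n w then 0 else f w + f' w) = (1 - p n) * msq M (\<lambda>w. f w + f' w)"
    by (intro msq_coin n sq_int_add f f') measurable
  also have "\<dots> \<le> (1 - p n) * ((1 + p n / 2) * msq M f + (1 + 1 / (p n / 2)) * msq M f')"
    using p by (intro mult_left_mono msq_young f f') auto
  also have "\<dots> = (1 - p n / 2 - (p n)\<^sup>2 / 2) * msq M f + (2 / p n - 1 - p n) * msq M f'"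
    using p by (simp add: power2_eq_square field_simps)
  also have "\<dots> \<le> (1 - p n / 2) * msq M f + 2 / p n * msq M f'"
    using p by (intro add_mono mult_right_mono msq_nonneg) auto
  finally show ?thesis .
qed

text \<open>Each coefficient is fed by \<eta> times its predecessor and forgotten at rate p, so one
  level gains (\<eta> / p)^2 in mean square.\<close>

lemma coef_msq: "(\<lambda>n. msq M (\<lambda>w. coef n w i)) \<in> O(\<lambda>n. \<eta> n powr (2 * real i * \<tau>))"
proof (induction i)
  case 0
  have "(\<lambda>n. msq M (\<lambda>w. coef n w 0)) = (\<lambda>n. 1)" by (simp add: msq_def prob_space)
  then show ?case using const_bigo[of 1] by simp
next
  case (Suc i)
  let ?B = "\<lambda>n. msq M (\<lambda>w. coef n w i)"
  have rec: "\<forall>\<^sub>F n in sequentially. msq M (\<lambda>w. coef (Suc n) w (Suc i)) \<le>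
     (1 - 1/2 * \<gamma> * \<eta> n powr \<beta>) * msq M (\<lambda>w. coef n w (Suc i))
     + 1/2 * \<gamma> * \<eta> n powr \<beta> * (4 * ((\<eta> n / p n) * (\<eta> n / p n) * ?B n))"
    using ev_p
  proof eventually_elim
    case (elim n)
    then have n: "n \<ge> 1" by simp
    have "msq M (\<lambda>w. coef (Suc n) w (Suc i)) =
        msq M (\<lambda>w. if \<omega> n w then 0 else coef n w (Suc i) + (- \<eta> n) * coef n w i)"
      unfolding coef_Suc[OF n] by (rule msq_cong) simp
    also have "\<dots> \<le> (1 - p n / 2) * msq M (\<lambda>w. coef n w (Suc i)) + 2 / p n * msq M (\<lambda>w. (- \<eta> n) * coef n w i)"
    proof (rule msq_coin_young[OF n _ _ _ coef_sq[OF n] _ sq_int_times[OF coef_sq[OF n]]])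
      show "(\<lambda>w. coef n w (Suc i)) \<in> borel_measurable (past_half n)"
        by (rule past_imp_half[OF coef_past[OF n]])
      have [measurable]: "(\<lambda>w. coef n w i) \<in> borel_measurable (past_half n)"
        by (rule past_imp_half[OF coef_past[OF n]])
      show "(\<lambda>w. (- \<eta> n) * coef n w i) \<in> borel_measurable (past_half n)" by measurable
    qed (use elim in auto)
    also have "msq M (\<lambda>w. (- \<eta> n) * coef n w i) = (\<eta> n)\<^sup>2 * ?B n"
      using msq_scaleR[of M "- \<eta> n" "\<lambda>w. coef n w i"] by simp
    also have "2 / p n * ((\<eta> n)\<^sup>2 * ?B n) = p n / 2 * (4 * ((\<eta> n / p n) * (\<eta> n / p n) * ?B n))"
      using elim by (simp add: power2_eq_square field_simps)
    finally show ?case using elim by (simp add: mult.commute)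
  qed
  have "(\<lambda>n. 4 * ((\<eta> n / p n) * (\<eta> n / p n) * ?B n)) \<in> O(\<lambda>n. \<eta> n powr (\<tau> + \<tau> + 2 * real i * \<tau>))"
    by (intro landau_o.big.cmult_in_iff[THEN iffD2] bigo_powr_mult \<eta>_over_p_bigo Suc) auto
  also have "\<tau> + \<tau> + 2 * real i * \<tau> = 2 * real (Suc i) * \<tau>" by (simp add: algebra_simps)
  finally show ?case
    using \<tau> by (intro tracks_bigo[OF tracks_p _ rec]) (auto simp: msq_nonneg)
qed

text \<open>The mean follows the moving fixed point of its recursion: at equilibrium level i + 1 is
  - \<eta> / p times level i to leading order, that is - \<eta>^\<tau> / \<gamma> times it.\<close>

lemma mcoef_asymp:
  "(\<lambda>n. mcoef n i - (- 1 / \<gamma>) ^ i * \<eta> n powr (real i * \<tau>)) \<in> o(\<lambda>n. \<eta> n powr (real i * \<tau>))"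
proof (induction i)
  case 0
  have "(\<lambda>n. mcoef n 0 - (- 1 / \<gamma>) ^ 0 * \<eta> n powr (real 0 * \<tau>)) \<in> o(\<lambda>n. \<eta> n powr (real 0 * \<tau>)) \<longleftrightarrow>
      (\<lambda>n. 0) \<in> o(\<lambda>n. \<eta> n powr (real 0 * \<tau>))"
    by (intro landau_o.small.in_cong) (use ev_\<eta>_pos in \<open>eventually_elim; simp\<close>)
  then show ?case by simp
next
  case (Suc i)
  define s where "s n = \<eta> n powr (real (Suc i) * \<tau>)" for n
  define \<kappa> where "\<kappa> = (- 1 / \<gamma>) ^ Suc i"
  define d where "d n = mcoef n i - (- 1 / \<gamma>) ^ i * \<eta> n powr (real i * \<tau>)" for n
  define \<Delta> where "\<Delta> n = \<bar>mcoef n (Suc i) - \<kappa> * s n\<bar>" for n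
  \<comment> \<open>The three errors: the change of the target during one memory time 1 / p, the
    factor 1 - p taken as 1 in the fixed point, and the error of the previous level.\<close>
  define y where "y n = \<kappa> * ((s n - s (Suc n)) / p n) - \<kappa> * (p n * s n) - (1 - p n) * ((\<eta> n / p n) * d n)" for n
  have rec: "\<forall>\<^sub>F n in sequentially. \<Delta> (Suc n) \<le> (1 - 1 * \<gamma> * \<eta> n powr \<beta>) * \<Delta> n + 1 * \<gamma> * \<eta> n powr \<beta> * \<bar>y n\<bar>"
    using ev_p ev_\<eta>_over_p
  proof eventually_elim
    case (elim n)
    then have n: "n \<ge> 1" and p0: "p n \<noteq> 0" by auto
    have \<kappa>s: "\<eta> n / p n * ((- 1 / \<gamma>) ^ i * \<eta> n powr (real i * \<tau>)) = - \<kappa> * s n"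
      using elim \<gamma> by (simp add: \<kappa>_def s_def powr_add[symmetric] algebra_simps)
    have "\<eta> n * mcoef n i = p n * (\<eta> n / p n * ((- 1 / \<gamma>) ^ i * \<eta> n powr (real i * \<tau>)) + \<eta> n / p n * d n)"
      using p0 by (simp add: d_def field_simps)
    then have \<eta>m: "\<eta> n * mcoef n i = p n * (- \<kappa> * s n + \<eta> n / p n * d n)" unfolding \<kappa>s .
    have "mcoef (Suc n) (Suc i) - \<kappa> * s (Suc n) = (1 - p n) * (mcoef n (Suc i) - \<kappa> * s n) + p n * y n"
      unfolding mcoef_Suc[OF n] \<eta>m y_def using p0 by (simp add: field_simps)
    then have "\<Delta> (Suc n) \<le> \<bar>(1 - p n) * (mcoef n (Suc i) - \<kappa> * s n)\<bar> + \<bar>p n * y n\<bar>"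
      by (simp add: \<Delta>_def abs_triangle_ineq)
    also have "\<dots> = (1 - p n) * \<Delta> n + p n * \<bar>y n\<bar>" using elim \<gamma> by (simp add: abs_mult \<Delta>_def)
    finally show ?case using elim by (simp add: mult.commute)
  qed
  have 1: "(\<lambda>n. (s n - s (Suc n)) / p n) \<in> o(s)"
  proof -
    have "(\<lambda>n. s n - s (Suc n)) \<in> O(\<lambda>n. s n / real n)"
      unfolding s_def by (rule \<eta>_powr_diff_bigo)
    then have "(\<lambda>n. (s n - s (Suc n)) * (1 / p n)) \<in> O(\<lambda>n. s n * (1 / real n) * (1 / p n))"
      by (intro landau_o.big.mult) auto
    also have "(\<lambda>n. s n * (1 / real n) * (1 / p n)) \<in> O(\<lambda>n. s n * \<eta> n * (1 / p n))"
      by (intro landau_o.big.mult inverse_bigo_\<eta>) auto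
    finally have "(\<lambda>n. (s n - s (Suc n)) / p n) \<in> O(\<lambda>n. (\<eta> n / p n) * s n)" by (simp add: mult.commute)
    also have "(\<lambda>n. (\<eta> n / p n) * s n) \<in> O(\<lambda>n. \<eta> n powr (\<tau> + real (Suc i) * \<tau>))"
      unfolding s_def by (intro bigo_powr_mult \<eta>_over_p_bigo) auto
    finally show ?thesis unfolding s_def using \<tau> by (elim bigo_powr_smallo) auto
  qed
  have 2: "(\<lambda>n. p n * s n) \<in> o(s)"
  proof -
    have "(\<lambda>n. p n * s n) \<in> O(\<lambda>n. \<eta> n powr (\<beta> + real (Suc i) * \<tau>))"
      unfolding s_def by (intro bigo_powr_mult p_bigo) auto
    then show ?thesis unfolding s_def using \<beta> by (elim bigo_powr_smallo) auto
  qed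
  have 3: "(\<lambda>n. (1 - p n) * ((\<eta> n / p n) * d n)) \<in> o(s)"
  proof -
    have "(\<lambda>n. (\<eta> n / p n) * d n) \<in> o(\<lambda>n. \<eta> n powr (\<tau> + real i * \<tau>))"
      unfolding d_def by (intro smallo_powr_mult \<eta>_over_p_bigo Suc)
    also have "\<tau> + real i * \<tau> = real (Suc i) * \<tau>" by (simp add: algebra_simps)
    finally have "(\<lambda>n. (\<eta> n / p n) * d n) \<in> o(\<lambda>n. \<eta> n powr (real (Suc i) * \<tau>))" .
    moreover have "(\<lambda>n. 1 - p n) \<in> O(\<lambda>n. \<eta> n powr 0)"
      by (rule bigoI[of _ 1]) (use ev_p in \<open>eventually_elim; auto\<close>)
    ultimately show ?thesis unfolding s_def using smallo_powr_mult by fastforce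
  qed
  have "y \<in> o(s)"
    unfolding y_def by (intro sum_in_smallo smallo_cmult 1 2 3)
  then have y: "(\<lambda>n. \<bar>y n\<bar>) \<in> o(s)" by simp
  have "\<Delta> \<in> o(\<lambda>n. \<eta> n powr (real (Suc i) * \<tau>))"
    using \<tau> y[unfolded s_def]
    by (intro tracks_smallo[OF tracks_p _ rec]) (auto simp: \<Delta>_def)
  then show ?case unfolding \<Delta>_def s_def \<kappa>_def by simp
qed

lemma mcoef_bigo: "(\<lambda>n. mcoef n i) \<in> O(\<lambda>n. \<eta> n powr (real i * \<tau>))"
proof -
  have "(\<lambda>n. (mcoef n i - (- 1 / \<gamma>) ^ i * \<eta> n powr (real i * \<tau>)) + (- 1 / \<gamma>) ^ i * \<eta> n powr (real i * \<tau>))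
      \<in> O(\<lambda>n. \<eta> n powr (real i * \<tau>))"
    by (intro sum_in_bigo landau_o.small_imp_big[OF mcoef_asymp]) auto
  then show ?thesis by simp
qed

subsection \<open>Second moments of the error and of the residual\<close>

text \<open>The order of the error: exponent 1/2 comes from the noise and k * \<tau> from the bias
  of the projections; the smaller one dominates.\<close>

definition \<theta> :: real where "\<theta> = min (1 / 2) (real k * \<tau>)"

lemma \<theta>: "0 < \<theta>" "2 * \<theta> \<le> 1" "\<theta> \<le> real k * \<tau>"
  using \<tau> k by (auto simp: \<theta>_def)

text \<open>Inputs of size \<eta> may accumulate over about 1 / p steps, whence \<eta>^2 / p; the
  noise adds orthogonally and costs only \<eta>^2.\<close>

lemma res_rec:
  obtains C where "0 < C" "\<forall>\<^sub>F n in sequentially. msq M (res (Suc n)) \<le> (1 - p n / 2) * msq M (res n)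
    + C * \<eta> n * (\<eta> n / p n) * (msq M (err n) + msq M (res n) + msq M (\<lambda>w. coef n w k)) + C * (\<eta> n)\<^sup>2"
proof -
  obtain C0 where C0: "0 \<le> C0" "\<And>n. n \<ge> 1 \<Longrightarrow> msq M (noise n) \<le> C0"
    using noise_bounds by metis
  define K where "K = (onorm ((*v) (Q ** S)))\<^sup>2"
  define C where "C = 8 * (4 * K + 2 * (norm (Q *v kry k))\<^sup>2) + (onorm ((*v) Q))\<^sup>2 * C0 + 1"
  have K0: "0 \<le> K" by (simp add: K_def)
  have C: "0 < C" using K0 C0 by (simp add: C_def add_nonneg_pos)
  have "\<forall>\<^sub>F n in sequentially. msq M (res (Suc n)) \<le> (1 - p n / 2) * msq M (res n)
    + C * \<eta> n * (\<eta> n / p n) * (msq M (err n) + msq M (res n) + msq M (\<lambda>w. coef n w k)) + C * (\<eta> n)\<^sup>2"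
    using ev_p
  proof eventually_elim
    case (elim n)
    then have n: "n \<ge> 1" by simp
    have [measurable]: "res n \<in> borel_measurable (past n)" "err n \<in> borel_measurable (past n)"
        "(\<lambda>w. coef n w k) \<in> borel_measurable (past n)"
      using res_past[OF n] err_past[OF n] coef_past[OF n] by auto
    have [measurable]: "noise n \<in> borel_measurable (past_half n)" by (rule noise_half[OF n])
    define Y where "Y w = Q *v (S *v res n w) + Q *v (S *v err n w) + coef n w k *\<^sub>R (Q *v kry k)" for w
    have Ym [measurable]: "Y \<in> borel_measurable (past n)" unfolding Y_def[abs_def] by measurable
    have sq: "sq_int M (\<lambda>w. Q *v (S *v res n w))" "sq_int M (\<lambda>w. Q *v (S *v err n w))"
      "sq_int M (\<lambda>w. coef n w k *\<^sub>R (Q *v kry k))"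
      by (intro sq_int_matrix res_sq err_sq n sq_int_scaleR_const coef_sq)+
    have Ysq: "sq_int M Y" unfolding Y_def[abs_def] by (intro sq_int_add sq)
    have Yle: "msq M Y \<le> (4 * K + 2 * (norm (Q *v kry k))\<^sup>2) * (msq M (err n) + msq M (res n) + msq M (\<lambda>w. coef n w k))"
    proof -
      have "msq M Y \<le> 2 * (2 * msq M (\<lambda>w. (Q ** S) *v res n w) + 2 * msq M (\<lambda>w. (Q ** S) *v err n w))
          + 2 * msq M (\<lambda>w. coef n w k *\<^sub>R (Q *v kry k))"
        unfolding Y_def[abs_def] matrix_vector_mul_assoc[symmetric]
        by (intro order_trans[OF msq_add_le] add_mono mult_left_mono sq_int_add sq order_refl msq_add_le) auto
      also have "\<dots> \<le> 2 * (2 * (K * msq M (res n)) + 2 * (K * msq M (err n))) + 2 * ((norm (Q *v kry k))\<^sup>2 * msq M (\<lambda>w. coef n w k))"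
        unfolding K_def msq_scaleR_const
        by (intro add_mono mult_left_mono msq_matrix_le res_sq err_sq n) auto
      also have "\<dots> = 4 * K * (msq M (err n) + msq M (res n)) + 2 * (norm (Q *v kry k))\<^sup>2 * msq M (\<lambda>w. coef n w k)"
        by (simp add: algebra_simps)
      also have "\<dots> \<le> (4 * K + 2 * (norm (Q *v kry k))\<^sup>2) * (msq M (err n) + msq M (res n))
          + (4 * K + 2 * (norm (Q *v kry k))\<^sup>2) * msq M (\<lambda>w. coef n w k)"
        using K0 by (intro add_mono mult_right_mono msq_nonneg add_nonneg_nonneg) auto
      finally show ?thesis by (simp add: distrib_left)
    qed
    let ?f = "\<lambda>w. res n w + (- \<eta> n) *\<^sub>R Y w"
    have fsq: "sq_int M ?f" by (intro sq_int_add sq_int_scaleR res_sq n Ysq)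
    have fm [measurable]: "?f \<in> borel_measurable (past n)" by measurable
    have "msq M (res (Suc n)) = msq M (\<lambda>w. if \<omega> n w then 0 else ?f w + \<eta> n *\<^sub>R (Q *v noise n w))"
      by (rule msq_cong) (simp add: res_Suc[OF n] Y_def)
    also have "\<dots> = (1 - p n) * msq M (\<lambda>w. ?f w + \<eta> n *\<^sub>R (Q *v noise n w))"
    proof (rule msq_coin[OF n])
      have [measurable]: "?f \<in> borel_measurable (past_half n)" using past_imp_half[OF fm] .
      show "(\<lambda>w. ?f w + \<eta> n *\<^sub>R (Q *v noise n w)) \<in> borel_measurable (past_half n)" by measurable
      show "sq_int M (\<lambda>w. ?f w + \<eta> n *\<^sub>R (Q *v noise n w))"
        by (intro sq_int_add[OF fsq] sq_int_scaleR sq_int_matrix noise_sq n)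
    qed
    also have "\<dots> = (1 - p n) * msq M ?f + (1 - p n) * ((\<eta> n)\<^sup>2 * msq M (\<lambda>w. Q *v noise n w))"
      unfolding msq_add_noise[OF n fm fsq] by (simp add: distrib_left)
    \<comment> \<open>The noise has been split off by orthogonality. The rest is turned back into a
      coin expectation so that Young's inequality, with its factor 1 / p, is applied to the known
      part alone.\<close>
    also have "(1 - p n) * msq M ?f = msq M (\<lambda>w. if \<omega> n w then 0 else ?f w)"
      by (rule msq_coin[OF n past_imp_half[OF fm] fsq, symmetric])
    also have "\<dots> \<le> (1 - p n / 2) * msq M (res n) + 2 / p n * msq M (\<lambda>w. (- \<eta> n) *\<^sub>R Y w)"
    proof (rule msq_coin_young[OF n _ _ _ res_sq[OF n] _ sq_int_scaleR[OF Ysq]])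
      have [measurable]: "Y \<in> borel_measurable (past_half n)" using past_imp_half[OF Ym] .
      show "(\<lambda>w. (- \<eta> n) *\<^sub>R Y w) \<in> borel_measurable (past_half n)" by measurable
    qed (use elim past_imp_half[OF res_past[OF n]] in auto)
    also have "msq M (\<lambda>w. (- \<eta> n) *\<^sub>R Y w) = (\<eta> n)\<^sup>2 * msq M Y" by (simp add: msq_scaleR del: scaleR_minus_left)
    also have "2 / p n * ((\<eta> n)\<^sup>2 * msq M Y) = 2 * \<eta> n * (\<eta> n / p n) * msq M Y"
      by (simp add: power2_eq_square)
    also have "\<dots> \<le> 2 * \<eta> n * (\<eta> n / p n) * ((4 * K + 2 * (norm (Q *v kry k))\<^sup>2) * (msq M (err n) + msq M (res n) + msq M (\<lambda>w. coef n w k)))"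
      using elim by (intro mult_left_mono Yle) auto
    also have "\<dots> = (2 * (4 * K + 2 * (norm (Q *v kry k))\<^sup>2)) * (\<eta> n * (\<eta> n / p n) * (msq M (err n) + msq M (res n) + msq M (\<lambda>w. coef n w k)))"
      by simp
    also have "\<dots> \<le> C * (\<eta> n * (\<eta> n / p n) * (msq M (err n) + msq M (res n) + msq M (\<lambda>w. coef n w k)))"
      using elim K0 C0 by (intro mult_right_mono mult_nonneg_nonneg add_nonneg_nonneg msq_nonneg)
        (auto simp: C_def)
    also have "(1 - p n) * ((\<eta> n)\<^sup>2 * msq M (\<lambda>w. Q *v noise n w)) \<le> 1 * ((\<eta> n)\<^sup>2 * C)"
    proof (intro mult_mono mult_left_mono)
      have "msq M (\<lambda>w. Q *v noise n w) \<le> (onorm ((*v) Q))\<^sup>2 * msq M (noise n)"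
        by (intro msq_matrix_le noise_sq n)
      also have "\<dots> \<le> (onorm ((*v) Q))\<^sup>2 * C0" by (intro mult_left_mono C0 n) auto
      also have "\<dots> \<le> C" using K0 by (simp add: C_def add_nonneg_nonneg)
      finally show "msq M (\<lambda>w. Q *v noise n w) \<le> C" .
    qed (use elim in \<open>auto simp: msq_nonneg\<close>)
    finally show ?case by (simp add: mult.commute mult.assoc mult.left_commute)
  qed
  then show ?thesis using that C by blast
qed

lemma err_rec:
  obtains C where "0 < C" "\<forall>\<^sub>F n in sequentially. msq M (err (Suc n)) \<le> (1 - \<mu> * \<eta> n) * msq M (err n)
    + C * \<eta> n * (msq M (\<lambda>w. coef n w k) + msq M (res n)) + C * (\<eta> n)\<^sup>2"
proof -
  obtain C0 where C0: "0 \<le> C0" "\<And>n. n \<ge> 1 \<Longrightarrow> msq M (noise n) \<le> C0"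
    using noise_bounds by metis
  define K where "K = (onorm ((*v) (P ** S)))\<^sup>2"
  define C where "C = (2 * (norm w0)\<^sup>2 + 2 * K) / \<mu> + (onorm ((*v) P))\<^sup>2 * C0 + 1"
  have K0: "0 \<le> K" by (simp add: K_def)
  have C: "0 < C" using K0 C0 \<mu> by (simp add: C_def add_nonneg_pos)
  have "\<forall>\<^sub>F n in sequentially. msq M (err (Suc n)) \<le> (1 - \<mu> * \<eta> n) * msq M (err n)
    + C * \<eta> n * (msq M (\<lambda>w. coef n w k) + msq M (res n)) + C * (\<eta> n)\<^sup>2"
    using contraction
  proof eventually_elim
    case (elim n)
    then have n: "n \<ge> 1" by simp
    have [measurable]: "res n \<in> borel_measurable (past n)" "err n \<in> borel_measurable (past n)"
        "(\<lambda>w. coef n w k) \<in> borel_measurable (past n)"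
      using res_past[OF n] err_past[OF n] coef_past[OF n] by auto
    define Y where "Y w = coef n w k *\<^sub>R w0 + P *v (S *v res n w)" for w
    have sq: "sq_int M (\<lambda>w. coef n w k *\<^sub>R w0)" "sq_int M (\<lambda>w. P *v (S *v res n w))"
      by (intro sq_int_matrix res_sq n sq_int_scaleR_const coef_sq)+
    have Ysq: "sq_int M Y" unfolding Y_def[abs_def] by (intro sq_int_add sq)
    have Yle: "msq M Y \<le> (2 * (norm w0)\<^sup>2 + 2 * K) * (msq M (\<lambda>w. coef n w k) + msq M (res n))"
    proof -
      have "msq M Y \<le> 2 * msq M (\<lambda>w. coef n w k *\<^sub>R w0) + 2 * msq M (\<lambda>w. (P ** S) *v res n w)"
        unfolding Y_def[abs_def] matrix_vector_mul_assoc[symmetric] by (intro msq_add_le sq)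
      also have "\<dots> \<le> 2 * ((norm w0)\<^sup>2 * msq M (\<lambda>w. coef n w k)) + 2 * (K * msq M (res n))"
        unfolding K_def msq_scaleR_const by (intro add_mono mult_left_mono msq_matrix_le res_sq n) auto
      also have "\<dots> \<le> (2 * (norm w0)\<^sup>2 + 2 * K) * msq M (\<lambda>w. coef n w k) + (2 * (norm w0)\<^sup>2 + 2 * K) * msq M (res n)"
        unfolding mult.assoc[symmetric] using K0 by (intro add_mono mult_right_mono msq_nonneg) auto
      finally show ?thesis by (simp add: distrib_left)
    qed
    let ?f = "\<lambda>w. L n (err n w) - \<eta> n *\<^sub>R Y w"
    have fsq: "sq_int M ?f" by (intro sq_int_diff sq_int_L sq_int_scaleR err_sq n Ysq)
    have fm: "?f \<in> borel_measurable (past n)" unfolding L_def Y_def by measurable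
    have "msq M (err (Suc n)) = msq M (\<lambda>w. ?f w + \<eta> n *\<^sub>R (P *v noise n w))"
      by (rule msq_cong) (simp add: err_Suc[OF n] Y_def)
    also have "\<dots> = msq M ?f + (\<eta> n)\<^sup>2 * msq M (\<lambda>w. P *v noise n w)"
      by (rule msq_add_noise[OF n fm fsq])
    also have "msq M ?f \<le> (1 - \<mu> * \<eta> n) * msq M (err n) + \<mu> * \<eta> n * (msq M Y / \<mu>\<^sup>2)"
      using elim by (intro msq_L_step err_sq n P_err Ysq) auto
    also have "\<mu> * \<eta> n * (msq M Y / \<mu>\<^sup>2) = \<eta> n / \<mu> * msq M Y"
      using \<mu> by (simp add: power2_eq_square)
    also have "\<dots> \<le> \<eta> n / \<mu> * ((2 * (norm w0)\<^sup>2 + 2 * K) * (msq M (\<lambda>w. coef n w k) + msq M (res n)))"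
      using elim \<mu> by (intro mult_left_mono Yle) auto
    also have "\<dots> = ((2 * (norm w0)\<^sup>2 + 2 * K) / \<mu>) * (\<eta> n * (msq M (\<lambda>w. coef n w k) + msq M (res n)))"
      by simp
    also have "\<dots> \<le> C * (\<eta> n * (msq M (\<lambda>w. coef n w k) + msq M (res n)))"
      using elim C0 by (intro mult_right_mono mult_nonneg_nonneg add_nonneg_nonneg msq_nonneg)
        (auto simp: C_def)
    also have "(\<eta> n)\<^sup>2 * msq M (\<lambda>w. P *v noise n w) \<le> (\<eta> n)\<^sup>2 * C"
    proof (intro mult_left_mono)
      have "msq M (\<lambda>w. P *v noise n w) \<le> (onorm ((*v) P))\<^sup>2 * msq M (noise n)"
        by (intro msq_matrix_le noise_sq n)
      also have "\<dots> \<le> (onorm ((*v) P))\<^sup>2 * C0" by (intro mult_left_mono C0 n) auto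
      also have "\<dots> \<le> C" using K0 \<mu> by (simp add: C_def add_nonneg_nonneg)
      finally show "msq M (\<lambda>w. P *v noise n w) \<le> C" .
    qed auto
    finally show ?case by (simp add: mult.commute mult.assoc mult.left_commute)
  qed
  then show ?thesis using that C by blast
qed

text \<open>The recursions of \<open>err\<close> and \<open>res\<close> feed each other, but their
  sum closes: the feedback of \<open>err\<close> into \<open>res\<close> carries the vanishing
  factor \<eta> / p, and the feedback of \<open>res\<close> into \<open>err\<close> is of order
  \<eta>, negligible against the forgetting rate p.\<close>

lemma err_res_msq: "(\<lambda>n. msq M (err n) + msq M (res n)) \<in> O(\<lambda>n. \<eta> n powr (2 * \<theta>))"
proof -
  let ?B = "\<lambda>n. msq M (\<lambda>w. coef n w k)"
  obtain C where C: "0 < C" and rec_res: "\<forall>\<^sub>F n in sequentially. msq M (res (Suc n)) \<le> (1 - p n / 2) * msq M (res n)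
    + C * \<eta> n * (\<eta> n / p n) * (msq M (err n) + msq M (res n) + ?B n) + C * (\<eta> n)\<^sup>2"
    by (rule res_rec)
  obtain C' where C': "0 < C'" and rec_err: "\<forall>\<^sub>F n in sequentially. msq M (err (Suc n)) \<le> (1 - \<mu> * \<eta> n) * msq M (err n)
    + C' * \<eta> n * (?B n + msq M (res n)) + C' * (\<eta> n)\<^sup>2"
    by (rule err_rec)
  \<comment> \<open>The bound for \<eta> / p. The first entry lets half the contraction of
    \<open>err\<close> pay for the feedback into \<open>res\<close>; the second lets half the
    forgetting p pay for the feedback into \<open>err\<close> and for the contraction claimed for
    \<open>res\<close>.\<close>
  define e where "e = min (\<mu> / (2 * C)) (1 / (2 * (C' + \<mu>)))"
  have e: "0 < e" "C * e \<le> \<mu> / 2" "(C' + \<mu>) * e \<le> 1 / 2"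
  proof -
    show "0 < e" using C C' \<mu> by (simp add: e_def)
    have "C * e \<le> C * (\<mu> / (2 * C))" using C by (intro mult_left_mono) (auto simp: e_def)
    then show "C * e \<le> \<mu> / 2" using C by simp
    have "(C' + \<mu>) * e \<le> (C' + \<mu>) * (1 / (2 * (C' + \<mu>)))" using C' \<mu> by (intro mult_left_mono) (auto simp: e_def)
    also have "\<dots> = 1 / 2" using C' \<mu> by (simp add: field_simps)
    finally show "(C' + \<mu>) * e \<le> 1 / 2" .
  qed
  let ?y = "\<lambda>n. 2 / \<mu> * ((C' + \<mu> / 2) * ?B n + (C + C') * \<eta> n)"
  have rec: "\<forall>\<^sub>F n in sequentially. msq M (err (Suc n)) + msq M (res (Suc n)) \<le>
     (1 - \<mu> / 2 * \<eta> n) * (msq M (err n) + msq M (res n)) + \<mu> / 2 * \<eta> n * ?y n"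
    using rec_res rec_err ev_p ev_\<eta>_le_p[OF e(1)]
  proof eventually_elim
    case (elim n)
    define E R B q where "E = msq M (err n)" and "R = msq M (res n)" and "B = ?B n" and "q = \<eta> n / p n"
    have nn: "0 \<le> E" "0 \<le> R" "0 \<le> B" by (simp_all add: E_def R_def B_def msq_nonneg)
    have q: "q \<le> e" "0 \<le> q" using elim by (auto simp: q_def pos_divide_le_eq)
    have Cq: "C * q \<le> \<mu> / 2" using mult_left_mono[OF q(1) less_imp_le[OF C]] e(2) by linarith
    have "p n \<noteq> 0" using elim by auto
    then have "(C' + \<mu>) * \<eta> n = (C' + \<mu>) * q * p n" by (simp add: q_def)
    also have "\<dots> \<le> 1 / 2 * p n"
    proof (rule mult_right_mono)
      have "(C' + \<mu>) * q \<le> (C' + \<mu>) * e" using C' \<mu> by (intro mult_left_mono q) auto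
      then show "(C' + \<mu>) * q \<le> 1 / 2" using e(3) by linarith
    qed (use elim in auto)
    finally have p: "(C' + \<mu>) * \<eta> n \<le> p n / 2" by simp
    \<comment> \<open>Naming the products leaves an inequality linear in them.\<close>
    define e1 e2 e3 e4 where "e1 = \<mu> * (\<eta> n * E)" and "e2 = \<mu> * (\<eta> n * R)" and "e3 = \<mu> * (\<eta> n * B)"
      and "e4 = C' * (\<eta> n * R)"
    have "C * q * (\<eta> n * (E + R + B)) \<le> \<mu> / 2 * (\<eta> n * (E + R + B))"
      using Cq elim nn by (intro mult_right_mono) auto
    also have "\<dots> = e1 / 2 + e2 / 2 + e3 / 2" by (simp add: e1_def e2_def e3_def algebra_simps)
    finally have f1: "C * \<eta> n * q * (E + R + B) \<le> e1 / 2 + e2 / 2 + e3 / 2" by (simp add: mult_ac)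
    have "(C' + \<mu>) * \<eta> n * R \<le> p n / 2 * R" using p nn(2) by (rule mult_right_mono)
    then have f2: "e4 + e2 \<le> p n / 2 * R" by (simp add: e2_def e4_def algebra_simps)
    have "(1 - p n / 2) * R = R - p n / 2 * R" "(1 - \<mu> * \<eta> n) * E = E - e1"
      "C' * \<eta> n * (B + R) = C' * (\<eta> n * B) + e4" "(1 - \<mu> / 2 * \<eta> n) * (E + R) = E + R - e1 / 2 - e2 / 2"
      "\<eta> n * ((C' + \<mu> / 2) * B + (C + C') * \<eta> n) = C' * (\<eta> n * B) + e3 / 2 + C * (\<eta> n)\<^sup>2 + C' * (\<eta> n)\<^sup>2"
      by (simp_all add: e1_def e2_def e3_def e4_def power2_eq_square field_simps)
    then have "(1 - p n / 2) * R + C * \<eta> n * q * (E + R + B) + C * (\<eta> n)\<^sup>2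
        + ((1 - \<mu> * \<eta> n) * E + C' * \<eta> n * (B + R) + C' * (\<eta> n)\<^sup>2)
      \<le> (1 - \<mu> / 2 * \<eta> n) * (E + R) + \<eta> n * ((C' + \<mu> / 2) * B + (C + C') * \<eta> n)"
      using f1 f2 by linarith
    also have "\<eta> n * ((C' + \<mu> / 2) * B + (C + C') * \<eta> n) = \<mu> / 2 * \<eta> n * (2 / \<mu> * ((C' + \<mu> / 2) * B + (C + C') * \<eta> n))"
      using \<mu> by simp
    finally show ?case using elim(1,2) unfolding E_def R_def B_def q_def by linarith
  qed
  have y: "?y \<in> O(\<lambda>n. \<eta> n powr (2 * \<theta>))"
    using \<theta> \<mu> C C'
    by (intro landau_o.big.cmult_in_iff[THEN iffD2] sum_in_bigo bigo_powr_weaken[OF coef_msq] bigo_powr_weaken[OF \<eta>_bigo])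
       auto
  show ?thesis
    by (rule tracks_bigo[OF tracks_half_\<mu> _ rec y]) (use \<theta> in \<open>auto intro!: always_eventually add_nonneg_nonneg msq_nonneg\<close>)
qed

text \<open>The joint bound, inserted once more into the recursion of \<open>res\<close> alone,
  gains (\<eta> / p)^2 on the feedback, while the noise contributes \<eta> * (\<eta> / p). Both
  improve big-O to little-o.\<close>

lemma res_msq: "(\<lambda>n. msq M (res n)) \<in> o(\<lambda>n. \<eta> n powr (2 * \<theta>))"
proof -
  let ?B = "\<lambda>n. msq M (\<lambda>w. coef n w k)" and ?W = "\<lambda>n. msq M (err n) + msq M (res n)"
  obtain C where C: "0 < C" and rec: "\<forall>\<^sub>F n in sequentially. msq M (res (Suc n)) \<le> (1 - p n / 2) * msq M (res n)
    + C * \<eta> n * (\<eta> n / p n) * (msq M (err n) + msq M (res n) + ?B n) + C * (\<eta> n)\<^sup>2"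
    by (rule res_rec)
  let ?y = "\<lambda>n. 2 * C * ((\<eta> n / p n) * (\<eta> n / p n) * (?W n + ?B n)) + 2 * C * (\<eta> n * (\<eta> n / p n))"
  have rec': "\<forall>\<^sub>F n in sequentially. msq M (res (Suc n)) \<le>
      (1 - 1/2 * \<gamma> * \<eta> n powr \<beta>) * msq M (res n) + 1/2 * \<gamma> * \<eta> n powr \<beta> * ?y n"
    using rec ev_p
  proof eventually_elim
    case (elim n)
    define q where "q = \<eta> n / p n"
    have "C * \<eta> n * q * (?W n + ?B n) + C * (\<eta> n)\<^sup>2 = p n / 2 * (2 * C * (q * q * (?W n + ?B n)) + 2 * C * (\<eta> n * q))"
    proof -
      have "p n \<noteq> 0" using elim by auto
      then have "\<eta> n = p n * q" by (simp add: q_def)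
      then show ?thesis by (simp add: power2_eq_square algebra_simps)
    qed
    moreover have "1/2 * \<gamma> * \<eta> n powr \<beta> = p n / 2" using elim by simp
    ultimately show ?case using elim(1) unfolding q_def[symmetric] by simp
  qed
  have y: "?y \<in> o(\<lambda>n. \<eta> n powr (2 * \<theta>))"
  proof (intro sum_in_smallo)
    have "(\<lambda>n. ?W n + ?B n) \<in> O(\<lambda>n. \<eta> n powr (2 * \<theta>))"
      using \<theta> by (intro sum_in_bigo(1) err_res_msq bigo_powr_weaken[OF coef_msq]) auto
    then have "(\<lambda>n. (\<eta> n / p n) * (\<eta> n / p n) * (?W n + ?B n)) \<in> O(\<lambda>n. \<eta> n powr (\<tau> + \<tau> + 2 * \<theta>))"
      by (intro bigo_powr_mult \<eta>_over_p_bigo)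
    then show "(\<lambda>n. 2 * C * ((\<eta> n / p n) * (\<eta> n / p n) * (?W n + ?B n))) \<in> o(\<lambda>n. \<eta> n powr (2 * \<theta>))"
    proof (intro smallo_cmult, elim bigo_powr_smallo)
      show "2 * \<theta> < \<tau> + \<tau> + 2 * \<theta>" using \<tau> by linarith
    qed
    have "(\<lambda>n. \<eta> n * (\<eta> n / p n)) \<in> O(\<lambda>n. \<eta> n powr (1 + \<tau>))"
      by (intro bigo_powr_mult \<eta>_over_p_bigo \<eta>_bigo)
    then show "(\<lambda>n. 2 * C * (\<eta> n * (\<eta> n / p n))) \<in> o(\<lambda>n. \<eta> n powr (2 * \<theta>))"
    proof (intro smallo_cmult, elim bigo_powr_smallo)
      show "2 * \<theta> < 1 + \<tau>" using \<tau> \<theta> by linarith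
    qed
  qed
  show ?thesis
    by (rule tracks_smallo[OF tracks_p _ rec' y]) (use \<theta> in \<open>auto intro!: always_eventually msq_nonneg\<close>)
qed

lemma mart_msq: "(\<lambda>n. msq M (mart n)) \<in> O(\<lambda>n. \<eta> n powr 1)"
proof -
  obtain C0 where C0: "0 \<le> C0" "\<And>n. n \<ge> 1 \<Longrightarrow> msq M (noise n) \<le> C0"
    using noise_bounds by metis
  define C where "C = (onorm ((*v) P))\<^sup>2 * C0 / \<mu>"
  have rec: "\<forall>\<^sub>F n in sequentially. msq M (mart (Suc n)) \<le> (1 - \<mu> * \<eta> n) * msq M (mart n) + \<mu> * \<eta> n * (C * \<eta> n)"
    using contraction
  proof eventually_elim
    case (elim n)
    then have n: "n \<ge> 1" by simp
    have [measurable]: "mart n \<in> borel_measurable (past n)" by (rule mart_past[OF n])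
    have m: "(\<lambda>w. L n (mart n w)) \<in> borel_measurable (past n)" unfolding L_def by measurable
    have "msq M (mart (Suc n)) = msq M (\<lambda>w. L n (mart n w) + \<eta> n *\<^sub>R (P *v noise n w))"
      by (rule msq_cong) (use n in simp)
    also have "\<dots> = msq M (\<lambda>w. L n (mart n w)) + (\<eta> n)\<^sup>2 * msq M (\<lambda>w. P *v noise n w)"
      by (rule msq_add_noise[OF n m sq_int_L[OF mart_sq[OF n]]])
    also have "msq M (\<lambda>w. L n (mart n w)) \<le> (1 - \<mu> * \<eta> n) * msq M (mart n)"
      using msq_L_step[of n "mart n" "\<lambda>w. 0"] elim mart_sq[OF n] P_mart sq_int_const[of "0::real^'d"]
      by (simp add: msq_def)
    also have "(\<eta> n)\<^sup>2 * msq M (\<lambda>w. P *v noise n w) \<le> (\<eta> n)\<^sup>2 * ((onorm ((*v) P))\<^sup>2 * C0)"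
      by (intro mult_left_mono order_trans[OF msq_matrix_le[OF noise_sq[OF n]]] C0 n) auto
    finally show ?case using \<mu> by (simp add: C_def power2_eq_square mult_ac)
  qed
  have y: "(\<lambda>n. C * \<eta> n) \<in> O(\<lambda>n. \<eta> n powr 1)" using \<eta>_bigo by (cases "C = 0") auto
  show ?thesis
    by (rule tracks_bigo[OF tracks_\<mu> _ rec y]) (use k in \<open>auto intro!: always_eventually msq_nonneg\<close>)
qed

lemma rest_msq: "(\<lambda>n. msq M (rest n)) \<in> o(\<lambda>n. \<eta> n powr (2 * \<theta>))"
proof -
  define K where "K = (onorm ((*v) (P ** S)))\<^sup>2"
  have rec: "\<forall>\<^sub>F n in sequentially. msq M (rest (Suc n)) \<le> (1 - \<mu> * \<eta> n) * msq M (rest n) + \<mu> * \<eta> n * (K / \<mu>\<^sup>2 * msq M (res n))"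
    using contraction
  proof eventually_elim
    case (elim n)
    then have n: "n \<ge> 1" by simp
    have "msq M (rest (Suc n)) = msq M (\<lambda>w. L n (rest n w) - \<eta> n *\<^sub>R ((P ** S) *v res n w))"
      unfolding matrix_vector_mul_assoc[symmetric] by (rule msq_cong) (rule rest_Suc[OF n])
    also have "\<dots> \<le> (1 - \<mu> * \<eta> n) * msq M (rest n) + \<mu> * \<eta> n * (msq M (\<lambda>w. (P ** S) *v res n w) / \<mu>\<^sup>2)"
      using elim by (intro msq_L_step rest_sq P_rest sq_int_matrix res_sq n) auto
    also have "\<dots> \<le> (1 - \<mu> * \<eta> n) * msq M (rest n) + \<mu> * \<eta> n * ((K * msq M (res n)) / \<mu>\<^sup>2)"
      unfolding K_def using elim \<mu>
      by (intro add_left_mono mult_left_mono divide_right_mono msq_matrix_le res_sq n) auto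
    finally show ?case by simp
  qed
  have y: "(\<lambda>n. K / \<mu>\<^sup>2 * msq M (res n)) \<in> o(\<lambda>n. \<eta> n powr (2 * \<theta>))"
    using res_msq by (cases "K / \<mu>\<^sup>2 = 0") auto
  have "2 * \<theta> \<le> 2 * real k" using \<theta> k by linarith
  then show ?thesis
    by (intro tracks_smallo[OF tracks_\<mu> _ rec y]) (use \<theta> in \<open>auto intro!: always_eventually msq_nonneg\<close>)
qed

subsection \<open>Bias and fluctuation of the coefficient \<open>k\<close>\<close>

text \<open>Inserting \<eta>^(k * \<tau>) times m into the recursion leaves the equation for m at
  order \<eta>^(1 + k * \<tau>). Its scalar shift comes from the decay of \<eta>^(k * \<tau>)
  itself, which reaches that order only for \<alpha> = 1.\<close>

lemma drift_asymp:
  assumes m: "P *v m = m"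
    "P *v (S *v m) - (of_bool (\<alpha> = 1) * (real k * \<tau>) / eta0) *\<^sub>R m = - ((- 1 / \<gamma>) ^ k) *\<^sub>R w0"
  shows "(\<lambda>n. norm (drift n - \<eta> n powr (real k * \<tau>) *\<^sub>R m)) \<in> o(\<lambda>n. \<eta> n powr (real k * \<tau>))"
proof -
  define s where "s n = \<eta> n powr (real k * \<tau>)" for n
  define c where "c = of_bool (\<alpha> = 1) * (real k * \<tau>) / eta0"
  define d where "d n = mcoef n k - (- 1 / \<gamma>) ^ k * s n" for n
  define e where "e n = s n - s (Suc n) - c * \<eta> n * s n" for n
  define y where "y n = (norm m * (\<bar>e n\<bar> / \<eta> n) + norm w0 * \<bar>d n\<bar>) / \<mu>" for n
  have rec: "\<forall>\<^sub>F n in sequentially. norm (drift (Suc n) - s (Suc n) *\<^sub>R m) \<le>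
      (1 - \<mu> * \<eta> n) * norm (drift n - s n *\<^sub>R m) + \<mu> * \<eta> n * y n"
    using contraction
  proof eventually_elim
    case (elim n)
    then have n: "n \<ge> 1" by simp
    have Sm: "P *v (S *v m) = c *\<^sub>R m - ((- 1 / \<gamma>) ^ k) *\<^sub>R w0"
      using m(2) unfolding c_def[symmetric] by (simp add: algebra_simps)
    have "drift (Suc n) - s (Suc n) *\<^sub>R m = L n (drift n - s n *\<^sub>R m) + (e n *\<^sub>R m - (\<eta> n * d n) *\<^sub>R w0)"
      using n by (simp add: L_def lin_simps Sm e_def d_def algebra_simps)
    then have "norm (drift (Suc n) - s (Suc n) *\<^sub>R m) = norm (L n (drift n - s n *\<^sub>R m) + (e n *\<^sub>R m - (\<eta> n * d n) *\<^sub>R w0))"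
      by (rule arg_cong)
    then have "norm (drift (Suc n) - s (Suc n) *\<^sub>R m) \<le> norm (L n (drift n - s n *\<^sub>R m)) + (norm (e n *\<^sub>R m) + norm ((\<eta> n * d n) *\<^sub>R w0))"
      using norm_triangle_ineq[of "L n (drift n - s n *\<^sub>R m)" "e n *\<^sub>R m - (\<eta> n * d n) *\<^sub>R w0"]
        norm_triangle_ineq4[of "e n *\<^sub>R m" "(\<eta> n * d n) *\<^sub>R w0"] by linarith
    also have "norm (L n (drift n - s n *\<^sub>R m)) \<le> (1 - \<mu> * \<eta> n) * norm (drift n - s n *\<^sub>R m)"
      using elim by (simp add: lin_simps P_drift m)
    also have "norm (e n *\<^sub>R m) + norm ((\<eta> n * d n) *\<^sub>R w0) = \<mu> * \<eta> n * y n"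
      using elim \<mu> by (simp add: y_def abs_mult field_simps)
    finally show ?case by simp
  qed
  have y: "y \<in> o(s)"
  proof -
    have "e \<in> o(\<lambda>n. \<eta> n * s n)"
      unfolding e_def s_def c_def by (rule \<eta>_powr_diff_smallo)
    then have "(\<lambda>n. \<bar>e n\<bar> * (1 / \<eta> n)) \<in> o(\<lambda>n. \<eta> n * s n * (1 / \<eta> n))"
      by (intro landau_o.small_big_mult) auto
    also have "o(\<lambda>n. \<eta> n * s n * (1 / \<eta> n)) = o(s)"
      by (intro landau_o.small.cong) (use ev_\<eta>_pos in \<open>eventually_elim; simp\<close>)
    finally have 1: "(\<lambda>n. \<bar>e n\<bar> / \<eta> n) \<in> o(s)" by simp
    have 2: "(\<lambda>n. \<bar>d n\<bar>) \<in> o(s)" unfolding d_def s_def using mcoef_asymp[of k] by simp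
    have "(\<lambda>n. 1 / \<mu> * (norm m * (\<bar>e n\<bar> / \<eta> n) + norm w0 * \<bar>d n\<bar>)) \<in> o(s)"
      by (intro smallo_cmult sum_in_smallo 1 2)
    then show ?thesis by (simp add: y_def[abs_def])
  qed
  have "real k * \<tau> \<le> real k * 2" using \<tau> by (intro mult_left_mono) auto
  then show ?thesis unfolding s_def
    by (intro tracks_smallo[OF tracks_\<mu> _ rec[unfolded s_def] y[unfolded s_def]])
       (use \<tau> in \<open>auto intro!: always_eventually\<close>)
qed

section \<open>Covariances between coefficients and the fluctuation of the error\<close>

definition dcoef :: "nat \<Rightarrow> 'a \<Rightarrow> nat \<Rightarrow> real" where
  "dcoef n w i = coef n w i - mcoef n i"

lemma dcoef_sq: "n \<ge> 1 \<Longrightarrow> sq_int M (\<lambda>w. dcoef n w i)"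
  unfolding dcoef_def by (intro sq_int_diff coef_sq sq_int_const)

lemma dcoef_msq: "(\<lambda>n. msq M (\<lambda>w. dcoef n w i)) \<in> O(\<lambda>n. \<eta> n powr (2 * real i * \<tau>))"
proof -
  have "(\<lambda>n. mcoef n i * mcoef n i) \<in> O(\<lambda>n. \<eta> n powr (real i * \<tau> + real i * \<tau>))"
    by (intro bigo_powr_mult mcoef_bigo)
  then have m: "(\<lambda>n. (mcoef n i)\<^sup>2) \<in> O(\<lambda>n. \<eta> n powr (2 * real i * \<tau>))"
    by (simp add: power2_eq_square algebra_simps)
  have "\<forall>\<^sub>F n in sequentially. norm (msq M (\<lambda>w. dcoef n w i)) \<le> 1 * norm (2 * msq M (\<lambda>w. coef n w i) + 2 * (mcoef n i)\<^sup>2)"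
    using eventually_ge_at_top[of 1]
  proof eventually_elim
    case (elim n)
    have "msq M (\<lambda>w. dcoef n w i) \<le> 2 * msq M (\<lambda>w. coef n w i) + 2 * msq M (\<lambda>w. mcoef n i)"
      unfolding dcoef_def using elim by (intro msq_diff_le coef_sq sq_int_const)
    then show ?case by (simp add: msq_nonneg msq_def[of M "\<lambda>w. mcoef n i"] prob_space)
  qed
  then have "(\<lambda>n. msq M (\<lambda>w. dcoef n w i)) \<in> O(\<lambda>n. 2 * msq M (\<lambda>w. coef n w i) + 2 * (mcoef n i)\<^sup>2)"
    by (rule bigoI)
  also have "(\<lambda>n. 2 * msq M (\<lambda>w. coef n w i) + 2 * (mcoef n i)\<^sup>2) \<in> O(\<lambda>n. \<eta> n powr (2 * real i * \<tau>))"
    using m coef_msq[of i] by (intro sum_in_bigo) auto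
  finally show ?thesis .
qed

text \<open>The index k is what the mean square of \<open>fluct\<close> requires; the lower ones are
  there to close the recursion.\<close>

definition cross :: "nat \<Rightarrow> nat \<Rightarrow> real^'d" where
  "cross i n = expectation (\<lambda>w. dcoef n w i *\<^sub>R fluct n w)"

lemma cross_integrable: "n \<ge> 1 \<Longrightarrow> integrable M (\<lambda>w. dcoef n w i *\<^sub>R fluct n w)"
  by (intro sq_int_scaleR_integrable dcoef_sq fluct_sq)

lemma P_cross: "P *v cross i n = cross i n" if "n \<ge> 1"
proof -
  have "P *v cross i n = expectation (\<lambda>w. P *v (dcoef n w i *\<^sub>R fluct n w))"
    unfolding cross_def
    by (intro integral_bounded_linear[symmetric] matrix_vector_mul_bounded_linear cross_integrable that)
  then show ?thesis by (simp add: lin_simps P_fluct cross_def)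
qed

lemma L_cross: "n \<ge> 1 \<Longrightarrow> expectation (\<lambda>w. dcoef n w i *\<^sub>R L n (fluct n w)) = L n (cross i n)"
proof -
  assume n: "n \<ge> 1"
  have "bounded_linear (L n)"
    unfolding L_def
    by (intro bounded_linear_intros matrix_vector_mul_bounded_linear
        bounded_linear_compose[OF matrix_vector_mul_bounded_linear])
  from integral_bounded_linear[OF this cross_integrable[OF n]]
  show ?thesis by (simp add: cross_def L_scaleR)
qed

text \<open>Since \<open>fluct (Suc n)\<close> is known before the coin of step n, that coin only
  multiplies by 1 - p. This is the decorrelation: the coefficient is reset while the error keeps its
  memory.\<close>

lemma cross_Suc:
  assumes n: "n \<ge> 1"
  shows "cross (Suc i) (Suc n) = (1 - p n) *\<^sub>R (L n (cross (Suc i) n) - \<eta> n *\<^sub>R L n (cross i n)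
     - (\<eta> n * expectation (\<lambda>w. (dcoef n w (Suc i) - \<eta> n * dcoef n w i) *\<^sub>R dcoef n w k)) *\<^sub>R w0)"
proof -
  let ?F = "fluct (Suc n)" and ?f = "\<lambda>w. coef n w (Suc i) - \<eta> n * coef n w i"
    and ?d = "\<lambda>w. dcoef n w (Suc i) - \<eta> n * dcoef n w i"
  define c where "c = mcoef n (Suc i) - \<eta> n * mcoef n i"
  have Fsq: "sq_int M ?F" by (rule fluct_sq) simp
  have fsq: "sq_int M ?f" by (intro sq_int_diff sq_int_times coef_sq n)
  have dsq: "sq_int M ?d" by (intro sq_int_diff sq_int_times dcoef_sq n)
  have [measurable]: "?F \<in> borel_measurable (past_half n)" "(\<lambda>w. coef n w j) \<in> borel_measurable (past_half n)" for j
    by (rule past_imp_half[OF fluct_past'[OF n]], rule past_imp_half[OF coef_past[OF n]])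
  have fF: "integrable M (\<lambda>w. ?f w *\<^sub>R ?F w)" by (intro sq_int_scaleR_integrable fsq Fsq)
  have coin: "integrable M (\<lambda>w. if \<omega> n w then 0 else ?f w *\<^sub>R ?F w)"
    "expectation (\<lambda>w. if \<omega> n w then 0 else ?f w *\<^sub>R ?F w) = (1 - p n) *\<^sub>R expectation (\<lambda>w. ?f w *\<^sub>R ?F w)"
    by (rule expectation_coin[OF n _ fF], measurable)+
  \<comment> \<open>The new mean is (1 - p) * c, so after the coin is integrated out both terms
    share the factor 1 - p and combine into the difference \<open>?d\<close> of deviations from the
    means.\<close>
  have "cross (Suc i) (Suc n) = expectation (\<lambda>w. (if \<omega> n w then 0 else ?f w *\<^sub>R ?F w) - ((1 - p n) * c) *\<^sub>R ?F w)"
    unfolding cross_def dcoef_def coef_Suc[OF n] mcoef_Suc[OF n] c_def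
    by (intro Bochner_Integration.integral_cong refl) (auto simp: algebra_simps simp del: fluct.simps)
  also have "\<dots> = (1 - p n) *\<^sub>R expectation (\<lambda>w. ?f w *\<^sub>R ?F w) - ((1 - p n) * c) *\<^sub>R expectation ?F"
    using coin sq_int_integrable[OF Fsq] by (simp del: fluct.simps)
  also have "\<dots> = (1 - p n) *\<^sub>R expectation (\<lambda>w. ?f w *\<^sub>R ?F w - c *\<^sub>R ?F w)"
    using fF sq_int_integrable[OF Fsq] by (simp add: scaleR_diff_right del: fluct.simps)
  also have "(\<lambda>w. ?f w *\<^sub>R ?F w - c *\<^sub>R ?F w) = (\<lambda>w. ?d w *\<^sub>R ?F w)"
    by (auto simp: dcoef_def c_def algebra_simps simp del: fluct.simps)
  also have "\<dots> = (\<lambda>w. (dcoef n w (Suc i) *\<^sub>R L n (fluct n w) - \<eta> n *\<^sub>R (dcoef n w i *\<^sub>R L n (fluct n w)))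
      - \<eta> n *\<^sub>R ((?d w *\<^sub>R dcoef n w k) *\<^sub>R w0))"
    using n by (simp add: fun_eq_iff dcoef_def[of _ _ k, symmetric] scaleR_diff_right scaleR_diff_left mult.assoc mult.left_commute)
  also have "expectation \<dots> = L n (cross (Suc i) n) - \<eta> n *\<^sub>R L n (cross i n)
      - \<eta> n *\<^sub>R (expectation (\<lambda>w. ?d w *\<^sub>R dcoef n w k) *\<^sub>R w0)"
  proof -
    have i1: "integrable M (\<lambda>w. dcoef n w j *\<^sub>R L n (fluct n w))" for j
      by (intro sq_int_scaleR_integrable dcoef_sq sq_int_L fluct_sq n)
    have i2: "integrable M (\<lambda>w. ?d w *\<^sub>R dcoef n w k)"
      by (intro sq_int_scaleR_integrable dsq dcoef_sq n)
    have diff: "expectation (\<lambda>w. (A w - B w) - C w) = expectation A - expectation B - expectation C"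
      if "integrable M A" "integrable M B" "integrable M C" for A B C :: "'a \<Rightarrow> real^'d"
      using that by simp
    have e1: "expectation (\<lambda>w. \<eta> n *\<^sub>R (dcoef n w i *\<^sub>R L n (fluct n w))) = \<eta> n *\<^sub>R L n (cross i n)"
      by (simp only: Bochner_Integration.integral_scaleR_right L_cross[OF n])
    have e2: "expectation (\<lambda>w. \<eta> n *\<^sub>R ((?d w *\<^sub>R dcoef n w k) *\<^sub>R w0)) =
        \<eta> n *\<^sub>R (expectation (\<lambda>w. ?d w *\<^sub>R dcoef n w k) *\<^sub>R w0)"
      by (simp only: Bochner_Integration.integral_scaleR_right integral_scaleR_left[OF i2])
    show ?thesis
      by (subst diff) (simp_all only: e1 e2 L_cross[OF n] i1 i2 integrable_scaleR_right integrable_scaleR_left)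
  qed
  finally show ?thesis by simp
qed

text \<open>Level i + 1 is driven by \<eta> times level i and \<eta> times covariances among
  coefficients, both forgotten at rate p, so the exponent rises by \<tau> per level. Level 0
  vanishes since \<open>coef n w 0\<close> is deterministic.\<close>

lemma cross_bigo: "(\<lambda>n. norm (cross i n)) \<in> O(\<lambda>n. \<eta> n powr (real (k + i + 1) * \<tau>))"
proof (induction i)
  case 0
  have "cross 0 n = 0" for n by (simp add: cross_def dcoef_def)
  then show ?case by simp
next
  case (Suc i)
  \<comment> \<open>The weight in Young's inequality: it brings the mean squares, of exponents 2 *
    (i + 1) * \<tau> and 2 * k * \<tau>, to the common exponent (k + i + 1) * \<tau>.\<close>
  define s where "s n = \<eta> n powr ((real k - real (Suc i)) * \<tau>)" for n
  define d where "d n w = dcoef n w (Suc i) - \<eta> n * dcoef n w i" for n w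
  define b where "b n = s n * msq M (d n) + msq M (\<lambda>w. dcoef n w k) / s n" for n
  have dsq: "n \<ge> 1 \<Longrightarrow> sq_int M (d n)" for n
    unfolding d_def[abs_def] by (intro sq_int_diff sq_int_times dcoef_sq)
  let ?y = "\<lambda>n. (\<eta> n / p n) * (norm (cross i n) + norm w0 * b n)"
  have rec: "\<forall>\<^sub>F n in sequentially. norm (cross (Suc i) (Suc n)) \<le>
      (1 - 1 * \<gamma> * \<eta> n powr \<beta>) * norm (cross (Suc i) n) + 1 * \<gamma> * \<eta> n powr \<beta> * ?y n"
    using ev_p contraction
  proof eventually_elim
    case (elim n)
    then have n: "n \<ge> 1" by simp
    have Lle: "norm (L n z) \<le> norm z" if "P *v z = z" for z
    proof -
      have "norm (L n z) \<le> (1 - \<mu> * \<eta> n) * norm z" using elim that by blast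
      also have "\<dots> \<le> 1 * norm z" using elim \<mu> by (intro mult_right_mono) auto
      finally show ?thesis by simp
    qed
    define B where "B = expectation (\<lambda>w. d n w *\<^sub>R dcoef n w k)"
    have B: "\<bar>B\<bar> \<le> b n"
      unfolding B_def b_def using norm_expectation_scaleR_le[OF dsq[OF n] dcoef_sq[OF n], of "s n" k] elim
      by (simp add: s_def)
    have "norm (cross (Suc i) (Suc n)) = (1 - p n) * norm (L n (cross (Suc i) n) - \<eta> n *\<^sub>R L n (cross i n) - (\<eta> n * B) *\<^sub>R w0)"
      unfolding cross_Suc[OF n] B_def d_def using elim by simp
    also have "\<dots> \<le> (1 - p n) * (norm (L n (cross (Suc i) n)) + norm (\<eta> n *\<^sub>R L n (cross i n)) + norm ((\<eta> n * B) *\<^sub>R w0))"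
    proof (rule mult_left_mono)
      show "norm (L n (cross (Suc i) n) - \<eta> n *\<^sub>R L n (cross i n) - (\<eta> n * B) *\<^sub>R w0)
          \<le> norm (L n (cross (Suc i) n)) + norm (\<eta> n *\<^sub>R L n (cross i n)) + norm ((\<eta> n * B) *\<^sub>R w0)"
        using norm_triangle_ineq4[of "L n (cross (Suc i) n) - \<eta> n *\<^sub>R L n (cross i n)" "(\<eta> n * B) *\<^sub>R w0"]
          norm_triangle_ineq4[of "L n (cross (Suc i) n)" "\<eta> n *\<^sub>R L n (cross i n)"] by linarith
    qed (use elim in simp)
    also have "\<dots> \<le> (1 - p n) * (norm (cross (Suc i) n) + (\<eta> n * norm (cross i n) + \<eta> n * (norm w0 * b n)))"
    proof -
      have "norm (\<eta> n *\<^sub>R L n (cross i n)) \<le> \<eta> n * norm (cross i n)"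
        using elim Lle[OF P_cross[OF n]] by simp
      moreover have "norm ((\<eta> n * B) *\<^sub>R w0) \<le> \<eta> n * (norm w0 * b n)"
        using elim B by (simp add: abs_mult mult.commute mult_right_mono)
      moreover have "norm (L n (cross (Suc i) n)) \<le> norm (cross (Suc i) n)" by (rule Lle[OF P_cross[OF n]])
      ultimately have "norm (L n (cross (Suc i) n)) + norm (\<eta> n *\<^sub>R L n (cross i n)) + norm ((\<eta> n * B) *\<^sub>R w0)
          \<le> norm (cross (Suc i) n) + (\<eta> n * norm (cross i n) + \<eta> n * (norm w0 * b n))" by linarith
      then show ?thesis using elim by (intro mult_left_mono) auto
    qed
    also have "\<dots> \<le> (1 - p n) * norm (cross (Suc i) n) + 1 * (\<eta> n * norm (cross i n) + \<eta> n * (norm w0 * b n))"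
    proof -
      have "0 \<le> b n" using B by linarith
      then have "(1 - p n) * (\<eta> n * norm (cross i n) + \<eta> n * (norm w0 * b n))
          \<le> 1 * (\<eta> n * norm (cross i n) + \<eta> n * (norm w0 * b n))"
        using elim by (intro mult_right_mono) auto
      then show ?thesis unfolding distrib_left[of "1 - p n" "norm (cross (Suc i) n)"] by linarith
    qed
    also have "1 * (\<eta> n * norm (cross i n) + \<eta> n * (norm w0 * b n)) = p n * ?y n"
    proof -
      have "p n \<noteq> 0" using elim by auto
      then show ?thesis by (simp add: distrib_left)
    qed
    finally show ?case using elim by (simp add: mult.commute)
  qed
  have y: "?y \<in> O(\<lambda>n. \<eta> n powr (real (k + Suc i + 1) * \<tau>))"
  proof -
    have d_msq: "(\<lambda>n. msq M (d n)) \<in> O(\<lambda>n. \<eta> n powr (2 * real (Suc i) * \<tau>))"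
    proof -
      have "\<forall>\<^sub>F n in sequentially. norm (msq M (d n)) \<le>
          1 * norm (2 * msq M (\<lambda>w. dcoef n w (Suc i)) + 2 * (\<eta> n * \<eta> n * msq M (\<lambda>w. dcoef n w i)))"
        using eventually_ge_at_top[of 1]
      proof eventually_elim
        case (elim n)
        have "msq M (d n) \<le> 2 * msq M (\<lambda>w. dcoef n w (Suc i)) + 2 * msq M (\<lambda>w. \<eta> n *\<^sub>R dcoef n w i)"
          unfolding d_def[abs_def] real_scaleR_def
          using elim by (intro msq_diff_le dcoef_sq sq_int_times)
        then show ?case unfolding msq_scaleR by (simp add: msq_nonneg power2_eq_square)
      qed
      then have "(\<lambda>n. msq M (d n)) \<in> O(\<lambda>n. 2 * msq M (\<lambda>w. dcoef n w (Suc i)) + 2 * (\<eta> n * \<eta> n * msq M (\<lambda>w. dcoef n w i)))"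
        by (rule bigoI)
      also have "(\<lambda>n. 2 * msq M (\<lambda>w. dcoef n w (Suc i)) + 2 * (\<eta> n * \<eta> n * msq M (\<lambda>w. dcoef n w i)))
          \<in> O(\<lambda>n. \<eta> n powr (2 * real (Suc i) * \<tau>))"
      proof (intro sum_in_bigo)
        have "(\<lambda>n. \<eta> n * \<eta> n * msq M (\<lambda>w. dcoef n w i)) \<in> O(\<lambda>n. \<eta> n powr (1 + 1 + 2 * real i * \<tau>))"
          by (intro bigo_powr_mult \<eta>_bigo dcoef_msq)
        then have "(\<lambda>n. \<eta> n * \<eta> n * msq M (\<lambda>w. dcoef n w i)) \<in> O(\<lambda>n. \<eta> n powr (2 * real (Suc i) * \<tau>))"
          by (rule bigo_powr_weaken) (use \<tau> in \<open>simp add: algebra_simps\<close>)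
        then show "(\<lambda>n. 2 * (\<eta> n * \<eta> n * msq M (\<lambda>w. dcoef n w i))) \<in> O(\<lambda>n. \<eta> n powr (2 * real (Suc i) * \<tau>))"
          by simp
      qed (use dcoef_msq[of "Suc i"] in simp)
      finally show ?thesis .
    qed
    have "(\<lambda>n. s n * msq M (d n)) \<in> O(\<lambda>n. \<eta> n powr ((real k - real (Suc i)) * \<tau> + 2 * real (Suc i) * \<tau>))"
      unfolding s_def by (intro bigo_powr_mult d_msq) auto
    moreover have "(real k - real (Suc i)) * \<tau> + 2 * real (Suc i) * \<tau> = real (k + i + 1) * \<tau>"
      by (simp add: algebra_simps)
    ultimately have 1: "(\<lambda>n. s n * msq M (d n)) \<in> O(\<lambda>n. \<eta> n powr (real (k + i + 1) * \<tau>))" by metis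
    have "(\<lambda>n. msq M (\<lambda>w. dcoef n w k) * \<eta> n powr (- ((real k - real (Suc i)) * \<tau>)))
        \<in> O(\<lambda>n. \<eta> n powr (2 * real k * \<tau> + - ((real k - real (Suc i)) * \<tau>)))"
      by (intro bigo_powr_mult dcoef_msq) auto
    moreover have "2 * real k * \<tau> + - ((real k - real (Suc i)) * \<tau>) = real (k + i + 1) * \<tau>"
      by (simp add: algebra_simps)
    moreover have "(\<lambda>n. msq M (\<lambda>w. dcoef n w k) * \<eta> n powr (- ((real k - real (Suc i)) * \<tau>))) =
        (\<lambda>n. msq M (\<lambda>w. dcoef n w k) / s n)"
      unfolding s_def by (simp only: powr_minus divide_inverse)
    ultimately have 2: "(\<lambda>n. msq M (\<lambda>w. dcoef n w k) / s n) \<in> O(\<lambda>n. \<eta> n powr (real (k + i + 1) * \<tau>))"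
      by metis
    have "b \<in> O(\<lambda>n. \<eta> n powr (real (k + i + 1) * \<tau>))" unfolding b_def by (intro sum_in_bigo 1 2)
    then have "(\<lambda>n. norm w0 * b n) \<in> O(\<lambda>n. \<eta> n powr (real (k + i + 1) * \<tau>))"
      by (cases "norm w0 = 0") auto
    then have "?y \<in> O(\<lambda>n. \<eta> n powr (\<tau> + real (k + i + 1) * \<tau>))"
      by (intro bigo_powr_mult \<eta>_over_p_bigo sum_in_bigo Suc)
    moreover have "\<tau> + real (k + i + 1) * \<tau> = real (k + Suc i + 1) * \<tau>" by (simp add: algebra_simps)
    ultimately show ?thesis by metis
  qed
  show ?case by (rule tracks_bigo[OF tracks_p _ rec y]) (use \<tau> in \<open>auto intro!: always_eventually\<close>)
qed

text \<open>The square is expanded exactly instead of being estimated by convexity, to keep the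
  cross term as a covariance. That term has exponent (2k + 1) * \<tau>, hence one \<tau> more than
  required, and the squared input carries an additional \<eta>.\<close>

lemma fluct_msq: "(\<lambda>n. msq M (fluct n)) \<in> o(\<lambda>n. \<eta> n powr (2 * real k * \<tau>))"
proof -
  let ?B = "\<lambda>n. msq M (\<lambda>w. dcoef n w k)"
  let ?y = "\<lambda>n. 2 * norm w0 / \<mu> * norm (cross k n) + (norm w0)\<^sup>2 / \<mu> * (\<eta> n * ?B n)"
  have rec: "\<forall>\<^sub>F n in sequentially. msq M (fluct (Suc n)) \<le> (1 - \<mu> * \<eta> n) * msq M (fluct n) + \<mu> * \<eta> n * ?y n"
    using contraction
  proof eventually_elim
    case (elim n)
    then have n: "n \<ge> 1" by simp
    have i1: "integrable M (\<lambda>w. dcoef n w k *\<^sub>R L n (fluct n w))"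
      by (intro sq_int_scaleR_integrable dcoef_sq sq_int_L fluct_sq n)
    have i0: "integrable M (\<lambda>w. (norm (L n (fluct n w)))\<^sup>2)"
      using sq_int_L[OF fluct_sq[OF n], of n] by (simp add: sq_int_def)
    have "msq M (fluct (Suc n)) = expectation (\<lambda>w. (norm (L n (fluct n w)))\<^sup>2
        - 2 * \<eta> n * ((dcoef n w k *\<^sub>R L n (fluct n w)) \<bullet> w0) + (\<eta> n)\<^sup>2 * (norm w0)\<^sup>2 * (norm (dcoef n w k))\<^sup>2)"
    proof -
      have e: "fluct (Suc n) w = L n (fluct n w) - (\<eta> n * dcoef n w k) *\<^sub>R w0" for w
        using n by (simp add: dcoef_def)
      show ?thesis unfolding msq_def
        by (simp only: e norm_diff_scaleR_sq)
    qed
    also have "\<dots> = msq M (\<lambda>w. L n (fluct n w)) - 2 * \<eta> n * (L n (cross k n) \<bullet> w0) + (\<eta> n)\<^sup>2 * (norm w0)\<^sup>2 * ?B n"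
    proof -
      have "expectation (\<lambda>w. (dcoef n w k *\<^sub>R L n (fluct n w)) \<bullet> w0) = L n (cross k n) \<bullet> w0"
        unfolding L_cross[OF n, symmetric] by (rule Bochner_Integration.integral_inner_left) (rule i1)
      moreover have "expectation (\<lambda>w. A w - c * B w + c' * C w) = expectation A - c * expectation B + c' * expectation C"
        if "integrable M A" "integrable M B" "integrable M C" for A B C :: "'a \<Rightarrow> real" and c c'
        using that by simp
      ultimately show ?thesis
        using integrable_inner_left[OF i1, of w0] sq_int_norm_sq[OF dcoef_sq[OF n, of k]]
        unfolding msq_def by (simp only: i0)
    qed
    also have "\<dots> \<le> (1 - \<mu> * \<eta> n) * msq M (fluct n) + 2 * \<eta> n * (norm (cross k n) * norm w0) + (\<eta> n)\<^sup>2 * (norm w0)\<^sup>2 * ?B n"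
    proof -
      have "msq M (\<lambda>w. L n (fluct n w)) \<le> (1 - \<mu> * \<eta> n) * msq M (fluct n)"
        using msq_L_step[of n "fluct n" "\<lambda>w. 0"] elim fluct_sq[OF n] P_fluct sq_int_const[of "0::real^'d"]
        by (simp add: msq_def)
      moreover have "- (L n (cross k n) \<bullet> w0) \<le> norm (cross k n) * norm w0"
      proof -
        have "norm (L n (cross k n)) \<le> (1 - \<mu> * \<eta> n) * norm (cross k n)" using elim P_cross[OF n] by blast
        also have "\<dots> \<le> 1 * norm (cross k n)" using elim \<mu> by (intro mult_right_mono) auto
        finally have "norm (L n (cross k n)) * norm w0 \<le> norm (cross k n) * norm w0" by (intro mult_right_mono) auto
        then show ?thesis using Cauchy_Schwarz_ineq2[of "L n (cross k n)" w0] by linarith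
      qed
      then have "2 * \<eta> n * - (L n (cross k n) \<bullet> w0) \<le> 2 * \<eta> n * (norm (cross k n) * norm w0)"
        using elim by (intro mult_left_mono) auto
      then have "- (2 * \<eta> n * (L n (cross k n) \<bullet> w0)) \<le> 2 * \<eta> n * (norm (cross k n) * norm w0)"
        by (simp only: mult_minus_right)
      ultimately show ?thesis by linarith
    qed
    also have "\<dots> = (1 - \<mu> * \<eta> n) * msq M (fluct n) + \<mu> * \<eta> n * ?y n"
      using \<mu> by (simp add: power2_eq_square field_simps del: fluct.simps)
    finally show ?case .
  qed
  have y: "?y \<in> o(\<lambda>n. \<eta> n powr (2 * real k * \<tau>))"
  proof (intro sum_in_smallo)
    have "(\<lambda>n. norm (cross k n)) \<in> o(\<lambda>n. \<eta> n powr (2 * real k * \<tau>))"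
      using cross_bigo[of k] by (rule bigo_powr_smallo) (use \<tau> in \<open>simp add: algebra_simps\<close>)
    then show "(\<lambda>n. 2 * norm w0 / \<mu> * norm (cross k n)) \<in> o(\<lambda>n. \<eta> n powr (2 * real k * \<tau>))"
      by (cases "w0 = 0") (use \<mu> in auto)
    have "(\<lambda>n. \<eta> n * ?B n) \<in> O(\<lambda>n. \<eta> n powr (1 + 2 * real k * \<tau>))"
      by (intro bigo_powr_mult \<eta>_bigo dcoef_msq)
    then have "(\<lambda>n. \<eta> n * ?B n) \<in> o(\<lambda>n. \<eta> n powr (2 * real k * \<tau>))" by (rule bigo_powr_smallo) simp
    then show "(\<lambda>n. (norm w0)\<^sup>2 / \<mu> * (\<eta> n * ?B n)) \<in> o(\<lambda>n. \<eta> n powr (2 * real k * \<tau>))"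
      by (cases "w0 = 0") (use \<mu> in auto)
  qed
  have "2 * real k * \<tau> \<le> 2 * real k * 1" using \<tau> by (intro mult_left_mono) auto
  then show ?thesis
    by (intro tracks_smallo[OF tracks_\<mu> _ rec y]) (use \<tau> in \<open>auto intro!: always_eventually msq_nonneg\<close>)
qed

end

section \<open>Asymptotic normality of the martingale part\<close>

lemma abs_exp_diff_le:
  fixes a c :: real
  assumes "0 \<le> a" "0 \<le> c"
  shows "\<bar>exp (- a) - exp (- c)\<bar> \<le> \<bar>a - c\<bar>"
proof -
  have *: "exp (- a) - exp (- c) \<le> c - a" if "0 \<le> a" "a \<le> c" for a c :: real
  proof -
    have "exp (- a) - exp (- c) = exp (- a) * (1 - exp (- (c - a)))"
      by (simp add: algebra_simps exp_add[symmetric])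
    also have "\<dots> \<le> 1 * (c - a)"
    proof (rule mult_mono)
      have "1 + - (c - a) \<le> exp (- (c - a))" by (rule exp_ge_add_one_self)
      then show "1 - exp (- (c - a)) \<le> c - a" by linarith
    qed (use that in auto)
    finally show ?thesis by simp
  qed
  show ?thesis
  proof (cases "a \<le> c")
    case True
    then show ?thesis using *[of a c] assms by (simp add: abs_if)
  next
    case False
    then show ?thesis using *[of c a] assms by (simp add: abs_if)
  qed
qed

text \<open>To be used with s = r / 2 and v at most a multiple of |t|^2, so that this remainder
  takes the form |t|^r of the Taylor remainder of the noise.\<close>

lemma exp_minus_taylor_le:
  fixes v s :: real
  assumes v: "0 \<le> v" and s: "1 \<le> s" "s \<le> 2"
  shows "\<bar>(1 - v) - exp (- v)\<bar> \<le> v powr s"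
proof -
  have lo: "1 - v \<le> exp (- v)" using exp_ge_add_one_self[of "- v"] by simp
  have 1: "\<bar>(1 - v) - exp (- v)\<bar> \<le> v" using lo v by simp
  have 2: "\<bar>(1 - v) - exp (- v)\<bar> \<le> v\<^sup>2" if "v \<le> 1"
  proof -
    \<comment> \<open>As exp v \<ge> 1 + v, this identity bounds 1 / exp v by 1 - v + v^2.\<close>
    have "(1 - v + v\<^sup>2) * (1 + v) = 1 + v ^ 3" by (simp add: power2_eq_square power3_eq_cube algebra_simps)
    then have "1 \<le> (1 - v + v\<^sup>2) * (1 + v)" using v by simp
    also have "\<dots> \<le> (1 - v + v\<^sup>2) * exp v"
      using that v by (intro mult_left_mono) (auto simp: add_nonneg_nonneg)
    finally have "1 / exp v \<le> 1 - v + v\<^sup>2" by (simp add: pos_divide_le_eq)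
    then show ?thesis using lo by (simp add: exp_minus field_simps)
  qed
  show ?thesis
  proof (cases "v \<le> 1")
    case True
    have "v\<^sup>2 \<le> v powr s"
    proof (cases "v = 0")
      case False
      then have "v powr 2 \<le> v powr s" using True v s by (intro powr_mono') auto
      then show ?thesis using False v by (simp add: powr_numeral)
    qed simp
    then show ?thesis using 2[OF True] by linarith
  next
    case False
    then have "v powr 1 \<le> v powr s" using s by (intro powr_mono) auto
    then show ?thesis using 1 False by simp
  qed
qed

text \<open>Covariances enter through their quadratic forms only, and the Lyapunov equation is
  tested on vectors t in the range of P; this is all that characteristic functions see.\<close>

locale lpsa_clt = lpsa M D \<zeta> \<omega> p \<eta> eta0 \<alpha> S P b xstar x1 k \<mu> \<gamma> \<beta> q g x
  for M :: "'a measure" and D :: "'z measure" and \<zeta> \<omega> p \<eta> eta0 \<alpha>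
    and S P :: "real^'d^'d" and b xstar x1 k \<mu> \<gamma> \<beta> q g x +
  fixes \<Sigma> :: "real^'d \<Rightarrow> real^'d^'d" and \<Sigma>t :: "real^'d^'d"
  assumes \<Sigma>_quad: "\<And>y t. integrable D (\<lambda>z. (t \<bullet> ((S *v y - b) - g y z))\<^sup>2)"
      "\<And>y t. (\<integral>z. (t \<bullet> ((S *v y - b) - g y z))\<^sup>2 \<partial>D) = t \<bullet> (\<Sigma> y *v t)"
    and \<Sigma>_lip: "\<exists>C. \<forall>y t. \<bar>t \<bullet> (\<Sigma> y *v t) - t \<bullet> (\<Sigma> xstar *v t)\<bar> \<le> C * norm (y - xstar) * (norm t)\<^sup>2"
    and \<Sigma>t: "psd \<Sigma>t" "P ** \<Sigma>t = \<Sigma>t"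
    and lyapunov: "\<And>t. P *v t = t \<Longrightarrow>
      2 * ((P *v (S *v t)) \<bullet> (\<Sigma>t *v t)) - of_bool (\<alpha> = 1) / eta0 * (t \<bullet> (\<Sigma>t *v t)) = t \<bullet> (\<Sigma> xstar *v t)"
begin

definition char_mart :: "nat \<Rightarrow> real^'d \<Rightarrow> complex" where
  "char_mart n t = expectation (\<lambda>w. cis (t \<bullet> mart n w))"

text \<open>The characteristic function of the centred normal law with covariance
  \<open>\<eta> n\<close> times \<open>\<Sigma>t\<close>.\<close>

definition char_gauss :: "nat \<Rightarrow> real^'d \<Rightarrow> real" where
  "char_gauss n t = exp (- (\<eta> n * (t \<bullet> (\<Sigma>t *v t)) / 2))"

lemma h_sq: "integrable D (\<lambda>z. (t \<bullet> h y z)\<^sup>2)" "(\<integral>z. (t \<bullet> h y z)\<^sup>2 \<partial>D) = t \<bullet> (\<Sigma> y *v t)"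
  using \<Sigma>_quad unfolding h_def by auto

lemma \<Sigma>_nonneg: "0 \<le> t \<bullet> (\<Sigma> y *v t)"
  unfolding h_sq(2)[symmetric] by (intro Bochner_Integration.integral_nonneg) simp

lemma \<Sigma>t_nonneg: "0 \<le> t \<bullet> (\<Sigma>t *v t)"
  using \<Sigma>t by (simp add: psd_def)

lemma expectation_cis_sample:
  assumes n: "n \<ge> 1" and G: "G \<in> borel_measurable (borel \<Otimes>\<^sub>M D)"
    and int: "integrable M (\<lambda>w. G (x n w, \<zeta> n w))"
  shows "expectation (\<lambda>w. cis (s \<bullet> mart n w) * of_real (G (x n w, \<zeta> n w)))
    = expectation (\<lambda>w. cis (s \<bullet> mart n w) * of_real (\<integral>z. G (x n w, z) \<partial>D))"
proof -
  let ?\<phi> = "\<lambda>((y, u), z). cis (s \<bullet> y) * complex_of_real (G (u, z))"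
  have X: "(\<lambda>w. (mart n w, x n w)) \<in> measurable (past n) (borel \<Otimes>\<^sub>M borel)"
    using mart_past[OF n] x_past[OF n] by measurable
  have [measurable]: "(\<lambda>q. G (snd (fst q), snd q)) \<in> borel_measurable ((borel \<Otimes>\<^sub>M borel) \<Otimes>\<^sub>M D)"
    using measurable_compose[OF _ G, of "\<lambda>q. (snd (fst q), snd q)" "(borel \<Otimes>\<^sub>M borel) \<Otimes>\<^sub>M D"] by simp
  have \<phi>: "?\<phi> \<in> borel_measurable ((borel \<Otimes>\<^sub>M borel) \<Otimes>\<^sub>M D)"
    unfolding case_prod_beta' by measurable
  have [measurable]: "mart n \<in> borel_measurable M" "(\<lambda>w. G (x n w, \<zeta> n w)) \<in> borel_measurable M"
    using mart_sq[OF n] int by auto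
  have int': "integrable M (\<lambda>w. ?\<phi> ((mart n w, x n w), \<zeta> n w))"
    by (rule Bochner_Integration.integrable_bound[OF int]) (auto simp: norm_mult)
  have "expectation (\<lambda>w. ?\<phi> ((mart n w, x n w), \<zeta> n w)) = expectation (\<lambda>w. \<integral>z. ?\<phi> ((mart n w, x n w), z) \<partial>D)"
    by (rule expectation_sample[OF n X \<phi> int'])
  then show ?thesis by (simp add: integral_complex_of_real)
qed

text \<open>Convergence of the whole iterate, not only of its projection, so that the covariance of
  the noise at \<open>x n\<close> can be replaced by that at \<open>xstar\<close>. By Lipschitz
  continuity the first absolute moment is enough.\<close>

lemma x_conv: "(\<lambda>n. expectation (\<lambda>w. norm (x n w - xstar))) \<longlonglongrightarrow> 0"
proof -
  have to0: "f \<longlonglongrightarrow> 0" if "f \<in> O(\<lambda>n. \<eta> n powr a)" "0 < a" for f a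
  proof -
    have "f \<in> o(\<lambda>n. \<eta> n powr 0)" using that by (rule bigo_powr_smallo)
    then have "(\<lambda>n. f n / \<eta> n powr 0) \<longlonglongrightarrow> 0" by (rule smalloD_tendsto)
    then show ?thesis by (rule Lim_transform_eventually) (use ev_\<eta>_pos in \<open>eventually_elim; simp\<close>)
  qed
  let ?s = "\<lambda>j n w. \<Sum>i<j. coef n w (Suc i) *\<^sub>R kry i"
  have ssq: "n \<ge> 1 \<Longrightarrow> sq_int M (?s j n)" for j n
    by (intro sq_int_sum sq_int_scaleR_const coef_sq) auto
  \<comment> \<open>Only coefficients of positive index occur, and each is O of a positive power of
    \<eta> in mean square.\<close>
  have s0: "(\<lambda>n. msq M (?s j n)) \<longlonglongrightarrow> 0" for j
  proof (induction j)
    case 0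
    then show ?case by (simp add: msq_def)
  next
    case (Suc j)
    have "(\<lambda>n. msq M (\<lambda>w. coef n w (Suc j))) \<longlonglongrightarrow> 0"
      using coef_msq by (rule to0) (use \<tau> in simp)
    from tendsto_add[OF tendsto_mult_left[OF Suc, of 2] tendsto_mult_left[OF this, of "2 * (norm (kry j))\<^sup>2"]]
    have "(\<lambda>n. 2 * msq M (?s j n) + 2 * (norm (kry j))\<^sup>2 * msq M (\<lambda>w. coef n w (Suc j))) \<longlonglongrightarrow> 0" by simp
    then show ?case
    proof (rule tendsto_sandwich[OF _ _ tendsto_const, rotated 2])
      show "\<forall>\<^sub>F n in sequentially. msq M (?s (Suc j) n) \<le> 2 * msq M (?s j n) + 2 * (norm (kry j))\<^sup>2 * msq M (\<lambda>w. coef n w (Suc j))"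
        using eventually_ge_at_top[of 1]
      proof eventually_elim
        case (elim n)
        have "msq M (?s (Suc j) n) \<le> 2 * msq M (?s j n) + 2 * msq M (\<lambda>w. coef n w (Suc j) *\<^sub>R kry j)"
          using elim by (simp add: msq_add_le ssq sq_int_scaleR_const coef_sq)
        then show ?case by (simp add: msq_scaleR_const)
      qed
    qed (simp add: msq_nonneg)
  qed
  have "(\<lambda>n. msq M (err n) + msq M (res n)) \<longlonglongrightarrow> 0"
    using err_res_msq by (rule to0) (use \<theta> in simp)
  from tendsto_add[OF tendsto_mult_left[OF this, of 4] tendsto_mult_left[OF s0[of k], of 4]]
  have "(\<lambda>n. sqrt (4 * (msq M (err n) + msq M (res n)) + 4 * msq M (?s k n))) \<longlonglongrightarrow> sqrt 0"
    by (intro tendsto_real_sqrt) simp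
  then have lim: "(\<lambda>n. sqrt (4 * (msq M (err n) + msq M (res n)) + 4 * msq M (?s k n))) \<longlonglongrightarrow> 0" by simp
  show ?thesis
  proof (rule tendsto_sandwich[OF _ _ tendsto_const lim])
    show "\<forall>\<^sub>F n in sequentially. expectation (\<lambda>w. norm (x n w - xstar))
        \<le> sqrt (4 * (msq M (err n) + msq M (res n)) + 4 * msq M (?s k n))"
      using eventually_ge_at_top[of 1]
    proof eventually_elim
      case (elim n)
      have xs: "sq_int M (\<lambda>w. x n w - xstar)" by (intro sq_int_diff x_sq sq_int_const elim)
      have "msq M (\<lambda>w. x n w - xstar) \<le> 2 * (2 * msq M (err n) + 2 * msq M (?s k n)) + 2 * msq M (res n)"
        unfolding x_split
        by (intro order_trans[OF msq_add_le] add_right_mono mult_left_mono msq_add_le sq_int_add err_sq ssq res_sq elim) auto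
      also have "\<dots> \<le> 4 * (msq M (err n) + msq M (res n)) + 4 * msq M (?s k n)"
        using msq_nonneg[of M "res n"] by simp
      finally have le: "msq M (\<lambda>w. x n w - xstar) \<le> \<dots>" .
      have ni: "integrable M (\<lambda>w. norm (x n w - xstar))" using sq_int_integrable[OF xs] by simp
      have "0 \<le> variance (\<lambda>w. norm (x n w - xstar))" by (intro Bochner_Integration.integral_nonneg) auto
      then have "(expectation (\<lambda>w. norm (x n w - xstar)))\<^sup>2 \<le> msq M (\<lambda>w. x n w - xstar)"
        using variance_eq[OF ni sq_int_norm_sq[OF xs]] by (simp add: msq_def)
      then show ?case using le by (intro real_le_rsqrt) linarith
    qed
  qed simp
qed

text \<open>Taylor expansion of the exponential of the new noise: the linear term has mean zero
  given the past, the quadratic one yields the covariance at \<open>x n\<close>, replaced by that at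
  \<open>xstar\<close> at the Lipschitz cost, and the remainder is controlled by the r-th
  moment.\<close>

lemma char_mart_Suc:
  assumes n: "n \<ge> 1" and \<eta>n: "0 < \<eta> n" and t: "P *v t = t"
    and C1: "\<And>y t. \<bar>t \<bullet> (\<Sigma> y *v t) - t \<bullet> (\<Sigma> xstar *v t)\<bar> \<le> C1 * norm (y - xstar) * (norm t)\<^sup>2"
    and C2: "integrable M (\<lambda>w. norm (noise n w) powr r)" "expectation (\<lambda>w. norm (noise n w) powr r) \<le> C2"
  shows "norm (char_mart (Suc n) t - char_mart n (L n t) * of_real (1 - (\<eta> n)\<^sup>2 * (t \<bullet> (\<Sigma> xstar *v t)) / 2))
    \<le> (\<eta> n)\<^sup>2 / 2 * C1 * expectation (\<lambda>w. norm (x n w - xstar)) * (norm t)\<^sup>2 + C2 * \<eta> n powr r * norm t powr r"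
proof -
  define a where "a w = L n t \<bullet> mart n w" for w
  define c where "c w = t \<bullet> noise n w" for w
  define e where "e = \<eta> n"
  define R where "R w = cis (e * c w) - (1 + \<i> * of_real (e * c w) - of_real ((e * c w)\<^sup>2) / 2)" for w
  define v where "v w = t \<bullet> (\<Sigma> (x n w) *v t)" for w
  define vs where "vs = t \<bullet> (\<Sigma> xstar *v t)"
  have [measurable]: "noise n \<in> borel_measurable M" "mart n \<in> borel_measurable M" "x n \<in> borel_measurable M"
    using noise_sq[OF n] mart_sq[OF n] x_sq[OF n] by auto
  have am [measurable]: "a \<in> borel_measurable M" and cm [measurable]: "c \<in> borel_measurable M"
    unfolding a_def[abs_def] c_def[abs_def] by measurable
  have csq: "sq_int M c" unfolding c_def[abs_def]
    by (rule sq_int_bound[OF noise_sq[OF n], of _ "norm t"]) (use Cauchy_Schwarz_ineq2 in auto)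
  have c1: "integrable M c" by (rule sq_int_integrable[OF csq])
  have c2: "integrable M (\<lambda>w. (c w)\<^sup>2)" using csq by (simp add: sq_int_def)
  have mult_int: "integrable M (\<lambda>w. cis (a w) * f w)" if "integrable M f" for f :: "'a \<Rightarrow> complex"
    by (rule Bochner_Integration.integrable_bound[OF that]) (use that in \<open>auto simp: norm_mult\<close>)
  have ci: "integrable M (\<lambda>w. cis (f w))" if [measurable]: "f \<in> borel_measurable M" for f
    by (rule integrable_const_bound[of _ 1]) auto
  have arg: "t \<bullet> mart (Suc n) w = a w + e * c w" for w
  proof -
    have "t \<bullet> L n (mart n w) = a w" unfolding a_def by (rule inner_L[OF t P_mart])
    moreover have "t \<bullet> (P *v noise n w) = c w" unfolding c_def using inner_P[of t "noise n w"] t by simp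
    ultimately show ?thesis using n by (simp add: inner_add_right e_def)
  qed
  have Rint: "integrable M R" unfolding R_def[abs_def]
    using c1 c2 by (intro Bochner_Integration.integrable_diff Bochner_Integration.integrable_add ci
        integrable_mult_right integrable_of_real integrable_divide_zero) (auto simp: power_mult_distrib)
  have Rle: "norm (R w) \<le> e powr r * norm t powr r * norm (noise n w) powr r" for w
  proof -
    have "norm (R w) \<le> \<bar>e * c w\<bar> powr r" unfolding R_def by (rule norm_cis_taylor_le) (use r in auto)
    also have "\<dots> \<le> (e * (norm t * norm (noise n w))) powr r"
      unfolding c_def using \<eta>n r by (intro powr_mono2)
        (auto simp: abs_mult e_def intro!: mult_left_mono Cauchy_Schwarz_ineq2)
    finally show ?thesis using \<eta>n by (simp add: powr_mult e_def)
  qed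
  have E1: "expectation (\<lambda>w. cis (a w) * of_real (c w)) = 0"
  proof -
    have [measurable]: "(\<lambda>q. h (fst q) (snd q)) \<in> borel_measurable (borel \<Otimes>\<^sub>M D)" by measurable
    have "expectation (\<lambda>w. cis (a w) * of_real ((\<lambda>q. t \<bullet> h (fst q) (snd q)) (x n w, \<zeta> n w)))
       = expectation (\<lambda>w. cis (a w) * of_real (\<integral>z. (\<lambda>q. t \<bullet> h (fst q) (snd q)) (x n w, z) \<partial>D))"
      unfolding a_def
      by (rule expectation_cis_sample[OF n]) (measurable, use c1 in \<open>simp add: c_def[abs_def] noise_def\<close>)
    then show ?thesis by (simp add: c_def noise_def h_integral)
  qed
  have E2: "expectation (\<lambda>w. cis (a w) * of_real ((c w)\<^sup>2)) = expectation (\<lambda>w. cis (a w) * of_real (v w))"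
  proof -
    have [measurable]: "(\<lambda>q. h (fst q) (snd q)) \<in> borel_measurable (borel \<Otimes>\<^sub>M D)" by measurable
    have "expectation (\<lambda>w. cis (a w) * of_real ((\<lambda>q. (t \<bullet> h (fst q) (snd q))\<^sup>2) (x n w, \<zeta> n w)))
       = expectation (\<lambda>w. cis (a w) * of_real (\<integral>z. (\<lambda>q. (t \<bullet> h (fst q) (snd q))\<^sup>2) (x n w, z) \<partial>D))"
      unfolding a_def
      by (rule expectation_cis_sample[OF n]) (measurable, use c2 in \<open>simp add: c_def[abs_def] noise_def\<close>)
    then show ?thesis by (simp add: c_def noise_def v_def h_sq)
  qed
  have xi: "integrable M (\<lambda>w. norm (x n w - xstar))"
    by (intro integrable_norm sq_int_integrable sq_int_diff x_sq sq_int_const n)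
  \<comment> \<open>Measurability in the iterate comes from writing the quadratic form as a
    parameter integral of the jointly measurable noise.\<close>
  have vm [measurable]: "v \<in> borel_measurable M"
  proof -
    interpret D: prob_space D
      using prob_space_distr[OF \<zeta>_meas[of 1]] \<zeta>_distr[of 1] by simp
    have "(\<lambda>y. \<integral>z. (t \<bullet> h y z)\<^sup>2 \<partial>D) \<in> borel_measurable borel"
      using h_meas by (intro D.borel_measurable_lebesgue_integral) (simp add: case_prod_beta')
    then have "(\<lambda>w. \<integral>z. (t \<bullet> h (x n w) z)\<^sup>2 \<partial>D) \<in> borel_measurable M"
      by (rule measurable_compose[rotated]) measurable
    then show ?thesis by (simp add: v_def[abs_def] h_sq)
  qed
  have vdi: "integrable M (\<lambda>w. v w - vs)"
  proof (rule Bochner_Integration.integrable_bound)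
    show "integrable M (\<lambda>w. C1 * norm (x n w - xstar) * (norm t)\<^sup>2)" using xi by simp
    show "AE w in M. norm (v w - vs) \<le> norm (C1 * norm (x n w - xstar) * (norm t)\<^sup>2)"
      using C1[of t] by (intro AE_I2) (simp only: v_def vs_def real_norm_def order_trans[OF _ abs_ge_self])
  qed measurable
  have vi: "integrable M v" using Bochner_Integration.integrable_add[OF vdi, of "\<lambda>w. vs"] by simp
  have "char_mart (Suc n) t = expectation (\<lambda>w. cis (a w) + \<i> * of_real e * (cis (a w) * of_real (c w))
      - of_real (e\<^sup>2) / 2 * (cis (a w) * of_real ((c w)\<^sup>2)) + cis (a w) * R w)"
    unfolding char_mart_def arg
    by (intro Bochner_Integration.integral_cong refl)
       (simp add: R_def cis_mult[symmetric] power_mult_distrib algebra_simps)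
  also have "\<dots> = expectation (\<lambda>w. cis (a w)) + \<i> * of_real e * expectation (\<lambda>w. cis (a w) * of_real (c w))
      - of_real (e\<^sup>2) / 2 * expectation (\<lambda>w. cis (a w) * of_real ((c w)\<^sup>2)) + expectation (\<lambda>w. cis (a w) * R w)"
  proof -
    have lin: "expectation (\<lambda>w. A w + c1 * B w - c2 * C w + E w) =
        expectation A + c1 * expectation B - c2 * expectation C + expectation E"
      if "integrable M A" "integrable M B" "integrable M C" "integrable M E" for A B C E :: "'a \<Rightarrow> complex" and c1 c2
      using that by simp
    show ?thesis by (rule lin) (intro ci am mult_int integrable_of_real c1 c2 Rint)+
  qed
  also have "\<dots> = char_mart n (L n t) - of_real (e\<^sup>2) / 2 * expectation (\<lambda>w. cis (a w) * of_real (v w))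
      + expectation (\<lambda>w. cis (a w) * R w)"
    unfolding E1 E2 by (simp add: char_mart_def a_def)
  finally have step: "char_mart (Suc n) t = \<dots>" .
  have "char_mart (Suc n) t - char_mart n (L n t) * of_real (1 - e\<^sup>2 * vs / 2) =
     - (of_real (e\<^sup>2) / 2 * expectation (\<lambda>w. cis (a w) * of_real (v w - vs))) + expectation (\<lambda>w. cis (a w) * R w)"
  proof -
    have "expectation (\<lambda>w. cis (a w) * of_real (v w - vs)) =
        expectation (\<lambda>w. cis (a w) * of_real (v w) - cis (a w) * of_real vs)" by (simp add: algebra_simps)
    also have "\<dots> = expectation (\<lambda>w. cis (a w) * of_real (v w)) - expectation (\<lambda>w. cis (a w) * of_real vs)"
      by (rule Bochner_Integration.integral_diff[OF mult_int[OF integrable_of_real[OF vi]] mult_int[of "\<lambda>w. of_real vs"]]) simp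
    also have "expectation (\<lambda>w. cis (a w) * of_real vs) = char_mart n (L n t) * of_real vs"
      by (simp add: char_mart_def a_def)
    finally have ev: "expectation (\<lambda>w. cis (a w) * of_real (v w - vs)) =
        expectation (\<lambda>w. cis (a w) * of_real (v w)) - char_mart n (L n t) * of_real vs" .
    show ?thesis unfolding step ev by (simp add: algebra_simps)
  qed
  also have "norm \<dots> \<le> norm (of_real (e\<^sup>2) / 2 * expectation (\<lambda>w. cis (a w) * of_real (v w - vs)))
      + norm (expectation (\<lambda>w. cis (a w) * R w))"
    by (rule order_trans[OF norm_triangle_ineq]) simp
  also have "norm (of_real (e\<^sup>2) / 2 * expectation (\<lambda>w. cis (a w) * of_real (v w - vs)))
      \<le> e\<^sup>2 / 2 * (C1 * expectation (\<lambda>w. norm (x n w - xstar)) * (norm t)\<^sup>2)"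
  proof -
    have "norm (expectation (\<lambda>w. cis (a w) * of_real (v w - vs))) \<le> expectation (\<lambda>w. C1 * norm (x n w - xstar) * (norm t)\<^sup>2)"
    proof (rule norm_integral_le)
      show "integrable M (\<lambda>w. cis (a w) * complex_of_real (v w - vs))"
        by (intro mult_int integrable_of_real vdi)
      show "integrable M (\<lambda>w. C1 * norm (x n w - xstar) * (norm t)\<^sup>2)" using xi by simp
      fix w
      have "norm (cis (a w) * complex_of_real (v w - vs)) = \<bar>v w - vs\<bar>" by (simp only: norm_mult norm_cis norm_of_real mult_1)
      then show "norm (cis (a w) * complex_of_real (v w - vs)) \<le> C1 * norm (x n w - xstar) * (norm t)\<^sup>2"
        using C1[of t "x n w"] by (simp add: v_def vs_def)
    qed
    also have "\<dots> = C1 * expectation (\<lambda>w. norm (x n w - xstar)) * (norm t)\<^sup>2" by simp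
    finally have "norm (of_real (e\<^sup>2) / 2 :: complex) * norm (expectation (\<lambda>w. cis (a w) * of_real (v w - vs)))
        \<le> norm (of_real (e\<^sup>2) / 2 :: complex) * (C1 * expectation (\<lambda>w. norm (x n w - xstar)) * (norm t)\<^sup>2)"
      by (rule mult_left_mono) simp
    moreover have "norm (of_real (e\<^sup>2) / 2 :: complex) = e\<^sup>2 / 2"
      by (simp add: norm_divide norm_power)
    ultimately show ?thesis unfolding norm_mult by simp
  qed
  also have "norm (expectation (\<lambda>w. cis (a w) * R w)) \<le> C2 * e powr r * norm t powr r"
  proof -
    have "norm (expectation (\<lambda>w. cis (a w) * R w)) \<le> expectation (\<lambda>w. e powr r * norm t powr r * norm (noise n w) powr r)"
      by (rule norm_integral_le[OF mult_int[OF Rint]]) (use C2 Rle in \<open>auto simp: norm_mult\<close>)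
    also have "\<dots> = e powr r * norm t powr r * expectation (\<lambda>w. norm (noise n w) powr r)" by simp
    also have "\<dots> \<le> e powr r * norm t powr r * C2" by (intro mult_left_mono C2) auto
    finally show ?thesis by (simp add: mult_ac)
  qed
  finally show ?thesis unfolding e_def vs_def by (simp add: mult.assoc)
qed

lemma inner_mart_mean:
  assumes "n \<ge> 1" "P *v t = t"
  shows "expectation (\<lambda>w. t \<bullet> mart n w) = 0"
  using assms
proof (induction n arbitrary: t rule: nat_induct_at_least)
  case base
  then show ?case by simp
next
  case (Suc n)
  have sq1: "sq_int M (\<lambda>w. c)" for c :: "real^'d" by (rule sq_int_const)
  have i1: "integrable M (\<lambda>w. L n t \<bullet> mart n w)" "integrable M (\<lambda>w. t \<bullet> noise n w)"
    by (rule sq_int_inner_integrable[OF sq1 mart_sq[OF Suc.hyps]], rule sq_int_inner_integrable[OF sq1 noise_sq[OF Suc.hyps]])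
  have "expectation (\<lambda>w. t \<bullet> mart (Suc n) w) = expectation (\<lambda>w. L n t \<bullet> mart n w + \<eta> n * (t \<bullet> noise n w))"
  proof (intro Bochner_Integration.integral_cong refl)
    fix w
    have "t \<bullet> (P *v noise n w) = t \<bullet> noise n w" using inner_P[of t "noise n w"] Suc.prems by simp
    then show "t \<bullet> mart (Suc n) w = L n t \<bullet> mart n w + \<eta> n * (t \<bullet> noise n w)"
      using Suc.hyps inner_L[OF Suc.prems P_mart, of n n w] by (simp add: inner_add_right)
  qed
  also have "\<dots> = expectation (\<lambda>w. L n t \<bullet> mart n w) + \<eta> n * expectation (\<lambda>w. t \<bullet> noise n w)"
    using i1 by simp
  also have "expectation (\<lambda>w. t \<bullet> noise n w) = 0"
    by (rule expectation_inner_noise[OF Suc.hyps _ sq1]) simp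
  also have "expectation (\<lambda>w. L n t \<bullet> mart n w) = 0"
    by (rule Suc.IH[OF P_L[OF Suc.prems]])
  finally show ?case by simp
qed

text \<open>Starts the induction over n: because the mean vanishes the deviation from 1 is quadratic
  in t, as the uniform bound demands near t = 0.\<close>

lemma char_mart_approx_one:
  assumes n: "n \<ge> 1" and t: "P *v t = t"
  shows "norm (char_mart n t - 1) \<le> msq M (mart n) / 2 * (norm t)\<^sup>2"
proof -
  have [measurable]: "mart n \<in> borel_measurable M" using mart_sq[OF n] by auto
  have sqm: "integrable M (\<lambda>w. (norm (mart n w))\<^sup>2)" using mart_sq[OF n] by (simp add: sq_int_def)
  have ti: "integrable M (\<lambda>w. t \<bullet> mart n w)"
    by (rule sq_int_inner_integrable[OF sq_int_const mart_sq[OF n]])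
  have ci: "integrable M (\<lambda>w. cis (t \<bullet> mart n w))"
    by (rule integrable_const_bound[of _ 1]) auto
  have "char_mart n t - 1 = expectation (\<lambda>w. cis (t \<bullet> mart n w) - (1 + \<i> * of_real (t \<bullet> mart n w)))"
  proof -
    have "expectation (\<lambda>w. 1 + \<i> * of_real (t \<bullet> mart n w)) = 1 + \<i> * of_real (expectation (\<lambda>w. t \<bullet> mart n w))"
      using ti by (simp add: integral_complex_of_real prob_space)
    then show ?thesis
      using ci ti inner_mart_mean[OF n t] by (simp add: char_mart_def Bochner_Integration.integral_diff integral_complex_of_real prob_space)
  qed
  also have "norm \<dots> \<le> expectation (\<lambda>w. (norm t)\<^sup>2 / 2 * (norm (mart n w))\<^sup>2)"
  proof (rule norm_integral_le)
    show "integrable M (\<lambda>w. cis (t \<bullet> mart n w) - (1 + \<i> * complex_of_real (t \<bullet> mart n w)))"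
      using ci ti by simp
    show "integrable M (\<lambda>w. (norm t)\<^sup>2 / 2 * (norm (mart n w))\<^sup>2)" using sqm by simp
    fix w
    let ?y = "t \<bullet> mart n w"
    have "norm (cis ?y - (1 + \<i> * complex_of_real ?y)) \<le> ?y\<^sup>2 / 2"
      using iexp_approx1[of ?y 1] by (simp add: cis_eq_iexp power2_eq_square)
    also have "?y\<^sup>2 \<le> (norm t * norm (mart n w))\<^sup>2"
      using Cauchy_Schwarz_ineq2[of t "mart n w"] by (intro power2_le_iff_abs_le[THEN iffD2]) auto
    finally show "norm (cis ?y - (1 + \<i> * complex_of_real ?y)) \<le> (norm t)\<^sup>2 / 2 * (norm (mart n w))\<^sup>2"
      by (simp add: power_mult_distrib)
  qed
  also have "\<dots> = msq M (mart n) / 2 * (norm t)\<^sup>2" by (simp add: msq_def)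
  finally show ?thesis .
qed

lemma norm_char_mart_le: "norm (char_mart n t) \<le> 1"
proof -
  have "norm (char_mart n t) \<le> expectation (\<lambda>w. norm (cis (t \<bullet> mart n w)))"
    unfolding char_mart_def by (rule integral_norm_bound)
  then show ?thesis by (simp add: prob_space)
qed

text \<open>In the exponent the terms of order \<eta>^2 cancel by the Lyapunov equation, apart from
  the part that matches the decrease of \<eta>; what is left is the defect of that decrease and a
  term of order \<eta>^3.\<close>

lemma char_gauss_Suc:
  obtains C where "0 \<le> C" "\<And>n t. n \<ge> 1 \<Longrightarrow> P *v t = t \<Longrightarrow>
    \<bar>char_gauss n (L n t) * exp (- ((\<eta> n)\<^sup>2 * (t \<bullet> (\<Sigma> xstar *v t)) / 2)) - char_gauss (Suc n) t\<bar>
      \<le> C * (\<bar>\<eta> n - \<eta> (Suc n) - of_bool (\<alpha> = 1) / eta0 * (\<eta> n)\<^sup>2\<bar> + (\<eta> n)^3) * (norm t)\<^sup>2"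
proof -
  define K1 where "K1 = onorm ((*v) \<Sigma>t)"
  define K2 where "K2 = onorm ((*v) (P ** S))"
  have K: "0 \<le> K1" "norm (\<Sigma>t *v z) \<le> K1 * norm z" "0 \<le> K2" "norm (P *v (S *v z)) \<le> K2 * norm z" for z
    unfolding K1_def K2_def using onorm[OF matrix_vector_mul_bounded_linear[of "P ** S"], of z]
    by (auto intro: onorm onorm_pos_le matrix_vector_mul_bounded_linear simp: matrix_vector_mul_assoc)
  have quad: "z \<bullet> (\<Sigma>t *v z) \<le> K1 * (norm z)\<^sup>2" for z
  proof -
    have "z \<bullet> (\<Sigma>t *v z) \<le> norm z * norm (\<Sigma>t *v z)" by (rule norm_cauchy_schwarz)
    also have "\<dots> \<le> norm z * (K1 * norm z)" by (intro mult_left_mono K) auto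
    finally show ?thesis by (simp add: power2_eq_square mult_ac)
  qed
  show ?thesis
  proof (rule that[of "K1 + K1 * K2\<^sup>2"])
    show "0 \<le> K1 + K1 * K2\<^sup>2" using K by simp
    fix n :: nat and t :: "real^'d" assume n: "n \<ge> 1" and t: "P *v t = t"
    define q where "q = t \<bullet> (\<Sigma>t *v t)"
    define vs where "vs = t \<bullet> (\<Sigma> xstar *v t)"
    define y where "y = P *v (S *v t)"
    define e where "e = \<eta> n"
    define c where "c = of_bool (\<alpha> = 1) / eta0"
    have e: "0 < e" unfolding e_def by (rule \<eta>_pos[OF n])
    have q: "0 \<le> q" "q \<le> K1 * (norm t)\<^sup>2" unfolding q_def using \<Sigma>t_nonneg quad by auto
    have vs: "vs = 2 * (y \<bullet> (\<Sigma>t *v t)) - c * q"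
      using lyapunov[OF t] by (simp add: vs_def q_def y_def c_def)
    have ty: "t \<bullet> (\<Sigma>t *v y) = y \<bullet> (\<Sigma>t *v t)"
      by (rule symmetric_inner) (use \<Sigma>t in \<open>simp add: psd_def\<close>)
    have LL: "L n t \<bullet> (\<Sigma>t *v L n t) = q - 2 * e * (y \<bullet> (\<Sigma>t *v t)) + e\<^sup>2 * (y \<bullet> (\<Sigma>t *v y))"
      unfolding L_def y_def[symmetric] e_def[symmetric]
      by (simp add: lin_simps inner_diff_left inner_diff_right ty q_def power2_eq_square algebra_simps)
    have "\<bar>char_gauss n (L n t) * exp (- (e\<^sup>2 * vs / 2)) - char_gauss (Suc n) t\<bar> =
        \<bar>exp (- (e * (L n t \<bullet> (\<Sigma>t *v L n t)) / 2 + e\<^sup>2 * vs / 2)) - exp (- (\<eta> (Suc n) * q / 2))\<bar>"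
      by (simp add: char_gauss_def exp_add[symmetric] q_def e_def)
    also have "\<dots> \<le> \<bar>e * (L n t \<bullet> (\<Sigma>t *v L n t)) / 2 + e\<^sup>2 * vs / 2 - \<eta> (Suc n) * q / 2\<bar>"
      using e q \<Sigma>t_nonneg \<Sigma>_nonneg[of t xstar] \<eta>_pos[of "Suc n"]
      by (intro abs_exp_diff_le) (auto simp: vs_def)
    also have "\<dots> = \<bar>(e - \<eta> (Suc n) - c * e\<^sup>2) * q + e ^ 3 * (y \<bullet> (\<Sigma>t *v y))\<bar> / 2"
    proof -
      have "e * (L n t \<bullet> (\<Sigma>t *v L n t)) / 2 + e\<^sup>2 * vs / 2 - \<eta> (Suc n) * q / 2 =
          ((e - \<eta> (Suc n) - c * e\<^sup>2) * q + e ^ 3 * (y \<bullet> (\<Sigma>t *v y))) / 2"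
        unfolding LL vs by (simp add: power2_eq_square power3_eq_cube field_simps)
      then show ?thesis by (simp only: abs_divide abs_numeral)
    qed
    also have "\<dots> \<le> \<bar>e - \<eta> (Suc n) - c * e\<^sup>2\<bar> * q + e ^ 3 * (y \<bullet> (\<Sigma>t *v y))"
    proof -
      have "\<bar>(e - \<eta> (Suc n) - c * e\<^sup>2) * q + e ^ 3 * (y \<bullet> (\<Sigma>t *v y))\<bar> \<le> \<bar>(e - \<eta> (Suc n) - c * e\<^sup>2) * q\<bar> + \<bar>e ^ 3 * (y \<bullet> (\<Sigma>t *v y))\<bar>"
        by (rule abs_triangle_ineq)
      also have "\<dots> = \<bar>e - \<eta> (Suc n) - c * e\<^sup>2\<bar> * q + e ^ 3 * (y \<bullet> (\<Sigma>t *v y))"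
        using q e \<Sigma>t_nonneg[of y] by (simp add: abs_mult)
      finally show ?thesis using q e \<Sigma>t_nonneg[of y] by simp
    qed
    also have "\<dots> \<le> \<bar>e - \<eta> (Suc n) - c * e\<^sup>2\<bar> * (K1 * (norm t)\<^sup>2) + e ^ 3 * (K1 * K2\<^sup>2 * (norm t)\<^sup>2)"
    proof (intro add_mono mult_left_mono)
      have "y \<bullet> (\<Sigma>t *v y) \<le> K1 * (norm y)\<^sup>2" by (rule quad)
      also have "\<dots> \<le> K1 * (K2 * norm t)\<^sup>2" unfolding y_def by (intro mult_left_mono power_mono K) auto
      finally show "y \<bullet> (\<Sigma>t *v y) \<le> K1 * K2\<^sup>2 * (norm t)\<^sup>2" by (simp add: power_mult_distrib)
    qed (use q e in auto)
    also have "\<dots> \<le> (K1 + K1 * K2\<^sup>2) * (\<bar>e - \<eta> (Suc n) - c * e\<^sup>2\<bar> + e ^ 3) * (norm t)\<^sup>2"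
    proof -
      have "\<bar>e - \<eta> (Suc n) - c * e\<^sup>2\<bar> * K1 + e ^ 3 * (K1 * K2\<^sup>2) \<le> (K1 + K1 * K2\<^sup>2) * (\<bar>e - \<eta> (Suc n) - c * e\<^sup>2\<bar> + e ^ 3)"
        using K e by (simp add: algebra_simps)
      from mult_right_mono[OF this, of "(norm t)\<^sup>2"] show ?thesis by (simp add: algebra_simps)
    qed
    finally show "\<bar>char_gauss n (L n t) * exp (- ((\<eta> n)\<^sup>2 * (t \<bullet> (\<Sigma> xstar *v t)) / 2)) - char_gauss (Suc n) t\<bar>
      \<le> (K1 + K1 * K2\<^sup>2) * (\<bar>\<eta> n - \<eta> (Suc n) - of_bool (\<alpha> = 1) / eta0 * (\<eta> n)\<^sup>2\<bar> + (\<eta> n)^3) * (norm t)\<^sup>2"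
      unfolding e_def vs_def c_def .
  qed
qed

lemma recursive_seq:
  fixes f :: "nat \<Rightarrow> real \<Rightarrow> real"
  obtains A where "A N = A0" "\<And>n. n \<ge> N \<Longrightarrow> A (Suc n) = f n (A n)"
proof -
  define A where "A = rec_nat A0 (\<lambda>n a. if n < N then A0 else f n a)"
  have S: "A (Suc n) = (if n < N then A0 else f n (A n))" for n by (simp add: A_def)
  have "A m = A0" if "m \<le> N" for m
    using that by (cases m) (simp_all add: S, simp add: A_def)
  then show ?thesis using that[of A] S by simp
qed

text \<open>Passing from t to \<open>L n t\<close> multiplies |t|^2 and |t|^r by at most 1 - \<mu> *
  \<eta>, so the two coefficients obey separate scalar contractions whose forcing is the error of
  one step.\<close>

lemma char_mart_gauss:
  obtains A B where "A \<in> o(\<lambda>n. \<eta> n powr 1)" "B \<in> o(\<lambda>n. \<eta> n powr (r / 2))"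
    "\<forall>\<^sub>F n in sequentially. \<forall>t. P *v t = t \<longrightarrow>
       norm (char_mart n t - of_real (char_gauss n t)) \<le> A n * (norm t)\<^sup>2 + B n * norm t powr r"
proof -
  obtain C1 where C1: "\<And>y t. \<bar>t \<bullet> (\<Sigma> y *v t) - t \<bullet> (\<Sigma> xstar *v t)\<bar> \<le> C1 * norm (y - xstar) * (norm t)\<^sup>2"
    using \<Sigma>_lip by blast
  obtain C2 where C2: "0 \<le> C2" "\<And>n. n \<ge> 1 \<Longrightarrow> integrable M (\<lambda>w. norm (noise n w) powr r)"
    "\<And>n. n \<ge> 1 \<Longrightarrow> expectation (\<lambda>w. norm (noise n w) powr r) \<le> C2"
    using noise_bounds by metis
  obtain C3 where C3: "0 \<le> C3" "\<And>n t. n \<ge> 1 \<Longrightarrow> P *v t = t \<Longrightarrow>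
    \<bar>char_gauss n (L n t) * exp (- ((\<eta> n)\<^sup>2 * (t \<bullet> (\<Sigma> xstar *v t)) / 2)) - char_gauss (Suc n) t\<bar>
      \<le> C3 * (\<bar>\<eta> n - \<eta> (Suc n) - of_bool (\<alpha> = 1) / eta0 * (\<eta> n)\<^sup>2\<bar> + (\<eta> n)^3) * (norm t)\<^sup>2"
    using char_gauss_Suc by metis
  define K where "K = onorm ((*v) (\<Sigma> xstar))"
  have K: "0 \<le> K" "t \<bullet> (\<Sigma> xstar *v t) \<le> K * (norm t)\<^sup>2" for t
  proof -
    show "0 \<le> K" unfolding K_def by (intro onorm_pos_le matrix_vector_mul_bounded_linear)
    have "t \<bullet> (\<Sigma> xstar *v t) \<le> norm t * norm (\<Sigma> xstar *v t)" by (rule norm_cauchy_schwarz)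
    also have "\<dots> \<le> norm t * (K * norm t)"
      unfolding K_def by (intro mult_left_mono onorm matrix_vector_mul_bounded_linear) auto
    finally show "t \<bullet> (\<Sigma> xstar *v t) \<le> K * (norm t)\<^sup>2" by (simp add: power2_eq_square mult_ac)
  qed
  define Kt where "Kt = onorm ((*v) \<Sigma>t)"
  have Kt: "t \<bullet> (\<Sigma>t *v t) \<le> Kt * (norm t)\<^sup>2" for t
  proof -
    have "t \<bullet> (\<Sigma>t *v t) \<le> norm t * norm (\<Sigma>t *v t)" by (rule norm_cauchy_schwarz)
    also have "\<dots> \<le> norm t * (Kt * norm t)"
      unfolding Kt_def by (intro mult_left_mono onorm matrix_vector_mul_bounded_linear) auto
    finally show ?thesis by (simp add: power2_eq_square mult_ac)
  qed
  define \<delta> where "\<delta> n = \<bar>C1\<bar> * expectation (\<lambda>w. norm (x n w - xstar))" for n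
  define \<epsilon> where "\<epsilon> n = \<bar>\<eta> n - \<eta> (Suc n) - of_bool (\<alpha> = 1) / eta0 * (\<eta> n)\<^sup>2\<bar>" for n
  \<comment> \<open>One-step errors divided by \<mu> * \<eta>: \<open>a\<close> collects those
    proportional to |t|^2, the varying covariance and the Gaussian mismatch; \<open>c\<close>
    collects the two Taylor remainders proportional to |t|^r.\<close>
  define a where "a n = (\<eta> n * \<delta> n / 2 + C3 * (\<epsilon> n / \<eta> n + (\<eta> n)\<^sup>2)) / \<mu>" for n
  define c where "c n = (C2 + K powr (r / 2)) / \<mu> * \<eta> n powr (r - 1)" for n
  have \<delta>0: "0 \<le> \<delta> n" for n by (simp add: \<delta>_def Bochner_Integration.integral_nonneg)
  obtain N where N: "\<And>n. n \<ge> N \<Longrightarrow> 1 \<le> n \<and> 0 < \<eta> n \<and> \<mu> * \<eta> n \<le> 1 \<and>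
     (\<forall>z. P *v z = z \<longrightarrow> norm (L n z) \<le> (1 - \<mu> * \<eta> n) * norm z)"
    using contraction unfolding eventually_sequentially by blast
  \<comment> \<open>At N both functions are compared with 1. Each differs from it by a multiple of
    |t|^2, so B may start from 0.\<close>
  define A0 where "A0 = msq M (mart N) / 2 + \<eta> N * Kt / 2"
  obtain A where A: "A N = A0" "\<And>n. n \<ge> N \<Longrightarrow> A (Suc n) = (1 - \<mu> * \<eta> n) * A n + \<mu> * \<eta> n * a n"
    by (rule recursive_seq[of N A0 "\<lambda>n z. (1 - \<mu> * \<eta> n) * z + \<mu> * \<eta> n * a n"]) blast
  obtain B where B: "B N = 0" "\<And>n. n \<ge> N \<Longrightarrow> B (Suc n) = (1 - \<mu> * \<eta> n) * B n + \<mu> * \<eta> n * c n"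
    by (rule recursive_seq[of N 0 "\<lambda>n z. (1 - \<mu> * \<eta> n) * z + \<mu> * \<eta> n * c n"]) blast
  have a0: "0 \<le> a n" and c0: "0 \<le> c n" if "n \<ge> N" for n
    using N[OF that] \<mu> \<delta>0[of n] C2 C3 K(1) by (auto simp: a_def c_def \<epsilon>_def intro!: divide_nonneg_pos add_nonneg_nonneg mult_nonneg_nonneg)
  have Kt0: "0 \<le> Kt" unfolding Kt_def by (intro onorm_pos_le matrix_vector_mul_bounded_linear)
  have A00: "0 \<le> A n" if "n \<ge> N" for n
    using that
  proof (induction n rule: dec_induct)
    case base
    show ?case using N[of N] Kt0 by (simp add: A A0_def msq_nonneg)
  next
    case (step n)
    then show ?case using N[of n] a0[of n] \<mu> by (simp add: A)
  qed
  have B00: "0 \<le> B n" if "n \<ge> N" for n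
    using that
  proof (induction n rule: dec_induct)
    case (step n)
    then show ?case using N[of n] c0[of n] \<mu> by (simp add: B)
  qed (simp add: B)
  have main: "\<forall>t. P *v t = t \<longrightarrow> norm (char_mart n t - of_real (char_gauss n t)) \<le> A n * (norm t)\<^sup>2 + B n * norm t powr r"
    if "n \<ge> N" for n
    using that
  proof (induction n rule: dec_induct)
    case base
    show ?case
    proof (intro allI impI)
      fix t assume t: "P *v t = t"
      have NN: "1 \<le> N" "0 < \<eta> N" using N[of N] by auto
      have "norm (char_mart N t - of_real (char_gauss N t)) \<le> norm (char_mart N t - 1) + norm (1 - complex_of_real (char_gauss N t))"
        using norm_triangle_ineq[of "char_mart N t - 1" "1 - complex_of_real (char_gauss N t)"] by simp
      also have "norm (1 - complex_of_real (char_gauss N t)) = \<bar>exp (- 0) - exp (- (\<eta> N * (t \<bullet> (\<Sigma>t *v t)) / 2))\<bar>"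
        unfolding char_gauss_def by (metis exp_zero minus_zero norm_of_real of_real_1 of_real_diff)
      also have "\<dots> \<le> \<bar>0 - \<eta> N * (t \<bullet> (\<Sigma>t *v t)) / 2\<bar>"
        using NN \<Sigma>t_nonneg by (intro abs_exp_diff_le) auto
      also have "\<dots> \<le> \<eta> N * (Kt * (norm t)\<^sup>2) / 2"
        using NN \<Sigma>t_nonneg[of t] Kt[of t] by (simp add: mult_left_mono)
      also have "norm (char_mart N t - 1) \<le> msq M (mart N) / 2 * (norm t)\<^sup>2"
        by (rule char_mart_approx_one[OF NN(1) t])
      finally show "norm (char_mart N t - of_real (char_gauss N t)) \<le> A N * (norm t)\<^sup>2 + B N * norm t powr r"
        by (simp add: A B A0_def algebra_simps)
    qed
  next
    case (step n)
    show ?case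
    proof (intro allI impI)
      fix t assume t: "P *v t = t"
      note Nn = N[OF step.hyps(1)]
      define v where "v = (\<eta> n)\<^sup>2 * (t \<bullet> (\<Sigma> xstar *v t)) / 2"
      have v0: "0 \<le> v" using \<Sigma>_nonneg by (simp add: v_def)
      let ?\<psi> = "char_mart n (L n t)" and ?G = "char_gauss n (L n t)"
      \<comment> \<open>T1 advances the martingale, T2 turns 1 - v into exp (- v), T3 uses the
        induction hypothesis at \<open>L n t\<close>, and T4 advances the Gaussian.\<close>
      have T1: "norm (char_mart (Suc n) t - ?\<psi> * of_real (1 - v)) \<le> (\<eta> n)\<^sup>2 / 2 * \<delta> n * (norm t)\<^sup>2 + C2 * \<eta> n powr r * norm t powr r"
      proof -
        have "norm (char_mart (Suc n) t - ?\<psi> * of_real (1 - v)) \<le>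
           (\<eta> n)\<^sup>2 / 2 * C1 * expectation (\<lambda>w. norm (x n w - xstar)) * (norm t)\<^sup>2 + C2 * \<eta> n powr r * norm t powr r"
          unfolding v_def using Nn by (intro char_mart_Suc t C1 C2) auto
        also have "(\<eta> n)\<^sup>2 / 2 * C1 * expectation (\<lambda>w. norm (x n w - xstar)) * (norm t)\<^sup>2 \<le> (\<eta> n)\<^sup>2 / 2 * \<delta> n * (norm t)\<^sup>2"
          unfolding \<delta>_def mult.assoc
          by (intro mult_left_mono mult_right_mono) (auto intro!: mult_nonneg_nonneg Bochner_Integration.integral_nonneg)
        finally show ?thesis by simp
      qed
      have T2: "norm (?\<psi> * of_real (1 - v) - ?\<psi> * of_real (exp (- v))) \<le> K powr (r / 2) * \<eta> n powr r * norm t powr r"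
      proof -
        have "norm (?\<psi> * of_real (1 - v) - ?\<psi> * of_real (exp (- v))) = norm ?\<psi> * norm (complex_of_real ((1 - v) - exp (- v)))"
          by (simp only: right_diff_distrib[symmetric] of_real_diff[symmetric] norm_mult)
        also have "\<dots> = norm ?\<psi> * \<bar>(1 - v) - exp (- v)\<bar>" by (simp only: norm_of_real)
        also have "\<dots> \<le> 1 * v powr (r / 2)"
          using v0 r by (intro mult_mono norm_char_mart_le exp_minus_taylor_le) auto
        also have "v \<le> K * (\<eta> n * norm t)\<^sup>2"
        proof -
          have "(\<eta> n)\<^sup>2 * (t \<bullet> (\<Sigma> xstar *v t)) \<le> (\<eta> n)\<^sup>2 * (K * (norm t)\<^sup>2)" by (intro mult_left_mono K) auto
          then show ?thesis using v0 by (simp add: v_def power_mult_distrib mult_ac)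
        qed
        then have "1 * v powr (r / 2) \<le> (K * (\<eta> n * norm t)\<^sup>2) powr (r / 2)"
          using v0 r by (simp add: powr_mono2)
        also have "\<dots> = K powr (r / 2) * \<eta> n powr r * norm t powr r"
        proof -
          have "((\<eta> n * norm t)\<^sup>2) powr (r / 2) = (\<eta> n * norm t) powr r"
            using Nn by (cases "norm t = 0") (auto simp flip: powr_numeral simp: powr_powr)
          then show ?thesis using K(1) Nn by (simp add: powr_mult)
        qed
        finally show ?thesis .
      qed
      have T3: "norm (?\<psi> * of_real (exp (- v)) - of_real (?G * exp (- v))) \<le> (1 - \<mu> * \<eta> n) * A n * (norm t)\<^sup>2 + (1 - \<mu> * \<eta> n) * B n * norm t powr r"
      proof -
        let ?l = "1 - \<mu> * \<eta> n"
        have l: "0 \<le> ?l" "?l \<le> 1" using Nn \<mu> by auto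
        have "norm (?\<psi> * of_real (exp (- v)) - of_real (?G * exp (- v))) = norm (?\<psi> - of_real ?G) * norm (complex_of_real (exp (- v)))"
          by (simp only: norm_mult[symmetric] of_real_mult left_diff_distrib)
        also have "\<dots> \<le> (A n * (norm (L n t))\<^sup>2 + B n * norm (L n t) powr r) * 1"
        proof (intro mult_mono)
          show "norm (?\<psi> - of_real ?G) \<le> A n * (norm (L n t))\<^sup>2 + B n * norm (L n t) powr r"
            using step.IH P_L[OF t] by blast
          show "norm (complex_of_real (exp (- v))) \<le> 1" using v0 by (simp only: norm_of_real) simp
          show "0 \<le> A n * (norm (L n t))\<^sup>2 + B n * norm (L n t) powr r"
            using A00[of n] B00[of n] step.hyps by simp
        qed auto
        also have "\<dots> \<le> A n * (?l * norm t)\<^sup>2 + B n * (?l * norm t) powr r"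
          using Nn t A00[of n] B00[of n] step.hyps r
          by (simp only: mult_1_right, intro add_mono mult_left_mono power_mono powr_mono2) auto
        \<comment> \<open>Of the powers 2 and r of the contraction factor only one is kept; it
          suffices for a scalar recursion of gain \<mu> * \<eta>.\<close>
        also have "\<dots> \<le> A n * (?l * (norm t)\<^sup>2) + B n * (?l * norm t powr r)"
        proof (intro add_mono mult_left_mono)
          have "?l\<^sup>2 \<le> ?l" using l by (simp add: power2_eq_square mult_left_le)
          then show "(?l * norm t)\<^sup>2 \<le> ?l * (norm t)\<^sup>2" unfolding power_mult_distrib by (intro mult_right_mono) auto
          have "?l powr r \<le> ?l"
          proof (cases "?l = 0")
            case False
            then have "?l powr r \<le> ?l powr 1" using l r by (intro powr_mono') auto
            then show ?thesis using l by simp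
          qed (use r in simp)
          then have "?l powr r * norm t powr r \<le> ?l * norm t powr r" by (intro mult_right_mono) auto
          then show "(?l * norm t) powr r \<le> ?l * norm t powr r" using l by (simp add: powr_mult)
        qed (use A00[of n] B00[of n] step.hyps in auto)
        finally show ?thesis by (simp add: mult_ac)
      qed
      have T4: "norm (complex_of_real (?G * exp (- v)) - of_real (char_gauss (Suc n) t)) \<le> C3 * (\<epsilon> n + (\<eta> n)^3) * (norm t)\<^sup>2"
        unfolding of_real_diff[symmetric] norm_of_real v_def \<epsilon>_def using Nn by (intro C3 t) auto
      have "norm (char_mart (Suc n) t - of_real (char_gauss (Suc n) t)) \<le>
          norm (char_mart (Suc n) t - ?\<psi> * of_real (1 - v)) + norm (?\<psi> * of_real (1 - v) - ?\<psi> * of_real (exp (- v)))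
          + norm (?\<psi> * of_real (exp (- v)) - of_real (?G * exp (- v))) + norm (complex_of_real (?G * exp (- v)) - of_real (char_gauss (Suc n) t))"
        (is "norm (?a - ?e) \<le> norm (?a - ?b) + norm (?b - ?c) + norm (?c - ?d) + norm (?d - ?e)")
        using norm_triangle_ineq[of "?a - ?b" "?b - ?e"] norm_triangle_ineq[of "?b - ?c" "?c - ?e"]
          norm_triangle_ineq[of "?c - ?d" "?d - ?e"] unfolding diff_add_cancel add_diff_eq by linarith
      also have "\<dots> \<le> ((\<eta> n)\<^sup>2 / 2 * \<delta> n * (norm t)\<^sup>2 + C2 * \<eta> n powr r * norm t powr r) + K powr (r / 2) * \<eta> n powr r * norm t powr r
          + ((1 - \<mu> * \<eta> n) * A n * (norm t)\<^sup>2 + (1 - \<mu> * \<eta> n) * B n * norm t powr r) + C3 * (\<epsilon> n + (\<eta> n)^3) * (norm t)\<^sup>2"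
        by (intro add_mono T1 T2 T3 T4)
      also have "\<dots> = ((1 - \<mu> * \<eta> n) * A n + ((\<eta> n)\<^sup>2 / 2 * \<delta> n + C3 * (\<epsilon> n + (\<eta> n)^3))) * (norm t)\<^sup>2
          + ((1 - \<mu> * \<eta> n) * B n + (C2 + K powr (r / 2)) * \<eta> n powr r) * norm t powr r"
        by (simp add: algebra_simps)
      also have "(\<eta> n)\<^sup>2 / 2 * \<delta> n + C3 * (\<epsilon> n + (\<eta> n)^3) = \<mu> * \<eta> n * a n"
        using Nn \<mu> by (simp add: a_def power2_eq_square power3_eq_cube field_simps)
      also have "(C2 + K powr (r / 2)) * \<eta> n powr r = \<mu> * \<eta> n * c n"
        using Nn \<mu> by (simp add: c_def powr_diff)
      finally show "norm (char_mart (Suc n) t - of_real (char_gauss (Suc n) t)) \<le> A (Suc n) * (norm t)\<^sup>2 + B (Suc n) * norm t powr r"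
        using A(2) B(2) step.hyps by simp
    qed
  qed
  have evN: "\<forall>\<^sub>F n in sequentially. n \<ge> N" by (rule eventually_ge_at_top)
  have "a \<in> o(\<lambda>n. \<eta> n powr 1)"
  proof -
    have 1: "(\<lambda>n. \<eta> n * \<delta> n) \<in> o(\<lambda>n. \<eta> n powr 1)"
    proof -
      have "\<delta> \<longlonglongrightarrow> 0" unfolding \<delta>_def using tendsto_mult_left[OF x_conv, of "\<bar>C1\<bar>"] by simp
      then have "\<delta> \<in> o(\<lambda>n. 1)" by (intro smalloI_tendsto) auto
      then have "(\<lambda>n. \<eta> n * \<delta> n) \<in> o(\<lambda>n. \<eta> n powr 1 * 1)" by (intro landau_o.big_small_mult \<eta>_bigo)
      then show ?thesis by simp
    qed
    have "(\<lambda>n. \<eta> n powr 1 - \<eta> (Suc n) powr 1 - of_bool (\<alpha> = 1) * 1 / eta0 * \<eta> n * \<eta> n powr 1) \<in> o(\<lambda>n. \<eta> n * \<eta> n powr 1)"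
      by (rule \<eta>_powr_diff_smallo)
    also have "?this \<longleftrightarrow> (\<lambda>n. \<eta> n - \<eta> (Suc n) - of_bool (\<alpha> = 1) / eta0 * (\<eta> n)\<^sup>2) \<in> o(\<lambda>n. \<eta> n * \<eta> n powr 1)"
      by (intro landau_o.small.in_cong eventually_mono[OF eventually_ge_at_top[of 1]])
         (use \<eta>_pos in \<open>simp add: less_imp_le power2_eq_square\<close>)
    finally have "\<epsilon> \<in> o(\<lambda>n. \<eta> n * \<eta> n powr 1)" unfolding \<epsilon>_def by simp
    then have "(\<lambda>n. \<epsilon> n * (1 / \<eta> n)) \<in> o(\<lambda>n. \<eta> n * \<eta> n powr 1 * (1 / \<eta> n))"
      by (intro landau_o.small_big_mult) auto
    also have "o(\<lambda>n. \<eta> n * \<eta> n powr 1 * (1 / \<eta> n)) = o(\<lambda>n. \<eta> n powr 1)"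
      by (intro landau_o.small.cong) (use ev_\<eta>_pos in \<open>eventually_elim; simp\<close>)
    finally have 2: "(\<lambda>n. \<epsilon> n / \<eta> n) \<in> o(\<lambda>n. \<eta> n powr 1)" by simp
    have "(\<lambda>n. \<eta> n * \<eta> n) \<in> O(\<lambda>n. \<eta> n powr (1 + 1))" by (intro bigo_powr_mult \<eta>_bigo)
    then have 3: "(\<lambda>n. (\<eta> n)\<^sup>2) \<in> o(\<lambda>n. \<eta> n powr 1)"
      unfolding power2_eq_square by (rule bigo_powr_smallo) simp
    have "(\<lambda>n. 1 / \<mu> * (1 / 2 * (\<eta> n * \<delta> n) + C3 * (\<epsilon> n / \<eta> n + (\<eta> n)\<^sup>2))) \<in> o(\<lambda>n. \<eta> n powr 1)"
      by (intro smallo_cmult sum_in_smallo 1 2 3)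
    then show ?thesis by (simp add: a_def[abs_def])
  qed
  then have "A \<in> o(\<lambda>n. \<eta> n powr 1)"
    using k A(2) A00
    by (intro tracks_smallo[OF tracks_\<mu>, of 1 A a]) (auto intro!: eventually_mono[OF evN])
  moreover have "B \<in> O(\<lambda>n. \<eta> n powr (r - 1))"
  proof (rule tracks_bigo[OF tracks_\<mu>, of "r - 1" B c])
    show "r - 1 \<le> 2 * real k" using r k by linarith
    show "c \<in> O(\<lambda>n. \<eta> n powr (r - 1))"
      unfolding c_def by (cases "(C2 + K powr (r / 2)) / \<mu> = 0") auto
  qed (use r B(2) B00 in \<open>auto intro!: eventually_mono[OF evN]\<close>)
  \<comment> \<open>Here r > 2 is decisive: it is equivalent to r - 1 > r / 2.\<close>
  then have "B \<in> o(\<lambda>n. \<eta> n powr (r / 2))" by (rule bigo_powr_smallo) (use r in simp)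
  ultimately show ?thesis by (rule that) (rule eventually_mono[OF evN main])
qed

lemma mart_clt:
  "(\<lambda>n. expectation (\<lambda>w. cis (t \<bullet> ((1 / sqrt (\<eta> n)) *\<^sub>R mart n w)))) \<longlonglongrightarrow> of_real (exp (- (t \<bullet> (\<Sigma>t *v t)) / 2))"
proof -
  obtain A B where AB: "A \<in> o(\<lambda>n. \<eta> n powr 1)" "B \<in> o(\<lambda>n. \<eta> n powr (r / 2))"
    "\<forall>\<^sub>F n in sequentially. \<forall>t. P *v t = t \<longrightarrow>
       norm (char_mart n t - of_real (char_gauss n t)) \<le> A n * (norm t)\<^sup>2 + B n * norm t powr r"
    by (rule char_mart_gauss)
  define s where "s = P *v t"
  have s: "P *v s = s" by (simp add: s_def PP)
  have ss: "s \<bullet> (\<Sigma>t *v s) = t \<bullet> (\<Sigma>t *v t)"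
  proof -
    have PS: "P *v (\<Sigma>t *v z) = \<Sigma>t *v z" for z by (simp add: matrix_vector_mul_assoc \<Sigma>t)
    have sym: "y \<bullet> (\<Sigma>t *v z) = z \<bullet> (\<Sigma>t *v y)" for y z
      by (rule symmetric_inner) (use \<Sigma>t in \<open>simp add: psd_def\<close>)
    have "s \<bullet> (\<Sigma>t *v s) = t \<bullet> (\<Sigma>t *v s)" unfolding s_def by (simp add: inner_P PS)
    also have "\<dots> = s \<bullet> (\<Sigma>t *v t)" by (rule sym)
    also have "\<dots> = t \<bullet> (\<Sigma>t *v t)" unfolding s_def by (simp add: inner_P PS)
    finally show ?thesis .
  qed
  define err where "err n = A n / \<eta> n powr 1 * (norm s)\<^sup>2 + B n / \<eta> n powr (r / 2) * norm s powr r" for n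
  have "err \<longlonglongrightarrow> 0 * (norm s)\<^sup>2 + 0 * norm s powr r"
    unfolding err_def by (intro tendsto_intros smalloD_tendsto AB)
  then have e0: "err \<longlonglongrightarrow> 0" by simp
  have "\<forall>\<^sub>F n in sequentially. norm (expectation (\<lambda>w. cis (t \<bullet> ((1 / sqrt (\<eta> n)) *\<^sub>R mart n w))) - of_real (exp (- (t \<bullet> (\<Sigma>t *v t)) / 2))) \<le> err n"
    using AB(3) ev_\<eta>_pos
  proof eventually_elim
    case (elim n)
    \<comment> \<open>The martingale lives in the range of P, so t may be replaced by its projection
      s. At this rescaled point |z|^2 and |z|^r produce the factors 1 / \<eta> and 1 /
      \<eta>^(r/2).\<close>
    define z where "z = (1 / sqrt (\<eta> n)) *\<^sub>R s"
    have z: "P *v z = z" by (simp add: z_def lin_simps s)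
    have "t \<bullet> ((1 / sqrt (\<eta> n)) *\<^sub>R mart n w) = z \<bullet> mart n w" for w
      using inner_P[of t "mart n w"] by (simp add: z_def s_def P_mart)
    then have "expectation (\<lambda>w. cis (t \<bullet> ((1 / sqrt (\<eta> n)) *\<^sub>R mart n w))) = char_mart n z"
      by (simp add: char_mart_def)
    moreover have "exp (- (t \<bullet> (\<Sigma>t *v t)) / 2) = char_gauss n z"
      using elim by (simp add: char_gauss_def z_def lin_simps ss)
    moreover have "A n * (norm z)\<^sup>2 + B n * norm z powr r = err n"
    proof -
      have "(norm z)\<^sup>2 = (norm s)\<^sup>2 / \<eta> n powr 1" using elim by (simp add: z_def power_divide)
      moreover have "norm z powr r = norm s powr r / \<eta> n powr (r / 2)"
        using elim by (simp add: z_def powr_divide powr_half_sqrt[symmetric] powr_powr)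
      ultimately show ?thesis by (simp add: err_def)
    qed
    ultimately show ?case using elim z by metis
  qed
  then have "(\<lambda>n. expectation (\<lambda>w. cis (t \<bullet> ((1 / sqrt (\<eta> n)) *\<^sub>R mart n w))) - of_real (exp (- (t \<bullet> (\<Sigma>t *v t)) / 2))) \<longlonglongrightarrow> 0"
    by (rule Lim_null_comparison[OF _ e0])
  then show ?thesis by (rule LIM_zero_cancel)
qed

end

section \<open>Limits of the normalized error\<close>

text \<open>The chosen factor B enters only through B times its transpose, so the law does not
  depend on the choice; \<open>psd_factor\<close> ensures that the choice is a genuine
  factor.\<close>

lemma char_multi_normal:
  fixes C :: "real^'d^'d"
  assumes C: "psd C"
  shows "(\<integral>z. cis (t \<bullet> z) \<partial>multi_normal m C) = cis (t \<bullet> m) * of_real (exp (- (t \<bullet> (C *v t)) / 2))"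
proof -
  define B where "B = (SOME B :: real^'d^'d. B ** transpose B = C)"
  have B: "B ** transpose B = C" unfolding B_def by (rule psd_factor[OF C])
  have "(\<integral>z. cis (t \<bullet> z) \<partial>multi_normal m C) = (\<integral>z. cis (t \<bullet> (m + B *v z)) \<partial>std_normal_vec)"
    unfolding multi_normal_def B_def[symmetric] by (subst integral_distr) auto
  also have "\<dots> = (\<integral>z. cis (t \<bullet> m) * cis ((transpose B *v t) \<bullet> z) \<partial>std_normal_vec)"
    by (simp only: inner_add_right inner_matrix_vector cis_mult)
  also have "\<dots> = cis (t \<bullet> m) * (\<integral>z. cis ((transpose B *v t) \<bullet> z) \<partial>std_normal_vec)" by simp
  also have "(transpose B *v t) \<bullet> (transpose B *v t) = t \<bullet> (C *v t)"
    unfolding B[symmetric] inner_matrix_vector[symmetric] by (simp only: matrix_vector_mul_assoc)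
  then have "(\<integral>z. cis ((transpose B *v t) \<bullet> z) \<partial>std_normal_vec) = of_real (exp (- (t \<bullet> (C *v t)) / 2))"
    by (simp only: char_std_normal_vec)
  finally show ?thesis .
qed

lemma conv_in_law_cong:
  assumes "\<And>n w. n \<ge> n0 \<Longrightarrow> w \<in> space M \<Longrightarrow> X n w = Y n w" "conv_in_law M Y \<nu>"
  shows "conv_in_law M X \<nu>"
  unfolding conv_in_law_def weak_conv_borel_def
proof (intro allI impI)
  fix f :: "'b \<Rightarrow> real" assume f: "continuous_on UNIV f \<and> bounded (range f)"
  have "distr M borel (X n) = distr M borel (Y n)" if "n \<ge> n0" for n
    using assms(1)[OF that] by (intro distr_cong) auto
  then have ev: "\<forall>\<^sub>F n in sequentially. (\<integral>x. f x \<partial>distr M borel (Y n)) = (\<integral>x. f x \<partial>distr M borel (X n))"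
    by (intro eventually_mono[OF eventually_ge_at_top[of n0]]) simp
  have lim: "(\<lambda>n. \<integral>x. f x \<partial>distr M borel (Y n)) \<longlonglongrightarrow> (\<integral>x. f x \<partial>\<nu>)"
    using assms(2) f unfolding conv_in_law_def weak_conv_borel_def by blast
  show "(\<lambda>n. \<integral>x. f x \<partial>distr M borel (X n)) \<longlonglongrightarrow> (\<integral>x. f x \<partial>\<nu>)"
    by (rule Lim_transform_eventually[OF lim ev])
qed

lemma conv_in_L2_of_msq:
  assumes eq: "\<And>n w. n \<ge> n0 \<Longrightarrow> w \<in> space M \<Longrightarrow> X n w - Z w = Y n w"
    and sq: "\<And>n. n \<ge> n0 \<Longrightarrow> sq_int M (Y n)" and lim: "(\<lambda>n. msq M (Y n)) \<longlonglongrightarrow> 0"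
  shows "conv_in_L2 M X Z"
  unfolding conv_in_L2_def
proof (rule Lim_transform_eventually)
  show "(\<lambda>n. ennreal (msq M (Y n))) \<longlonglongrightarrow> 0" using tendsto_ennrealI[OF lim] by simp
  show "\<forall>\<^sub>F n in sequentially. ennreal (msq M (Y n)) = (\<integral>\<^sup>+w. ennreal ((norm (X n w - Z w))\<^sup>2) \<partial>M)"
    using eventually_ge_at_top[of n0]
  proof eventually_elim
    case (elim n)
    have "(\<integral>\<^sup>+w. ennreal ((norm (X n w - Z w))\<^sup>2) \<partial>M) = (\<integral>\<^sup>+w. ennreal ((norm (Y n w))\<^sup>2) \<partial>M)"
      using eq[OF elim] by (intro nn_integral_cong) simp
    also have "\<dots> = ennreal (msq M (Y n))"
      unfolding msq_def by (intro nn_integral_eq_integral sq_int_norm_sq[OF sq[OF elim]]) auto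
    finally show ?case by simp
  qed
qed

lemma msq_add_tendsto_zero:
  assumes "\<And>n. n \<ge> n0 \<Longrightarrow> sq_int M (f n)" "\<And>n. n \<ge> n0 \<Longrightarrow> sq_int M (g n)"
    and "(\<lambda>n. msq M (f n)) \<longlonglongrightarrow> 0" "(\<lambda>n. msq M (g n)) \<longlonglongrightarrow> 0"
  shows "(\<lambda>n. msq M (\<lambda>w. f n w + g n w)) \<longlonglongrightarrow> 0"
proof (rule tendsto_sandwich[OF _ _ tendsto_const])
  show "(\<lambda>n. 2 * msq M (f n) + 2 * msq M (g n)) \<longlonglongrightarrow> 0"
    using tendsto_add[OF tendsto_mult_left[OF assms(3), of 2] tendsto_mult_left[OF assms(4), of 2]] by simp
  show "\<forall>\<^sub>F n in sequentially. msq M (\<lambda>w. f n w + g n w) \<le> 2 * msq M (f n) + 2 * msq M (g n)"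
    by (intro eventually_mono[OF eventually_ge_at_top[of n0]] msq_add_le assms)
qed (simp add: msq_nonneg)

section \<open>Normalization by the previous step size and limits of the parts\<close>

context lpsa
begin

lemma \<eta>_prev_ratio: "(\<lambda>n. \<eta> n powr a / \<eta> (n - 1) powr a) \<longlonglongrightarrow> 1"
proof -
  have "(\<lambda>n. \<eta> (Suc n) powr a / \<eta> (Suc n - 1) powr a) \<longlonglongrightarrow> 1" using \<eta>_Suc_ratio by simp
  then show ?thesis by (rule LIMSEQ_imp_Suc)
qed

lemma msq_normalized:
  assumes "(\<lambda>n. msq M (f n)) \<in> o(\<lambda>n. \<eta> n powr (2 * \<rho>))"
  shows "(\<lambda>n. msq M (\<lambda>w. (1 / \<eta> (n - 1) powr \<rho>) *\<^sub>R f n w)) \<longlonglongrightarrow> 0"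
proof -
  have "(\<lambda>n. msq M (f n) / \<eta> n powr (2 * \<rho>) * (\<eta> n powr \<rho> / \<eta> (n - 1) powr \<rho>)\<^sup>2) \<longlonglongrightarrow> 0 * 1\<^sup>2"
    by (intro tendsto_intros smalloD_tendsto[OF assms] \<eta>_prev_ratio)
  then have "(\<lambda>n. msq M (f n) / \<eta> n powr (2 * \<rho>) * (\<eta> n powr \<rho> / \<eta> (n - 1) powr \<rho>)\<^sup>2) \<longlonglongrightarrow> 0" by simp
  then show ?thesis
  proof (rule Lim_transform_eventually)
    show "\<forall>\<^sub>F n in sequentially. msq M (f n) / \<eta> n powr (2 * \<rho>) * (\<eta> n powr \<rho> / \<eta> (n - 1) powr \<rho>)\<^sup>2 =
        msq M (\<lambda>w. (1 / \<eta> (n - 1) powr \<rho>) *\<^sub>R f n w)"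
      using ev_\<eta>_pos
    proof eventually_elim
      case (elim n)
      have "\<eta> n powr (2 * \<rho>) = (\<eta> n powr \<rho>)\<^sup>2"
        using powr_add[of "\<eta> n" \<rho> \<rho>] by (simp add: power2_eq_square)
      then show ?case using elim by (simp add: msq_scaleR power_divide)
    qed
  qed
qed

lemma drift_normalized:
  assumes "(\<lambda>n. norm (drift n - \<eta> n powr \<rho> *\<^sub>R m')) \<in> o(\<lambda>n. \<eta> n powr \<rho>)"
  shows "(\<lambda>n. (1 / \<eta> (n - 1) powr \<rho>) *\<^sub>R drift n) \<longlonglongrightarrow> m'"
proof -
  have "(\<lambda>n. norm (drift n - \<eta> n powr \<rho> *\<^sub>R m') / \<eta> n powr \<rho>) \<longlonglongrightarrow> 0" by (rule smalloD_tendsto[OF assms])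
  moreover have "\<forall>\<^sub>F n in sequentially. norm (drift n - \<eta> n powr \<rho> *\<^sub>R m') / \<eta> n powr \<rho> = norm ((1 / \<eta> n powr \<rho>) *\<^sub>R drift n - m')"
    using ev_\<eta>_pos
  proof eventually_elim
    case (elim n)
    have "(1 / \<eta> n powr \<rho>) *\<^sub>R drift n - m' = (1 / \<eta> n powr \<rho>) *\<^sub>R (drift n - \<eta> n powr \<rho> *\<^sub>R m')"
      using elim by (simp add: scaleR_diff_right)
    then have "norm ((1 / \<eta> n powr \<rho>) *\<^sub>R drift n - m') = \<bar>1 / \<eta> n powr \<rho>\<bar> * norm (drift n - \<eta> n powr \<rho> *\<^sub>R m')"
      by (metis norm_scaleR)
    then show ?case by simp
  qed
  ultimately have "(\<lambda>n. norm ((1 / \<eta> n powr \<rho>) *\<^sub>R drift n - m')) \<longlonglongrightarrow> 0" by (rule Lim_transform_eventually)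
  then have "(\<lambda>n. (1 / \<eta> n powr \<rho>) *\<^sub>R drift n - m') \<longlonglongrightarrow> 0" by (rule tendsto_norm_zero_cancel)
  then have "(\<lambda>n. (1 / \<eta> n powr \<rho>) *\<^sub>R drift n) \<longlonglongrightarrow> m'" by (rule LIM_zero_cancel)
  then have "(\<lambda>n. (\<eta> n powr \<rho> / \<eta> (n - 1) powr \<rho>) *\<^sub>R ((1 / \<eta> n powr \<rho>) *\<^sub>R drift n)) \<longlonglongrightarrow> 1 *\<^sub>R m'"
    by (intro tendsto_scaleR \<eta>_prev_ratio)
  then have "(\<lambda>n. (\<eta> n powr \<rho> / \<eta> (n - 1) powr \<rho>) *\<^sub>R ((1 / \<eta> n powr \<rho>) *\<^sub>R drift n)) \<longlonglongrightarrow> m'" by simp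
  then show ?thesis
    by (rule Lim_transform_eventually) (use ev_\<eta>_pos in \<open>eventually_elim; simp\<close>)
qed

lemma msq_const_tendsto: "y \<longlonglongrightarrow> z \<Longrightarrow> (\<lambda>n. msq M (\<lambda>w. y n - z)) \<longlonglongrightarrow> 0"
proof -
  assume y: "y \<longlonglongrightarrow> z"
  have "(\<lambda>n. (norm (y n - z))\<^sup>2) \<longlonglongrightarrow> (norm (z - z))\<^sup>2" by (intro tendsto_intros y)
  then show ?thesis by (simp add: msq_def prob_space)
qed

lemma err_split: "err n w = mart n w + (fluct n w + rest n w) + drift n"
  by (simp add: rest_def)

theorem err_L2:
  assumes \<rho>: "real k * \<tau> < 1 / 2"
    and m: "P *v m = m"
      "P *v (S *v m) - (of_bool (\<alpha> = 1) * (real k * \<tau>) / eta0) *\<^sub>R m = - ((- 1 / \<gamma>) ^ k) *\<^sub>R w0"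
  shows "(\<lambda>n. msq M (\<lambda>w. (1 / \<eta> (n - 1) powr (real k * \<tau>)) *\<^sub>R err n w - m)) \<longlonglongrightarrow> 0"
proof -
  let ?\<rho> = "real k * \<tau>"
  let ?c = "\<lambda>n. 1 / \<eta> (n - 1) powr ?\<rho>"
  \<comment> \<open>The bias is larger than the noise in this regime, so the martingale part
    vanishes after normalization.\<close>
  have \<theta>\<rho>: "\<theta> = ?\<rho>" using \<rho> by (simp add: \<theta>_def)
  have 1: "(\<lambda>n. msq M (\<lambda>w. ?c n *\<^sub>R mart n w)) \<longlonglongrightarrow> 0"
    by (intro msq_normalized bigo_powr_smallo[OF mart_msq]) (use \<rho> in simp)
  have 2: "(\<lambda>n. msq M (\<lambda>w. ?c n *\<^sub>R fluct n w)) \<longlonglongrightarrow> 0"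
    by (intro msq_normalized) (use fluct_msq in \<open>simp add: mult.assoc\<close>)
  have 3: "(\<lambda>n. msq M (\<lambda>w. ?c n *\<^sub>R rest n w)) \<longlonglongrightarrow> 0"
    by (intro msq_normalized) (use rest_msq \<theta>\<rho> in simp)
  have 4: "(\<lambda>n. msq M (\<lambda>w. ?c n *\<^sub>R drift n - m)) \<longlonglongrightarrow> 0"
    by (intro msq_const_tendsto drift_normalized drift_asymp m)
  have sq: "n \<ge> 1 \<Longrightarrow> sq_int M (\<lambda>w. ?c n *\<^sub>R mart n w)" "n \<ge> 1 \<Longrightarrow> sq_int M (\<lambda>w. ?c n *\<^sub>R fluct n w)"
    "n \<ge> 1 \<Longrightarrow> sq_int M (\<lambda>w. ?c n *\<^sub>R rest n w)" "n \<ge> 1 \<Longrightarrow> sq_int M (\<lambda>w. ?c n *\<^sub>R drift n - m)" for n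
    by (intro sq_int_scaleR mart_sq fluct_sq rest_sq sq_int_const; assumption)+
  have "(\<lambda>n. msq M (\<lambda>w. ?c n *\<^sub>R mart n w + ((?c n *\<^sub>R fluct n w + ?c n *\<^sub>R rest n w) + (?c n *\<^sub>R drift n - m)))) \<longlonglongrightarrow> 0"
    by (intro msq_add_tendsto_zero[of 1] sq_int_add sq 1 2 3 4)
  then show ?thesis by (simp add: err_split scaleR_add_right algebra_simps)
qed

end

context lpsa_clt
begin

text \<open>The vector m is left open: it is 0 when the drift is of smaller order than \<eta>^(1/2),
  and the bias vector when the orders coincide.\<close>

theorem err_law:
  assumes \<rho>: "1 / 2 \<le> real k * \<tau>"
    and drift: "(\<lambda>n. norm (drift n - \<eta> n powr (1 / 2) *\<^sub>R m)) \<in> o(\<lambda>n. \<eta> n powr (1 / 2))"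
  shows "conv_in_law M (\<lambda>n w. (1 / sqrt (\<eta> (n - 1))) *\<^sub>R err n w) (multi_normal m \<Sigma>t)"
proof -
  let ?c = "\<lambda>n. 1 / \<eta> (n - 1) powr (1 / 2)"
  have \<theta>h: "\<theta> = 1 / 2" using \<rho> by (simp add: \<theta>_def)
  have sqrt: "sqrt (\<eta> n) = \<eta> n powr (1 / 2)" if "n \<ge> 1" for n
    using \<eta>_pos[OF that] by (simp add: powr_half_sqrt)
  define X where "X n w = (1 / sqrt (\<eta> n)) *\<^sub>R mart n w" for n w
  \<comment> \<open>Everything that converges in L2, including the mismatch between normalizing the
    martingale by \<eta> at n - 1 and at n.\<close>
  define R where "R n w = (?c n - 1 / sqrt (\<eta> n)) *\<^sub>R mart n w + ((?c n *\<^sub>R fluct n w + ?c n *\<^sub>R rest n w) + ?c n *\<^sub>R drift n)" for n w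
  \<comment> \<open>From n = 2 on, n - 1 is an index at which \<open>\<eta>\<close> is given by its
    formula.\<close>
  have XR: "(1 / sqrt (\<eta> (n - 1))) *\<^sub>R err n w = X n w + R n w" if "n \<ge> 2" for n w
    using that unfolding X_def R_def err_split sqrt[of "n - 1", simplified]
    by (subst sqrt) (auto simp: algebra_simps)
  have Xsq: "sq_int M (X n)" if "n \<ge> 1" for n
    unfolding X_def[abs_def] by (intro sq_int_scaleR mart_sq that)
  have sq: "n \<ge> 1 \<Longrightarrow> sq_int M (\<lambda>w. a *\<^sub>R mart n w)" "n \<ge> 1 \<Longrightarrow> sq_int M (\<lambda>w. ?c n *\<^sub>R fluct n w)"
    "n \<ge> 1 \<Longrightarrow> sq_int M (\<lambda>w. ?c n *\<^sub>R rest n w)" "n \<ge> 1 \<Longrightarrow> sq_int M (\<lambda>w. ?c n *\<^sub>R drift n - m)"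
    "n \<ge> 1 \<Longrightarrow> sq_int M (\<lambda>w. ?c n *\<^sub>R drift n)" for n a
    by (intro sq_int_scaleR mart_sq fluct_sq rest_sq sq_int_const; assumption)+
  have Rsq: "sq_int M (R n)" if "n \<ge> 1" for n
    unfolding R_def[abs_def] by (intro sq_int_add sq that)
  have bounded: "\<exists>K. \<forall>\<^sub>F n in sequentially. msq M (X n) \<le> K"
  proof -
    obtain K where "\<forall>\<^sub>F n in sequentially. norm (msq M (mart n)) \<le> K * norm (\<eta> n powr 1)"
      using landau_o.bigE[OF mart_msq] by blast
    then have "\<forall>\<^sub>F n in sequentially. msq M (X n) \<le> K"
      using ev_\<eta>_pos
    proof eventually_elim
      case (elim n)
      have "msq M (X n) = msq M (mart n) / \<eta> n"
        using elim unfolding X_def[abs_def] msq_scaleR by (simp add: power_divide)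
      then show ?case using elim by (simp add: pos_divide_le_eq)
    qed
    then show ?thesis by blast
  qed
  then obtain K where K: "\<forall>\<^sub>F n in sequentially. msq M (X n) \<le> K" by blast
  have 1: "(\<lambda>n. msq M (\<lambda>w. (?c n - 1 / sqrt (\<eta> n)) *\<^sub>R mart n w)) \<longlonglongrightarrow> 0"
  proof -
    have "(\<lambda>n. (\<eta> n powr (1 / 2) / \<eta> (n - 1) powr (1 / 2) - 1)\<^sup>2 * K) \<longlonglongrightarrow> (1 - 1)\<^sup>2 * K"
      by (intro tendsto_intros \<eta>_prev_ratio)
    then have "(\<lambda>n. (\<eta> n powr (1 / 2) / \<eta> (n - 1) powr (1 / 2) - 1)\<^sup>2 * K) \<longlonglongrightarrow> 0" by simp
    then show ?thesis
    proof (rule tendsto_sandwich[OF _ _ tendsto_const, rotated 2])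
      show "\<forall>\<^sub>F n in sequentially. msq M (\<lambda>w. (?c n - 1 / sqrt (\<eta> n)) *\<^sub>R mart n w) \<le> (\<eta> n powr (1 / 2) / \<eta> (n - 1) powr (1 / 2) - 1)\<^sup>2 * K"
        using K eventually_ge_at_top[of 1]
      proof eventually_elim
        case (elim n)
        have pos: "0 < \<eta> n" using \<eta>_pos elim by simp
        have "(?c n - 1 / sqrt (\<eta> n)) *\<^sub>R mart n w = (\<eta> n powr (1 / 2) / \<eta> (n - 1) powr (1 / 2) - 1) *\<^sub>R X n w" for w
          using pos unfolding X_def by (simp add: powr_half_sqrt field_simps)
        then have "msq M (\<lambda>w. (?c n - 1 / sqrt (\<eta> n)) *\<^sub>R mart n w) = (\<eta> n powr (1 / 2) / \<eta> (n - 1) powr (1 / 2) - 1)\<^sup>2 * msq M (X n)"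
          by (simp only: msq_scaleR)
        then show ?case using elim by (simp add: mult_left_mono)
      qed
    qed (simp add: msq_nonneg)
  qed
  have 2: "(\<lambda>n. msq M (\<lambda>w. ?c n *\<^sub>R fluct n w)) \<longlonglongrightarrow> 0"
    by (intro msq_normalized landau_o.small_big_trans[OF fluct_msq \<eta>_powr_bigo]) (use \<rho> in simp)
  have 3: "(\<lambda>n. msq M (\<lambda>w. ?c n *\<^sub>R rest n w)) \<longlonglongrightarrow> 0"
    by (intro msq_normalized) (use rest_msq \<theta>h in simp)
  have 4: "(\<lambda>n. msq M (\<lambda>w. ?c n *\<^sub>R drift n - m)) \<longlonglongrightarrow> 0"
    by (intro msq_const_tendsto drift_normalized drift)
  have "(\<lambda>n. msq M (\<lambda>w. (?c n - 1 / sqrt (\<eta> n)) *\<^sub>R mart n w + ((?c n *\<^sub>R fluct n w + ?c n *\<^sub>R rest n w) + (?c n *\<^sub>R drift n - m)))) \<longlonglongrightarrow> 0"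
    by (intro msq_add_tendsto_zero[of 1] sq_int_add sq 1 2 3 4)
  then have R0: "(\<lambda>n. msq M (\<lambda>w. R n w - m)) \<longlonglongrightarrow> 0" by (simp add: R_def add_diff_eq)
  have char: "(\<lambda>n. expectation (\<lambda>w. cis (t \<bullet> (X n w + R n w)))) \<longlonglongrightarrow> (\<integral>z. cis (t \<bullet> z) \<partial>multi_normal m \<Sigma>t)" for t
    unfolding char_multi_normal[OF \<Sigma>t(1)]
  proof (rule char_add_L2[OF prob_space_axioms])
    show "(\<lambda>n. expectation (\<lambda>w. cis (t \<bullet> X n w))) \<longlonglongrightarrow> of_real (exp (- (t \<bullet> (\<Sigma>t *v t)) / 2))"
      unfolding X_def by (rule mart_clt)
    show "(\<lambda>n. expectation (\<lambda>w. (norm (R n w - m))\<^sup>2)) \<longlonglongrightarrow> 0" using R0 by (simp add: msq_def)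
    show "X n \<in> borel_measurable M" "R n \<in> borel_measurable M" if "n \<ge> 1" for n
      using Xsq[OF that] Rsq[OF that] by (auto simp: sq_int_def)
    show "integrable M (\<lambda>w. (norm (R n w - m))\<^sup>2)" if "n \<ge> 1" for n
      using sq_int_diff[OF Rsq[OF that] sq_int_const[of m]] by (simp add: sq_int_def)
  qed
  \<comment> \<open>Bounded second moments of the sum, from some index on, supply the
    tightness.\<close>
  have "\<forall>\<^sub>F n in sequentially. msq M (\<lambda>w. R n w - m) < 1" using R0 by (rule order_tendstoD) simp
  then have "\<forall>\<^sub>F n in sequentially. msq M (\<lambda>w. R n w - m) < 1 \<and> msq M (X n) \<le> K" using K by eventually_elim auto
  then obtain n0 where n0: "\<And>n. n \<ge> n0 \<Longrightarrow> msq M (\<lambda>w. R n w - m) < 1 \<and> msq M (X n) \<le> K"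
    unfolding eventually_sequentially by blast
  have XRsq: "sq_int M (\<lambda>w. X n w + R n w)" if "n \<ge> 1" for n by (intro sq_int_add Xsq Rsq that)
  have "conv_in_law M (\<lambda>n w. X n w + R n w) (multi_normal m \<Sigma>t)"
  proof (rule conv_in_law_of_char[OF prob_space_axioms, where ?n0.0 = "max 1 n0"])
    fix n assume n: "n \<ge> max 1 n0"
    then have n1: "n \<ge> 1" by simp
    show "(\<lambda>w. X n w + R n w) \<in> borel_measurable M" "integrable M (\<lambda>w. (norm (X n w + R n w))\<^sup>2)"
      using XRsq[OF n1] by (simp_all add: sq_int_def)
    have Rm: "sq_int M (\<lambda>w. R n w - m)" by (intro sq_int_diff Rsq n1 sq_int_const)
    have "msq M (\<lambda>w. X n w + ((R n w - m) + m)) \<le> 2 * msq M (X n) + 2 * (2 * msq M (\<lambda>w. R n w - m) + 2 * msq M (\<lambda>w. m))"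
      by (intro order_trans[OF msq_add_le] add_left_mono mult_left_mono msq_add_le sq_int_add Rm Xsq n1 sq_int_const) auto
    also have "\<dots> \<le> 2 * K + 2 * (2 * 1 + 2 * msq M (\<lambda>w. m))"
      using n0[of n] n by (intro add_mono mult_left_mono) auto
    finally show "(\<integral>w. (norm (X n w + R n w))\<^sup>2 \<partial>M) \<le> 2 * K + 2 * (2 * 1 + 2 * msq M (\<lambda>w. m))"
      by (simp add: msq_def)
  qed (simp_all add: prob_space_multi_normal char)
  then show ?thesis by (rule conv_in_law_cong[of 2, rotated]) (rule XR)
qed

end

section \<open>From the stochastic gradients to the conditional covariance\<close>

lemma cov_matrix_quadratic_form:
  fixes X :: "'z \<Rightarrow> real^'d"
  assumes D: "prob_space D" and X: "has_bochner_integral D X m" and sq: "integrable D (\<lambda>z. (norm (X z))\<^sup>2)"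
  shows "integrable D (\<lambda>z. (t \<bullet> (m - X z))\<^sup>2)" "(\<integral>z. (t \<bullet> (m - X z))\<^sup>2 \<partial>D) = t \<bullet> (cov_matrix D X *v t)"
proof -
  interpret D: prob_space D by fact
  have Xi: "integrable D X" and Xm: "(\<integral>z. X z \<partial>D) = m" using X by (auto simp: has_bochner_integral_iff)
  have Xsq: "sq_int D X" using Xi sq by (simp add: sq_int_def)
  define Y where "Y i z = X z $ i - m $ i" for i z
  have comp: "(\<integral>z. X z $ i \<partial>D) = m $ i" for i
    using integral_bounded_linear[OF bounded_linear_vec_nth Xi, of i] by (simp add: Xm)
  have Ysq: "sq_int D (Y i)" for i
  proof -
    have "sq_int D (\<lambda>z. X z $ i)"
      by (rule sq_int_bound[OF Xsq, of _ 1])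
         (use Xi integrable_bounded_linear[OF bounded_linear_vec_nth Xi] in \<open>auto simp: component_le_norm_cart\<close>)
    then show ?thesis unfolding Y_def[abs_def] by (intro sq_int_diff D.sq_int_const)
  qed
  have YY: "integrable D (\<lambda>z. Y i z * Y j z)" for i j
    using sq_int_inner_integrable[OF Ysq[of i] Ysq[of j]] by simp
  have cov: "cov_matrix D X $ i $ j = (\<integral>z. Y i z * Y j z \<partial>D)" for i j
    by (simp add: cov_matrix_def comp Y_def)
  have quad: "(t \<bullet> (m - X z))\<^sup>2 = (\<Sum>i\<in>UNIV. \<Sum>j\<in>UNIV. t $ i * t $ j * (Y i z * Y j z))" for z
  proof -
    have "t \<bullet> (m - X z) = - (\<Sum>i\<in>UNIV. t $ i * Y i z)"
      by (simp add: inner_vec_def Y_def sum_negf[symmetric] algebra_simps)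
    then show ?thesis by (simp add: power2_eq_square sum_product mult_ac)
  qed
  show "integrable D (\<lambda>z. (t \<bullet> (m - X z))\<^sup>2)"
    unfolding quad by (intro Bochner_Integration.integrable_sum integrable_mult_right YY)
  have "(\<integral>z. (t \<bullet> (m - X z))\<^sup>2 \<partial>D) = (\<Sum>i\<in>UNIV. \<Sum>j\<in>UNIV. t $ i * t $ j * cov_matrix D X $ i $ j)"
    unfolding quad cov using YY
    by (simp add: Bochner_Integration.integral_sum Bochner_Integration.integrable_sum)
  also have "\<dots> = t \<bullet> (cov_matrix D X *v t)"
    by (simp add: inner_vec_def matrix_vector_mult_def sum_distrib_left mult_ac)
  finally show "(\<integral>z. (t \<bullet> (m - X z))\<^sup>2 \<partial>D) = t \<bullet> (cov_matrix D X *v t)" .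
qed

lemma spectral_norm_quadratic_form: "\<bar>t \<bullet> (A *v t)\<bar> \<le> spectral_norm A * (norm (t :: real^'d))\<^sup>2"
proof -
  have "\<bar>t \<bullet> (A *v t)\<bar> \<le> norm t * norm (A *v t)" by (rule Cauchy_Schwarz_ineq2)
  also have "\<dots> \<le> norm t * (spectral_norm A * norm t)"
    unfolding spectral_norm_def by (intro mult_left_mono onorm matrix_vector_mul_bounded_linear) auto
  finally show ?thesis by (simp add: power2_eq_square mult_ac)
qed

text \<open>Transposing P T = T gives T P = T; hence on vectors t of the range all projections
  disappear except one, and the two halves of the equation have equal quadratic forms.\<close>

lemma lyapunov_quadratic_form:
  fixes P S T C :: "real^'d^'d"
  assumes P: "transpose P = P" "P ** P = P" and S: "transpose S = S" and T: "transpose T = T" "P ** T = T"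
    and lyap: "P ** (S - mat c) ** P ** T + T ** P ** (S - mat c) ** P = P ** C ** P"
    and t: "P *v t = t"
  shows "2 * ((P *v (S *v t)) \<bullet> (T *v t)) - 2 * c * (t \<bullet> (T *v t)) = t \<bullet> (C *v t)"
proof -
  have PT: "P *v (T *v z) = T *v z" and PP: "P *v (P *v z) = P *v z" for z
    by (simp_all add: matrix_vector_mul_assoc T P)
  have inP: "t \<bullet> (P *v z) = t \<bullet> z" for z
    using inner_matrix_vector[of t P z] P t by simp
  have TP: "T *v (P *v z) = T *v z" for z
  proof -
    have "transpose (P ** T) = T ** P" by (simp add: matrix_transpose_mul P(1) T(1))
    then have "T ** P = T" by (metis T)
    then show ?thesis by (simp add: matrix_vector_mul_assoc)
  qed
  have "t \<bullet> ((P ** (S - mat c) ** P ** T + T ** P ** (S - mat c) ** P) *v t) = t \<bullet> ((P ** C ** P) *v t)"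
    unfolding lyap ..
  moreover have "(P ** (S - mat c) ** P ** T) *v t = P *v (S *v (T *v t)) - c *\<^sub>R (T *v t)"
    "(T ** P ** (S - mat c) ** P) *v t = T *v (S *v t) - c *\<^sub>R (T *v t)" "(P ** C ** P) *v t = P *v (C *v t)"
    by (simp_all add: matrix_vector_mul_assoc[symmetric] matrix_vector_mult_diff_rdistrib
        mat_scaleR_vector matrix_vector_mult_diff_distrib matrix_vector_mult_scaleR t PT TP)
  ultimately have "t \<bullet> (S *v (T *v t)) - c * (t \<bullet> (T *v t)) + (t \<bullet> (T *v (S *v t)) - c * (t \<bullet> (T *v t))) = t \<bullet> (C *v t)"
    by (simp only: matrix_vector_mult_add_rdistrib inner_add_right inner_diff_right inner_scaleR_right inP)
  moreover have "t \<bullet> (S *v (T *v t)) = (P *v (S *v t)) \<bullet> (T *v t)"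
  proof -
    have "t \<bullet> (S *v (T *v t)) = (S *v t) \<bullet> (P *v (T *v t))" using inner_matrix_vector[of t S] S PT by simp
    also have "\<dots> = (P *v (S *v t)) \<bullet> (T *v t)" using inner_matrix_vector[of "S *v t" P "T *v t"] P by simp
    finally show ?thesis .
  qed
  moreover have "t \<bullet> (T *v (S *v t)) = (P *v (S *v t)) \<bullet> (T *v t)"
    using symmetric_inner[OF T(1), of t "P *v (S *v t)"] by (simp add: TP)
  ultimately show ?thesis by simp
qed

text \<open>As c lies strictly below all Rayleigh quotients of S, the compression of S - c to the
  range of P is positive definite there, and the pseudoinverse solves the linear equation
  exactly.\<close>

lemma bias_vector:
  fixes P S :: "real^'d^'d"
  assumes P: "transpose P = P" "P ** P = P" and c: "\<And>z. z \<noteq> 0 \<Longrightarrow> c * (z \<bullet> z) < z \<bullet> (S *v z)"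
    and w: "P *v w = w" and m: "m = \<kappa> *\<^sub>R (pinv (P ** (S - mat c) ** P) *v w)"
  shows "P *v m = m" "P *v (S *v m) - c *\<^sub>R m = \<kappa> *\<^sub>R w"
proof -
  let ?T = "P ** (S - mat c) ** P"
  have inP: "x \<bullet> (P *v z) = (P *v x) \<bullet> z" for x z
    using inner_matrix_vector[of x P z] P by simp
  have T1: "P ** ?T = ?T" by (simp add: matrix_mul_assoc P)
  have T2: "?T ** P = ?T" by (simp add: matrix_mul_assoc[symmetric] P)
  have Tv: "?T *v z = P *v (S *v z) - c *\<^sub>R z" if "P *v z = z" for z
    using that by (simp add: matrix_vector_mul_assoc[symmetric] matrix_vector_mult_diff_rdistrib
        mat_scaleR_vector matrix_vector_mult_diff_distrib matrix_vector_mult_scaleR)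
  have pos: "0 < x \<bullet> (?T *v x)" if "P *v x = x" "x \<noteq> 0" for x
    unfolding Tv[OF that(1)] using c[OF that(2)] that(1) by (simp add: inner_diff_right inP)
  note sol = pinv_solves[OF P T1 T2 pos w]
  show Pm: "P *v m = m" unfolding m by (simp add: matrix_vector_mult_scaleR sol)
  show "P *v (S *v m) - c *\<^sub>R m = \<kappa> *\<^sub>R w"
    unfolding Tv[OF Pm, symmetric] unfolding m by (simp add: matrix_vector_mult_scaleR sol)
qed



theorem theorem4p2:
  fixes S :: "real^'d^'d" and b :: "real^'d" and A :: "real^'m^'d"
    and P :: "real^'d^'d" and xstar x1 :: "real^'d" and k :: nat
    and eta0 \<gamma> \<alpha> \<beta> q :: real and \<eta> p :: "nat \<Rightarrow> real"
    and M :: "'a measure" and D :: "'z measure"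
    and g :: "real^'d \<Rightarrow> 'z \<Rightarrow> real^'d" and \<Sigma> :: "real^'d \<Rightarrow> real^'d^'d"
    and \<zeta> :: "nat \<Rightarrow> 'a \<Rightarrow> 'z" and \<omega> :: "nat \<Rightarrow> 'a \<Rightarrow> bool"
    and x x_half u \<xi> :: "nat \<Rightarrow> 'a \<Rightarrow> real^'d"
    and \<Sigma>t :: "real^'d^'d" and m :: "real^'d"
  \<comment> \<open>the problem\<close>
  assumes S: "spd S"
    and P: "P = proj_perp A"
    and xstar: "constrained_minimizer A S b xstar"
    and deg: "degenerate_order A S b xstar k" and k: "k \<ge> 1"
  \<comment> \<open>stochastic gradients \<open>g x z\<close> of the objective, \<open>z\<close> drawn from \<open>D\<close>\<close>
    and g_meas: "(\<lambda>(y, z). g y z) \<in> borel_measurable (borel \<Otimes>\<^sub>M D)"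
    and g_unbiased: "\<And>y. has_bochner_integral D (g y) (S *v y - b)"
    and g_sq: "\<And>y. integrable D (\<lambda>z. (norm (g y z))\<^sup>2)"
    and \<Sigma>: "\<And>y. \<Sigma> y = cov_matrix D (g y)"
    and \<Sigma>_lip: "\<exists>L. \<forall>y z. spectral_norm (\<Sigma> y - \<Sigma> z) \<le> L * norm (y - z)"
  \<comment> \<open>step sizes and projection probabilities\<close>
    and eta0: "eta0 > 0" "eta0 > 2 * real k * of_bool (\<alpha> = 1) / lambda_min S"
    and \<gamma>: "\<gamma> > 0" and \<alpha>: "0 < \<alpha>" "\<alpha> \<le> 1" and \<beta>: "0 \<le> \<beta>" "\<beta> < 1"
    and \<eta>: "\<And>n. n \<ge> 1 \<Longrightarrow> \<eta> n = eta0 * real n powr (- \<alpha>)"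
    and p: "\<And>n. n \<ge> 1 \<Longrightarrow> p n = min (\<gamma> * \<eta> n powr \<beta>) 1"
  \<comment> \<open>randomness\<close>
    and M: "prob_space M"
    and \<zeta>_meas: "\<And>n. n \<ge> 1 \<Longrightarrow> \<zeta> n \<in> measurable M D"
    and \<zeta>_distr: "\<And>n. n \<ge> 1 \<Longrightarrow> distr M D (\<zeta> n) = D"
    and \<omega>_meas: "\<And>n. n \<ge> 1 \<Longrightarrow> \<omega> n \<in> measurable M (count_space UNIV)"
    and \<omega>_distr: "\<And>n. n \<ge> 1 \<Longrightarrow>
           distr M (count_space UNIV) (\<omega> n) = measure_pmf (bernoulli_pmf (p n))"
    and indep: "prob_space.indep_sets M (joint_events M D \<zeta> \<omega>) ({1..} <+> {1..})"
  \<comment> \<open>the LPSA iterates\<close>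
    and x_1: "\<And>w. w \<in> space M \<Longrightarrow> x 1 w = x1"
    and \<xi>: "\<And>n w. n \<ge> 1 \<Longrightarrow> w \<in> space M \<Longrightarrow> \<xi> n w = (S *v x n w - b) - g (x n w) (\<zeta> n w)"
    and x_half: "\<And>n w. n \<ge> 1 \<Longrightarrow> w \<in> space M \<Longrightarrow>
           x_half n w = x n w - \<eta> n *\<^sub>R (S *v x n w - b) + \<eta> n *\<^sub>R \<xi> n w"
    and x_Suc: "\<And>n w. n \<ge> 1 \<Longrightarrow> w \<in> space M \<Longrightarrow>
           x (Suc n) w = (if \<omega> n w then P *v x_half n w else x_half n w)"
    and u: "\<And>n w. n \<ge> 1 \<Longrightarrow> w \<in> space M \<Longrightarrow> u n w = P *v x n w"
    and q: "q > 2"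
    and \<xi>_moment: "(SUP n\<in>{1..}. \<integral>\<^sup>+w. ennreal (norm (\<xi> n w) powr q) \<partial>M) < \<infinity>"
  \<comment> \<open>the limits\<close>
    and \<Sigma>t: "psd \<Sigma>t" "P ** \<Sigma>t = \<Sigma>t"
    and lyapunov:
      "P ** (S - mat (of_bool (\<alpha> = 1) / (2 * eta0))) ** P ** \<Sigma>t
       + \<Sigma>t ** P ** (S - mat (of_bool (\<alpha> = 1) / (2 * eta0))) ** P = P ** \<Sigma> xstar ** P"
    and m: "m = ((- 1) ^ (k + 1) / \<gamma> ^ k) *\<^sub>R
      (pinv (P ** (S - mat (real k * (1 - \<beta>) / eta0 * of_bool (\<alpha> = 1))) ** P)
        *v (P *v (matpow S k *v (S *v xstar - b))))"
  shows "(0 < \<beta> \<and> \<beta> < 1 - 1 / (2 * real k) \<longrightarrow>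
           conv_in_law M (\<lambda>n w. (1 / sqrt (\<eta> (n - 1))) *\<^sub>R (u n w - xstar)) (multi_normal 0 \<Sigma>t))
       \<and> (1 - 1 / (2 * real k) < \<beta> \<and> \<beta> < 1 \<longrightarrow>
           conv_in_L2 M (\<lambda>n w. (1 / \<eta> (n - 1) powr (real k * (1 - \<beta>))) *\<^sub>R (u n w - xstar)) (\<lambda>_. m)
           \<and> m \<noteq> 0)
       \<and> (\<beta> = 1 - 1 / (2 * real k) \<longrightarrow>
           conv_in_law M (\<lambda>n w. (1 / sqrt (\<eta> (n - 1))) *\<^sub>R (u n w - xstar)) (multi_normal m \<Sigma>t))"
proof (cases "\<beta> = 0")
  case True
  \<comment> \<open>The critical exponent is at least 1/2, so \<beta> = 0 falls into none of the
    three cases.\<close>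
  have "1 - 1 / (2 * real k) \<ge> 1 / 2" using k by (simp add: field_simps)
  then show ?thesis using True by auto
next
  case False
  then have \<beta>0: "0 < \<beta>" using \<beta> by simp
  interpret M: prob_space M by fact
  have D: "prob_space D" using M.prob_space_distr[OF \<zeta>_meas[of 1]] \<zeta>_distr[of 1] by simp
  have S_sym: "transpose S = S" using S by (simp add: spd_def)
  have P_sym: "transpose P = P" and P_idem: "P ** P = P"
    unfolding P by (rule proj_perp_sym proj_perp_idem)+
  have "transpose A *v xstar = 0"
    using xstar by (simp add: constrained_minimizer_def is_arg_min_def)
  then have P_xstar: "P *v xstar = xstar" unfolding P by (rule proj_perp_kernel)
  have deg_k: "P *v (matpow S k *v (S *v xstar - b)) \<noteq> 0"
    using deg unfolding degenerate_order_def P by blast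
  have lmin: "0 < lambda_min S" by (rule lambda_min_spd(1)[OF S])
  have lmin_gt: "2 * real k * of_bool (\<alpha> = 1) / eta0 < lambda_min S"
  proof -
    have "2 * real k * of_bool (\<alpha> = 1) < eta0 * lambda_min S" using eta0 lmin by (simp add: pos_divide_less_eq)
    then show ?thesis using eta0 by (simp add: pos_divide_less_eq mult.commute)
  qed
  \<comment> \<open>The room between 2k / \<open>eta0\<close> (for \<alpha> = 1) and the smallest
    eigenvalue is split: the part above \<mu> goes to \<open>S_coercive\<close>, the part below to
    \<open>crit\<close>.\<close>
  then obtain \<mu> where \<mu>: "2 * real k * of_bool (\<alpha> = 1) / eta0 < \<mu>" "\<mu> < lambda_min S" using dense by blast
  have \<mu>0: "0 < \<mu>" using \<mu>(1) eta0 by (intro le_less_trans[OF _ \<mu>(1)]) auto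
  have \<eta>_pos: "0 < \<eta> n" if "n \<ge> 1" for n using \<eta>[OF that] eta0 that by simp
  obtain C where C: "\<forall>n\<ge>1. (\<integral>\<^sup>+w. ennreal (norm (\<xi> n w) powr q) \<partial>M) \<le> ennreal C"
  proof -
    let ?s = "SUP n\<in>{1..}. \<integral>\<^sup>+w. ennreal (norm (\<xi> n w) powr q) \<partial>M"
    have "ennreal (enn2real ?s) = ?s" using \<xi>_moment by (simp add: less_top)
    moreover have "(\<integral>\<^sup>+w. ennreal (norm (\<xi> n w) powr q) \<partial>M) \<le> ?s" if "n \<ge> 1" for n
      using that by (intro SUP_upper) auto
    ultimately show ?thesis using that[of "enn2real ?s"] by simp
  qed
  have lip: "\<exists>C. \<forall>y t. \<bar>t \<bullet> (\<Sigma> y *v t) - t \<bullet> (\<Sigma> xstar *v t)\<bar> \<le> C * norm (y - xstar) * (norm t)\<^sup>2"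
  proof -
    obtain Lc where Lc: "\<And>y z. spectral_norm (\<Sigma> y - \<Sigma> z) \<le> Lc * norm (y - z)" using \<Sigma>_lip by blast
    have "\<bar>t \<bullet> (\<Sigma> y *v t) - t \<bullet> (\<Sigma> xstar *v t)\<bar> \<le> Lc * norm (y - xstar) * (norm t)\<^sup>2" for y t
      using spectral_norm_quadratic_form[of t "\<Sigma> y - \<Sigma> xstar"]
        mult_right_mono[OF Lc[of y xstar], of "(norm t)\<^sup>2"]
      by (simp add: matrix_vector_mult_diff_rdistrib inner_diff_right)
    then show ?thesis by blast
  qed
  interpret lpsa_clt M D \<zeta> \<omega> p \<eta> eta0 \<alpha> S P b xstar x1 k \<mu> \<gamma> \<beta> q g x \<Sigma> \<Sigma>t
  proof unfold_locales
    show "0 \<le> p n \<and> p n \<le> 1" if "n \<ge> 1" for n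
      using p[OF that] \<gamma> by simp
    show "\<exists>\<mu>'>\<mu>. \<forall>z. \<mu>' * (z \<bullet> z) \<le> z \<bullet> (S *v z)" using \<mu>(2) lambda_min_spd(2)[OF S] by blast
    show "P *v (matpow S i *v (S *v xstar - b)) = 0" if "i < k" for i
      using deg that unfolding degenerate_order_def P by blast
    show "2 * real k < \<mu> * eta0" if "\<alpha> = 1" using \<mu>(1) eta0 that by (simp add: pos_divide_less_eq)
    show "x (Suc n) w = (if \<omega> n w then P *v (x n w - \<eta> n *\<^sub>R g (x n w) (\<zeta> n w)) else x n w - \<eta> n *\<^sub>R g (x n w) (\<zeta> n w))"
      if "n \<ge> 1" "w \<in> space M" for n w
    proof -
      have "x_half n w = x n w - \<eta> n *\<^sub>R g (x n w) (\<zeta> n w)"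
        unfolding x_half[OF that] \<xi>[OF that] by (simp add: algebra_simps)
      then show ?thesis using x_Suc[OF that] by simp
    qed
    have "(\<integral>\<^sup>+w. ennreal (norm ((S *v x n w - b) - g (x n w) (\<zeta> n w)) powr q) \<partial>M) \<le> ennreal C" if "n \<ge> 1" for n
    proof -
      have "(\<integral>\<^sup>+w. ennreal (norm ((S *v x n w - b) - g (x n w) (\<zeta> n w)) powr q) \<partial>M) = (\<integral>\<^sup>+w. ennreal (norm (\<xi> n w) powr q) \<partial>M)"
        using \<xi>[OF that] by (intro nn_integral_cong) simp
      then show ?thesis using C that by simp
    qed
    then show "\<exists>C. \<forall>n\<ge>1. (\<integral>\<^sup>+w. ennreal (norm ((S *v x n w - b) - g (x n w) (\<zeta> n w)) powr q) \<partial>M) \<le> ennreal C"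
      by blast
    show "integrable D (\<lambda>z. (t \<bullet> ((S *v y - b) - g y z))\<^sup>2)"
      "(\<integral>z. (t \<bullet> ((S *v y - b) - g y z))\<^sup>2 \<partial>D) = t \<bullet> (\<Sigma> y *v t)" for y t
      unfolding \<Sigma> by (rule cov_matrix_quadratic_form[OF D g_unbiased g_sq])+
    show "2 * ((P *v (S *v t)) \<bullet> (\<Sigma>t *v t)) - of_bool (\<alpha> = 1) / eta0 * (t \<bullet> (\<Sigma>t *v t)) = t \<bullet> (\<Sigma> xstar *v t)"
      if "P *v t = t" for t
      using lyapunov_quadratic_form[OF P_sym P_idem S_sym _ \<Sigma>t(2) lyapunov that] \<Sigma>t(1) by (simp add: psd_def)
  qed fact+
  have w0: "w0 = P *v (matpow S k *v (S *v xstar - b))" by (simp add: w0_def kry_def)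
  have w0_ne: "w0 \<noteq> 0" using deg_k unfolding w0 .
  define c where "c = real k * (1 - \<beta>) / eta0 * of_bool (\<alpha> = 1)"
  have c_eq: "c = of_bool (\<alpha> = 1) * (real k * \<tau>) / eta0" by (simp add: c_def \<tau>_def)
  have c_less: "c * (z \<bullet> z) < z \<bullet> (S *v z)" if "z \<noteq> 0" for z
  proof -
    \<comment> \<open>The shift in the matrix of m is at most half of the bound that
      \<open>eta0\<close> guarantees, since \<tau> < 1; the crude factor 2 is enough.\<close>
    have "real k * \<tau> \<le> real k * 2" using \<tau> by (intro mult_left_mono) auto
    then have "c \<le> 2 * real k * of_bool (\<alpha> = 1) / eta0"
      unfolding c_eq using eta0 by (auto intro!: divide_right_mono)
    then have "c * (z \<bullet> z) < lambda_min S * (z \<bullet> z)" using lmin_gt that by (intro mult_strict_right_mono) auto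
    then show ?thesis using lambda_min_spd(2)[OF S, of z] by linarith
  qed
  have \<kappa>: "(- 1) ^ (k + 1) / \<gamma> ^ k = - ((- 1 / \<gamma>) ^ k)"
    unfolding power_divide by simp
  have m_eq: "P *v m = m" "P *v (S *v m) - (of_bool (\<alpha> = 1) * (real k * \<tau>) / eta0) *\<^sub>R m = - ((- 1 / \<gamma>) ^ k) *\<^sub>R w0"
    unfolding c_eq[symmetric] \<kappa>[symmetric]
    by (rule bias_vector[OF P_sym P_idem _ P_w0 m[folded c_def w0]], erule c_less)+
  have u_err: "u n w - xstar = err n w" if "n \<ge> 1" "w \<in> space M" for n w
    using u[OF that] by (simp add: err_def)
  \<comment> \<open>The three regimes compare the exponent k * \<tau> of the bias with the exponent
    1/2 of the noise.\<close>
  have k\<tau>: "\<beta> < 1 - 1 / (2 * real k) \<longleftrightarrow> 1 / 2 < real k * \<tau>" "1 - 1 / (2 * real k) < \<beta> \<longleftrightarrow> real k * \<tau> < 1 / 2"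
    "\<beta> = 1 - 1 / (2 * real k) \<longleftrightarrow> real k * \<tau> = 1 / 2"
    using k by (auto simp: \<tau>_def field_simps)
  have law: "conv_in_law M (\<lambda>n w. (1 / sqrt (\<eta> (n - 1))) *\<^sub>R (u n w - xstar)) (multi_normal m' \<Sigma>t)"
    if "1 / 2 \<le> real k * \<tau>" "(\<lambda>n. norm (drift n - \<eta> n powr (1 / 2) *\<^sub>R m')) \<in> o(\<lambda>n. \<eta> n powr (1 / 2))" for m'
    by (rule conv_in_law_cong[OF _ err_law[OF that], where ?n0.0 = 1]) (simp add: u_err)
  note drift = drift_asymp[OF m_eq]
  show ?thesis
  proof (intro conjI impI; (elim conjE)?)
    assume "\<beta> < 1 - 1 / (2 * real k)"
    then have lt: "1 / 2 < real k * \<tau>" by (simp add: k\<tau>)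
    \<comment> \<open>The drift has order \<eta>^(k * \<tau>), which is o(\<eta>^(1/2)) here, so the
      limit law is centred.\<close>
    have "(\<lambda>n. norm (drift n - \<eta> n powr (real k * \<tau>) *\<^sub>R m) + norm m * \<eta> n powr (real k * \<tau>)) \<in> O(\<lambda>n. \<eta> n powr (real k * \<tau>))"
      by (intro sum_in_bigo landau_o.small_imp_big[OF drift]) auto
    moreover have "(\<lambda>n. norm (drift n)) \<in> O(\<lambda>n. norm (drift n - \<eta> n powr (real k * \<tau>) *\<^sub>R m) + norm m * \<eta> n powr (real k * \<tau>))"
    proof (rule bigoI[of _ 1], rule always_eventually, rule allI)
      fix n
      have "norm (drift n) \<le> norm (drift n - \<eta> n powr (real k * \<tau>) *\<^sub>R m) + norm (\<eta> n powr (real k * \<tau>) *\<^sub>R m)"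
        using norm_triangle_ineq[of "drift n - \<eta> n powr (real k * \<tau>) *\<^sub>R m" "\<eta> n powr (real k * \<tau>) *\<^sub>R m"] by simp
      then show "norm (norm (drift n)) \<le> 1 * norm (norm (drift n - \<eta> n powr (real k * \<tau>) *\<^sub>R m) + norm m * \<eta> n powr (real k * \<tau>))"
        by (simp add: mult.commute)
    qed
    ultimately have "(\<lambda>n. norm (drift n)) \<in> O(\<lambda>n. \<eta> n powr (real k * \<tau>))" by (rule landau_o.big.trans[rotated])
    then have "(\<lambda>n. norm (drift n)) \<in> o(\<lambda>n. \<eta> n powr (1 / 2))" using lt by (rule bigo_powr_smallo)
    then show "conv_in_law M (\<lambda>n w. (1 / sqrt (\<eta> (n - 1))) *\<^sub>R (u n w - xstar)) (multi_normal 0 \<Sigma>t)"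
      using lt by (intro law) auto
  next
    assume "1 - 1 / (2 * real k) < \<beta>"
    then have lt: "real k * \<tau> < 1 / 2" by (simp add: k\<tau>)
    show "conv_in_L2 M (\<lambda>n w. (1 / \<eta> (n - 1) powr (real k * (1 - \<beta>))) *\<^sub>R (u n w - xstar)) (\<lambda>_. m)"
    proof (rule conv_in_L2_of_msq[OF _ _ err_L2[OF lt m_eq], where ?n0.0 = 1])
      show "sq_int M (\<lambda>w. (1 / \<eta> (n - 1) powr (real k * \<tau>)) *\<^sub>R err n w - m)" if "n \<ge> 1" for n
        by (intro sq_int_diff sq_int_scaleR err_sq that M.sq_int_const)
    qed (simp add: u_err \<tau>_def)
  next
    \<comment> \<open>For m = 0 the equation of m would give w0 = 0, which the degenerate order
      excludes.\<close>
    have "m \<noteq> 0 \<or> w0 = 0" using m_eq(2) \<gamma> by auto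
    then show "m \<noteq> 0" using w0_ne by simp
  next
    assume "\<beta> = 1 - 1 / (2 * real k)"
    then have eq: "real k * \<tau> = 1 / 2" by (simp only: k\<tau>)
    show "conv_in_law M (\<lambda>n w. (1 / sqrt (\<eta> (n - 1))) *\<^sub>R (u n w - xstar)) (multi_normal m \<Sigma>t)"
      using drift unfolding eq by (intro law) (simp_all add: eq)
  qed
qed

end
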